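(* Consider sequences, indexed by $n$, of $p,k\in\mathbb{N}$ (with $1\le k\le p$), $\sigma>0$, $\tau>0$. For each $n$, let $(y_i,x_i)_{i=1}^n$ be i.i.d. from the model $y_i=x_i^T\beta+\sigma z_i$ with $x_i\sim\mathcal{N}(0,\frac1n I_p)$, $z_i\sim\mathcal{N}(0,1)$ independent of $x_i$, and $\beta\in\mathbb{R}^p$ fixed. Let $$\Theta(k,\tau)=\{\beta\in\mathbb{R}^p:\|\beta\|_0\le k,\ \|\beta\|_2^2\le k\tau^2\},\qquad R(\Theta(k,\tau),\sigma)=\inf_{\hat\beta}\sup_{\beta\in\Theta(k,\tau)}\mathbb{E}_\beta\|\hat\beta-\beta\|_2^2 .$$ Suppose $k/p\to0$, $\tau/\sigma\to\infty$ and $\tau/\sigma=o(\sqrt{\log(p/k)})$. (i) If $(\log(p/k))/n\to0$ and $\tau^4/(n\sigma^4)\to0$, then $$R(\Theta(k,\tau),\sigma)\ \ge\ k\tau^2\Big(1-\frac{1+o(1)}{2}\cdot\frac kp\cdot e^{\tau^2/\sigma^2}\Big).$$ (ii) If $(k(\log(p/k))^2)/n\to0$ and there exists a constant $\alpha>0$ such that $(p/k)^\alpha\le n$, then the estimator $$\hat\beta^E(\lambda,\gamma)\in\arg\min_{b\in\mathbb{R}^p}\Big\|\sum_{i=1}^ny_ix_i-b\Big\|_2^2+\lambda\|b\|_1+\gamma\|b\|_2^2$$ with tuning $\lambda=4\tau$, $\gamma=\frac{p\sigma^2}{2k\tau^2}e^{-\frac{3\tau^2}{2\sigma^2}}-1$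 satisfies $$\sup_{\beta\in\Theta(k,\tau)}\mathbb{E}_\beta\|\hat\beta^E(\lambda,\gamma)-\beta\|_2^2\ \le\ k\tau^2\Big(1-\frac{2+o(1)}{\sqrt{2\pi}}\cdot\frac kp\cdot\frac{\sigma}{\tau}e^{\tau^2/\sigma^2}\Big).$$
   Context: All asymptotics are as $n\to\infty$ and $p\to\infty$; the quantities $k,p,\sigma,\tau$ may all depend on $n$. $\|\beta\|_0$ is the number of nonzero entries of $\beta$, $\|\cdot\|_1,\|\cdot\|_2$ are the $\ell_1$ and Euclidean norms. $\mathbb{E}_\beta$ denotes expectation under the model with true parameter $\beta$. The infimum is over all estimators $\hat\beta$, i.e. measurable functions of the data $(y_i,x_i)_{i=1}^n$ with values in $\mathbb{R}^p$ (allowed to depend on $k,\tau,\sigma$). $a_n=o(b_n)$ means $a_n/b_n\to0$. *)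

theory Defs
  imports "HOL-Probability.Probability"
begin

text \<open>
  As the dimension varies with the sample size, \<open>\<real>\<^sup>p\<close> is represented by the extensional functions
  \<open>{..<p} \<rightarrow>\<^sub>E UNIV\<close>, i.e. the space of \<open>borel_vec p\<close>. A data point is a pair \<open>(y, x)\<close>, and a data
  set \<open>D\<close> maps each \<open>i < n\<close> to the pair \<open>(y\<^sub>i, x\<^sub>i)\<close>.
\<close>

definition borel_vec :: "nat \<Rightarrow> (nat \<Rightarrow> real) measure" where
  "borel_vec p = PiM {..<p} (\<lambda>_. borel)"

definition data_space :: "nat \<Rightarrow> nat \<Rightarrow> (nat \<Rightarrow> real \<times> (nat \<Rightarrow> real)) measure" where
  "data_space n p = PiM {..<n} (\<lambda>_. borel \<Otimes>\<^sub>M borel_vec p)"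

text \<open>The second parameter is the variance, whereas \<open>normal_density\<close> takes the standard deviation.\<close>

definition normal_measure :: "real \<Rightarrow> real \<Rightarrow> real measure" where
  "normal_measure m v = density lborel (\<lambda>t. ennreal (normal_density m (sqrt v) t))"

definition obs_law :: "nat \<Rightarrow> nat \<Rightarrow> real \<Rightarrow> (nat \<Rightarrow> real) \<Rightarrow> (real \<times> (nat \<Rightarrow> real)) measure" where
  "obs_law n p \<sigma> \<beta> =
     distr (PiM {..<p} (\<lambda>_. normal_measure 0 (1 / real n)) \<Otimes>\<^sub>M normal_measure 0 1)
           (borel \<Otimes>\<^sub>M borel_vec p)
           (\<lambda>(x, z). ((\<Sum>j<p. x j * \<beta> j) + \<sigma> * z, x))"

definition data_law ::
    "nat \<Rightarrow> nat \<Rightarrow> real \<Rightarrow> (nat \<Rightarrow> real) \<Rightarrow> (nat \<Rightarrow> real \<times> (nat \<Rightarrow> real)) measure" where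
  "data_law n p \<sigma> \<beta> = PiM {..<n} (\<lambda>_. obs_law n p \<sigma> \<beta>)"

definition param_set :: "nat \<Rightarrow> nat \<Rightarrow> real \<Rightarrow> (nat \<Rightarrow> real) set" where
  "param_set p k \<tau> =
     {\<beta> \<in> {..<p} \<rightarrow>\<^sub>E UNIV. card {j. j < p \<and> \<beta> j \<noteq> 0} \<le> k \<and> (L2_set \<beta> {..<p})\<^sup>2 \<le> real k * \<tau>\<^sup>2}"

definition estimators :: "nat \<Rightarrow> nat \<Rightarrow> ((nat \<Rightarrow> real \<times> (nat \<Rightarrow> real)) \<Rightarrow> nat \<Rightarrow> real) set" where
  "estimators n p = measurable (data_space n p) (borel_vec p)"

definition risk ::
    "nat \<Rightarrow> nat \<Rightarrow> real \<Rightarrow> ((nat \<Rightarrow> real \<times> (nat \<Rightarrow> real)) \<Rightarrow> nat \<Rightarrow> real) \<Rightarrow> (nat \<Rightarrow> real) \<Rightarrow> ennreal" where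
  "risk n p \<sigma> h \<beta> =
     (\<integral>\<^sup>+ D. ennreal ((L2_set (\<lambda>j. h D j - \<beta> j) {..<p})\<^sup>2) \<partial>data_law n p \<sigma> \<beta>)"

definition max_risk ::
    "nat \<Rightarrow> nat \<Rightarrow> nat \<Rightarrow> real \<Rightarrow> real \<Rightarrow> ((nat \<Rightarrow> real \<times> (nat \<Rightarrow> real)) \<Rightarrow> nat \<Rightarrow> real) \<Rightarrow> ennreal" where
  "max_risk n p k \<tau> \<sigma> h = (SUP \<beta>\<in>param_set p k \<tau>. risk n p \<sigma> h \<beta>)"

definition minimax_risk :: "nat \<Rightarrow> nat \<Rightarrow> nat \<Rightarrow> real \<Rightarrow> real \<Rightarrow> ennreal" where
  "minimax_risk n p k \<tau> \<sigma> = (INF h\<in>estimators n p. max_risk n p k \<tau> \<sigma> h)"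

definition enet_objective ::
    "nat \<Rightarrow> nat \<Rightarrow> real \<Rightarrow> real \<Rightarrow> (nat \<Rightarrow> real \<times> (nat \<Rightarrow> real)) \<Rightarrow> (nat \<Rightarrow> real) \<Rightarrow> real" where
  "enet_objective n p l g D b =
     (L2_set (\<lambda>j. (\<Sum>i<n. fst (D i) * snd (D i) j) - b j) {..<p})\<^sup>2
     + l * (\<Sum>j<p. \<bar>b j\<bar>) + g * (L2_set b {..<p})\<^sup>2"

definition enet_estimators ::
    "nat \<Rightarrow> nat \<Rightarrow> real \<Rightarrow> real \<Rightarrow> ((nat \<Rightarrow> real \<times> (nat \<Rightarrow> real)) \<Rightarrow> nat \<Rightarrow> real) set" where
  "enet_estimators n p l g =
     {h \<in> estimators n p. \<forall>D \<in> space (data_space n p).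
        is_arg_min (enet_objective n p l g D) (\<lambda>b. b \<in> {..<p} \<rightarrow>\<^sub>E UNIV) (h D)}"

end

theory Submission
  imports Defs "HOL-Real_Asymp.Real_Asymp"
begin

text \<open>
  Write \<open>u = \<tau>/\<sigma>\<close>. Lower bound: cut the coordinates into \<open>k\<close> blocks of length \<open>m = p div k\<close>, put one spike
  \<open>\<plusminus>\<tau>\<close> at a uniform position of each block, and reveal all blocks but one. The Bayes risk of the remaining
  block is \<open>\<tau>\<^sup>2\<close> minus the second moment of the posterior mean. After the change of measure to the absence
  of the spike, and given the noise, the likelihood ratios of the \<open>m\<close> columns are i.i.d.; hence the normalising
  sum concentrates and the second moment is about \<open>\<tau>\<^sup>2 exp (u\<^sup>2) / (2 m)\<close>. All moments are Gaussian integrals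
  in the noise and stay controlled because \<open>u\<^sup>4/n \<longlonglongrightarrow> 0\<close>.

  Upper bound: the objective is separable and its minimiser is the soft-thresholded score, shrunk by
  \<open>\<theta> = 1/(1+\<gamma>)\<close>. Given the \<open>j\<close>-th column \<open>x\<close>, the score is normal with mean \<open>\<beta>\<^sub>j \<parallel>x\<parallel>\<^sup>2\<close> and a variance of
  about \<open>\<sigma>\<^sup>2 \<parallel>x\<parallel>\<^sup>2\<close>. The mean of a soft-thresholded normal variable is an odd function of \<open>b\<close>, convex for
  \<open>b \<ge> 0\<close>, so \<open>b\<close> times this mean is convex in \<open>b\<^sup>2\<close>: under the constraint on \<open>\<parallel>\<beta>\<parallel>\<^sup>2\<close> the worst case is
  \<open>\<bar>\<beta>\<^sub>j\<bar> = \<tau>\<close> on \<open>k\<close> coordinates. Mills-ratio asymptotics then give the two leading terms \<open>4\<close> (gain on the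
  support) and \<open>2\<close> (loss off the support), whose difference is the constant of the theorem.
\<close>

section \<open>Gaussian integrals\<close>

text \<open>The tuning comes from optimising the upper bound. With threshold t and shrinkage
  \<theta>, the risk is k \<tau>^2 minus a gain linear in \<theta>, governed by the normal density
  at (t - \<tau>) / \<sigma>, plus a loss quadratic in \<theta>, governed by the density at t /
  \<sigma>. Minimising over \<theta> leaves a multiple of gain^2 / loss, whose exponent (-(t -
  \<tau>)^2 + t^2 / 2) / \<sigma>^2 is largest at t = 2 \<tau>; this is \<lambda> / 2, and the
  maximum is u^2. To leading order the minimising \<theta> is 2 u^2 exp (3 u^2 / 2) k / p, which is
  exactly 1 / (1 + \<gamma>); at the minimum the linear term is twice the quadratic one, hence 4
  against 2. An obstacle shared by both halves is that the model samples observations, i.e. rows of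
  the design, while the likelihood ratio of a spike and the score both single out one column. The
  data law is therefore rewritten with independent columns (\<open>nn_integral_data_law\<close>).
  Risks remain nonnegative integrals in \<open>ennreal\<close>, since an arbitrary estimator may
  have infinite risk.\<close>

lemma prob_space_normal_measure:
  assumes "0 < v" shows "prob_space (normal_measure m v)"
  unfolding normal_measure_def using assms by (intro prob_space_normal_density) auto

lemma sets_normal_measure [simp, measurable_cong]: "sets (normal_measure m v) = sets borel"
  by (simp add: normal_measure_def)

lemma space_normal_measure [simp]: "space (normal_measure m v) = UNIV"
  by (simp add: normal_measure_def)

lemma nn_integral_normal_measure:
  assumes "f \<in> borel_measurable borel"
  shows "(\<integral>\<^sup>+x. f x \<partial>normal_measure m v) = (\<integral>\<^sup>+x. ennreal (normal_density m (sqrt v) x) * f x \<partial>lborel)"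
  unfolding normal_measure_def using assms by (subst nn_integral_density) auto

lemma distributed_normal_measure:
  shows "distributed (normal_measure m v) lborel (\<lambda>x. x) (normal_density m (sqrt v))"
  by (auto simp: distributed_def normal_measure_def intro!: distr_id2)

lemma nn_integral_normal_scale:
  assumes v: "0 < v" and [measurable]: "f \<in> borel_measurable borel"
  shows "(\<integral>\<^sup>+x. f (a * x) \<partial>normal_measure 0 v) = (\<integral>\<^sup>+z. f (\<bar>a\<bar> * sqrt v * z) \<partial>normal_measure 0 1)"
proof (cases "a = 0")
  case True
  interpret N: prob_space "normal_measure 0 v" by (rule prob_space_normal_measure[OF v])
  interpret M: prob_space "normal_measure 0 1" by (rule prob_space_normal_measure) simp
  show ?thesis using N.emeasure_space_1 M.emeasure_space_1 True by simp
next
  case False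
  have *: "distr (normal_measure 0 w) borel (\<lambda>x. c * x) = normal_measure 0 (c\<^sup>2 * w)" if "0 < w" "c \<noteq> 0" for c w
  proof -
    interpret N: prob_space "normal_measure 0 w" by (rule prob_space_normal_measure[OF that(1)])
    from N.normal_density_affine[OF distributed_normal_measure _ that(2), of 0] that
    have "distributed (normal_measure 0 w) lborel (\<lambda>x. c * x) (normal_density 0 (\<bar>c\<bar> * sqrt w))" by simp
    then have "distr (normal_measure 0 w) lborel (\<lambda>x. c * x) = normal_measure 0 (c\<^sup>2 * w)"
      by (simp add: distributed_def normal_measure_def real_sqrt_mult)
    then show ?thesis by (metis distr_cong sets_lborel)
  qed
  have "(\<integral>\<^sup>+x. f (a * x) \<partial>normal_measure 0 v) = (\<integral>\<^sup>+x. f x \<partial>distr (normal_measure 0 v) borel (\<lambda>x. a * x))"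
    by (simp add: nn_integral_distr)
  also have "\<dots> = (\<integral>\<^sup>+x. f x \<partial>distr (normal_measure 0 1) borel (\<lambda>x. (\<bar>a\<bar> * sqrt v) * x))"
    using v False by (subst (1 2) *) (auto simp: power_mult_distrib)
  also have "\<dots> = (\<integral>\<^sup>+z. f (\<bar>a\<bar> * sqrt v * z) \<partial>normal_measure 0 1)"
    by (simp add: nn_integral_distr)
  finally show ?thesis .
qed

text \<open>The addition theorem for normal variables speaks of independent random variables; the
  two coordinates on a product of standard normal laws provide them.\<close>

lemma nn_integral_normal_add_std:
  assumes a: "0 < a" and s: "0 < s" and [measurable]: "f \<in> borel_measurable borel"
  shows "(\<integral>\<^sup>+x. \<integral>\<^sup>+z. f (a * x + s * z) \<partial>normal_measure 0 1 \<partial>normal_measure 0 1)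
       = (\<integral>\<^sup>+z. f (sqrt (a\<^sup>2 + s\<^sup>2) * z) \<partial>normal_measure 0 1)"
proof -
  let ?N = "normal_measure 0 1"
  interpret N: prob_space ?N by (rule prob_space_normal_measure) simp
  interpret P: pair_prob_space ?N ?N ..
  have fst: "distr (?N \<Otimes>\<^sub>M ?N) ?N fst = ?N" by (rule N.distr_pair_fst)
  have snd: "distr (?N \<Otimes>\<^sub>M ?N) ?N snd = ?N"
    by (subst P.distr_pair_swap) (simp add: distr_distr o_def case_prod_beta N.distr_pair_fst)
  have d1: "distributed (?N \<Otimes>\<^sub>M ?N) lborel (fst :: real \<times> real \<Rightarrow> real) (normal_density 0 1)"
    using fst by (auto simp: distributed_def normal_measure_def cong: distr_cong)
  have d2: "distributed (?N \<Otimes>\<^sub>M ?N) lborel (snd :: real \<times> real \<Rightarrow> real) (normal_density 0 1)"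
    using snd by (auto simp: distributed_def normal_measure_def cong: distr_cong)
  have "P.indep_var ?N fst ?N snd"
    by (subst P.indep_var_distribution_eq) (auto simp: fst snd intro!: distr_id2[symmetric])
  then have "P.indep_var borel ((\<lambda>x. a * x) \<circ> fst) borel ((\<lambda>x. s * x) \<circ> snd)"
    by (rule P.indep_var_compose) auto
  then have ind: "P.indep_var borel (\<lambda>w. a * fst w) borel (\<lambda>w. s * snd w)" by (simp add: o_def)
  have "distributed (?N \<Otimes>\<^sub>M ?N) lborel (\<lambda>w. a * fst w + s * snd w) (normal_density 0 (sqrt (a\<^sup>2 + s\<^sup>2)))"
    using P.add_indep_normal[OF ind, of a s 0 0] P.normal_density_affine[OF d1, of a 0]
      P.normal_density_affine[OF d2, of s 0] a s by simp
  then have D: "distr (?N \<Otimes>\<^sub>M ?N) lborel (\<lambda>w. a * fst w + s * snd w) = normal_measure 0 (a\<^sup>2 + s\<^sup>2)"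
    by (simp add: distributed_def normal_measure_def)
  have "(\<integral>\<^sup>+w. f (a * fst w + s * snd w) \<partial>(?N \<Otimes>\<^sub>M ?N)) = (\<integral>\<^sup>+z. f (1 * z) \<partial>normal_measure 0 (a\<^sup>2 + s\<^sup>2))"
    by (simp add: nn_integral_distr flip: D)
  also have "\<dots> = (\<integral>\<^sup>+z. f (sqrt (a\<^sup>2 + s\<^sup>2) * z) \<partial>normal_measure 0 1)"
    using a s by (subst nn_integral_normal_scale) (auto simp: add_pos_pos)
  finally show ?thesis
    by (simp add: N.nn_integral_fst[symmetric])
qed

text \<open>The inductive step for summing many normal variables. The case s = 0 is included because
  the sums in \<open>nn_integral_score\<close> start without a separate noise variable.\<close>

lemma nn_integral_normal_add:
  assumes v: "0 < v" and s: "0 \<le> s" and [measurable]: "f \<in> borel_measurable borel"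
  shows "(\<integral>\<^sup>+x. \<integral>\<^sup>+z. f (c + a * x + s * z) \<partial>normal_measure 0 1 \<partial>normal_measure 0 v)
       = (\<integral>\<^sup>+z. f (c + sqrt (s\<^sup>2 + a\<^sup>2 * v) * z) \<partial>normal_measure 0 1)"
proof -
  interpret N: prob_space "normal_measure 0 1" by (rule prob_space_normal_measure) simp
  define b where "b = \<bar>a\<bar> * sqrt v"
  have b: "0 \<le> b" "b\<^sup>2 = a\<^sup>2 * v" using v by (auto simp: b_def power_mult_distrib)
  have "(\<integral>\<^sup>+x. \<integral>\<^sup>+z. f (c + a * x + s * z) \<partial>normal_measure 0 1 \<partial>normal_measure 0 v)
     = (\<integral>\<^sup>+x. \<integral>\<^sup>+z. f (c + (b * x + s * z)) \<partial>normal_measure 0 1 \<partial>normal_measure 0 1)"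
    using nn_integral_normal_scale[OF v, of "\<lambda>t. \<integral>\<^sup>+z. f (c + t + s * z) \<partial>normal_measure 0 1" a]
    by (simp add: b_def add.assoc)
  also have "\<dots> = (\<integral>\<^sup>+z. f (c + sqrt (b\<^sup>2 + s\<^sup>2) * z) \<partial>normal_measure 0 1)"
  proof -
    consider "b = 0" | "b \<noteq> 0" "s = 0" | "b > 0" "s > 0" using b s by fastforce
    then show ?thesis
    proof cases
      case 1 then show ?thesis using s N.emeasure_space_1 by simp
    next
      case 2 then show ?thesis using b(1) N.emeasure_space_1 by simp
    next
      case 3 then show ?thesis using nn_integral_normal_add_std[of b s "\<lambda>t. f (c + t)"] by simp
    qed
  qed
  also have "b\<^sup>2 + s\<^sup>2 = s\<^sup>2 + a\<^sup>2 * v" by (simp add: b)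
  finally show ?thesis .
qed

lemma nn_integral_normal_exp:
  assumes v: "0 < v" and c: "0 < 1 + c * v"
  shows "(\<integral>\<^sup>+x. ennreal (exp (\<alpha> * x - c * x\<^sup>2 / 2)) \<partial>normal_measure 0 v)
       = ennreal (exp (\<alpha>\<^sup>2 * v / (2 * (1 + c * v))) / sqrt (1 + c * v))"
proof -
  define w where "w = v / (1 + c * v)"
  have w: "0 < w" using v c by (simp add: w_def)
  let ?K = "exp (\<alpha>\<^sup>2 * v / (2 * (1 + c * v))) / sqrt (1 + c * v)"
  have K: "0 \<le> ?K" using c by simp
  have eq: "normal_density 0 (sqrt v) x * exp (\<alpha> * x - c * x\<^sup>2 / 2) = ?K * normal_density (\<alpha> * w) (sqrt w) x" for x
  proof -
    have sq: "sqrt (2 * pi * w) * sqrt (1 + c * v) = sqrt (2 * pi * v)"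
      using c v by (simp add: w_def real_sqrt_mult[symmetric])
    have "- x\<^sup>2 / (2 * v) + (\<alpha> * x - c * x\<^sup>2 / 2) = \<alpha>\<^sup>2 * v / (2 * (1 + c * v)) + - (x - \<alpha> * w)\<^sup>2 / (2 * w)"
    proof -
      have v': "v = w / (1 - c * w)" "1 - c * w > 0"
        using v c by (auto simp: w_def field_simps)
      have u: "v / (1 + c * v) = w" "1/v = 1/w - c" using v c by (auto simp: w_def field_simps)
      have "- x\<^sup>2 / (2 * v) = - x\<^sup>2 / 2 * (1/v)" by simp
      also have "\<dots> = - x\<^sup>2 / (2*w) + c * x\<^sup>2 / 2" unfolding u by (simp add: field_simps)
      finally have 1: "- x\<^sup>2 / (2 * v) = - x\<^sup>2 / (2*w) + c * x\<^sup>2 / 2" .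
      have 2: "\<alpha>\<^sup>2 * v / (2 * (1 + c * v)) = \<alpha>\<^sup>2 * w / 2" using c by (simp add: w_def field_simps)
      show ?thesis unfolding 1 2 using w by (simp add: field_simps power2_eq_square)
    qed
    then have "exp (- x\<^sup>2 / (2 * v)) * exp (\<alpha> * x - c * x\<^sup>2 / 2) = exp (\<alpha>\<^sup>2 * v / (2 * (1 + c * v))) * exp (- (x - \<alpha> * w)\<^sup>2 / (2 * w))"
      by (simp only: exp_add[symmetric])
    then show ?thesis using v w c sq[symmetric]
      by (simp add: normal_density_def)
  qed
  have "(\<integral>\<^sup>+x. ennreal (exp (\<alpha> * x - c * x\<^sup>2 / 2)) \<partial>normal_measure 0 v)
     = (\<integral>\<^sup>+x. ennreal ?K * ennreal (normal_density (\<alpha> * w) (sqrt w) x) \<partial>lborel)"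
    using K by (subst nn_integral_normal_measure)
      (auto intro!: nn_integral_cong simp: ennreal_mult'[symmetric] ennreal_mult''[symmetric] eq)
  also have "\<dots> = ennreal ?K * (\<integral>\<^sup>+x. ennreal (normal_density (\<alpha> * w) (sqrt w) x) \<partial>lborel)"
    by (simp add: nn_integral_cmult)
  also have "(\<integral>\<^sup>+x. ennreal (normal_density (\<alpha> * w) (sqrt w) x) \<partial>lborel) = 1"
    using w by (subst nn_integral_eq_integral) (auto simp: )
  finally show ?thesis by simp
qed

section \<open>Finite products and the column representation of the data\<close>

text \<open>Measures on a finite product are determined by boxes. A side of a box is an arbitrary
  measurable set of pairs, not a rectangle, so the indicator of the box is written as a product over
  the indices and integrated first in y, then in x.\<close>

lemma nn_integral_PiM_pair:
  assumes I: "finite I" and M: "prob_space M" and N: "prob_space N"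
    and [measurable]: "f \<in> borel_measurable (PiM I (\<lambda>_. M \<Otimes>\<^sub>M N))"
  shows "(\<integral>\<^sup>+w. f w \<partial>PiM I (\<lambda>_. M \<Otimes>\<^sub>M N))
       = (\<integral>\<^sup>+x. \<integral>\<^sup>+y. f (\<lambda>i\<in>I. (x i, y i)) \<partial>PiM I (\<lambda>_. N) \<partial>PiM I (\<lambda>_. M))"
proof -
  interpret M: prob_space M by fact
  interpret N: prob_space N by fact
  interpret MN: pair_prob_space M N ..
  interpret IM: prob_space "PiM I (\<lambda>_. M)" by (intro prob_space_PiM M)
  interpret IN: prob_space "PiM I (\<lambda>_. N)" by (intro prob_space_PiM N)
  interpret PM: product_prob_space "\<lambda>_. M" I ..
  interpret PN: product_prob_space "\<lambda>_. N" I ..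
  interpret PMN: product_prob_space "\<lambda>_. M \<Otimes>\<^sub>M N" I ..
  interpret P: pair_prob_space "PiM I (\<lambda>_. M)" "PiM I (\<lambda>_. N)" ..
  let ?P = "PiM I (\<lambda>_. M) \<Otimes>\<^sub>M PiM I (\<lambda>_. N)" and ?Q = "PiM I (\<lambda>_. M \<Otimes>\<^sub>M N)"
  let ?T = "\<lambda>(x, y). \<lambda>i\<in>I. (x i, y i)"
  have T[measurable]: "?T \<in> measurable ?P ?Q" by measurable
  have "distr ?P ?Q ?T = ?Q"
  proof (rule PMN.PiM_eqI[OF I])
    fix A :: "'a \<Rightarrow> ('b \<times> 'c) set" assume A: "\<And>i. i \<in> I \<Longrightarrow> A i \<in> sets (M \<Otimes>\<^sub>M N)"
    have box[measurable]: "Pi\<^sub>E I A \<in> sets ?Q" using I A by (intro sets_PiM_I_finite) auto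
    have ind: "indicator (Pi\<^sub>E I A) (\<lambda>i\<in>I. (x i, y i)) = (\<Prod>i\<in>I. indicator (A i) (x i, y i) :: ennreal)" for x y
    proof (cases "\<forall>i\<in>I. (x i, y i) \<in> A i")
      case True then show ?thesis by (simp add: PiE_iff)
    next
      case False
      then obtain i where "i \<in> I" "(x i, y i) \<notin> A i" by auto
      then show ?thesis using I by (auto simp: PiE_iff indicator_def intro!: prod_zero[symmetric])
    qed
    have m1: "i \<in> I \<Longrightarrow> (\<lambda>z. indicator (A i) z :: ennreal) \<in> borel_measurable (M \<Otimes>\<^sub>M N)" for i
      using A by auto
    have m2: "i \<in> I \<Longrightarrow> x \<in> space M \<Longrightarrow> (\<lambda>y. indicator (A i) (x, y) :: ennreal) \<in> borel_measurable N" for i x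
      using measurable_compose[OF measurable_Pair1' m1] by simp
    have "emeasure (distr ?P ?Q ?T) (Pi\<^sub>E I A) = (\<integral>\<^sup>+w. indicator (Pi\<^sub>E I A) w \<partial>distr ?P ?Q ?T)" by simp
    also have "\<dots> = (\<integral>\<^sup>+w. indicator (Pi\<^sub>E I A) (?T w) \<partial>?P)" by (subst nn_integral_distr) auto
    also have "\<dots> = (\<integral>\<^sup>+x. \<integral>\<^sup>+y. indicator (Pi\<^sub>E I A) (?T (x, y)) \<partial>PiM I (\<lambda>_. N) \<partial>PiM I (\<lambda>_. M))"
      by (subst IN.nn_integral_fst[symmetric]) auto
    also have "\<dots> = (\<integral>\<^sup>+x. \<integral>\<^sup>+y. (\<Prod>i\<in>I. indicator (A i) (x i, y i)) \<partial>PiM I (\<lambda>_. N) \<partial>PiM I (\<lambda>_. M))"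
      by (simp add: ind)
    also have "\<dots> = (\<integral>\<^sup>+x. (\<Prod>i\<in>I. \<integral>\<^sup>+y. indicator (A i) (x i, y) \<partial>N) \<partial>PiM I (\<lambda>_. M))"
      by (intro nn_integral_cong PN.product_nn_integral_prod[OF I] m2) (auto simp: space_PiM)
    also have "\<dots> = (\<Prod>i\<in>I. \<integral>\<^sup>+x. \<integral>\<^sup>+y. indicator (A i) (x, y) \<partial>N \<partial>M)"
      by (intro PM.product_nn_integral_prod[OF I] N.borel_measurable_nn_integral_fst m1)
    also have "\<dots> = (\<Prod>i\<in>I. emeasure (M \<Otimes>\<^sub>M N) (A i))"
      using m1 A by (intro prod.cong refl) (simp add: N.nn_integral_fst)
    finally show "emeasure (distr ?P ?Q ?T) (Pi\<^sub>E I A) = (\<Prod>i\<in>I. emeasure (M \<Otimes>\<^sub>M N) (A i))" .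
  qed simp
  then have "(\<integral>\<^sup>+w. f w \<partial>?Q) = (\<integral>\<^sup>+w. f w \<partial>distr ?P ?Q ?T)" by simp
  also have "\<dots> = (\<integral>\<^sup>+w. f (?T w) \<partial>?P)" by (subst nn_integral_distr) auto
  also have "\<dots> = (\<integral>\<^sup>+x. \<integral>\<^sup>+y. f (?T (x, y)) \<partial>PiM I (\<lambda>_. N) \<partial>PiM I (\<lambda>_. M))"
    by (subst IN.nn_integral_fst[symmetric]) auto
  finally show ?thesis by simp
qed

lemma nn_integral_PiM_distr:
  assumes I: "finite I" and M: "prob_space M" and N: "prob_space N"
    and g[measurable]: "g \<in> measurable M N" and [measurable]: "f \<in> borel_measurable (PiM I (\<lambda>_. N))"
  shows "(\<integral>\<^sup>+w. f w \<partial>PiM I (\<lambda>_. distr M N g)) = (\<integral>\<^sup>+w. f (\<lambda>i\<in>I. g (w i)) \<partial>PiM I (\<lambda>_. M))"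
proof -
  have [measurable]: "compose I g \<in> measurable (PiM I (\<lambda>_. M)) (PiM I (\<lambda>_. N))"
    unfolding compose_def by measurable
  have "PiM I (\<lambda>_. distr M N g) = distr (PiM I (\<lambda>_. M)) (PiM I (\<lambda>_. N)) (compose I g)"
    using distr_PiM_finite_prob_space'[OF I, of "\<lambda>_. M" "\<lambda>_. N" g] M N by simp
  then show ?thesis by (simp add: nn_integral_distr) (simp add: compose_def)
qed

lemma measurable_transpose [measurable]:
  "(\<lambda>c. \<lambda>i\<in>I. \<lambda>j\<in>J. c j i) \<in> measurable (PiM J (\<lambda>_. PiM I (\<lambda>_. M))) (PiM I (\<lambda>_. PiM J (\<lambda>_. M)))"
proof (intro measurable_restrict)
  fix i j assume "i \<in> I" "j \<in> J"
  then show "(\<lambda>c. c j i) \<in> measurable (PiM J (\<lambda>_. PiM I (\<lambda>_. M))) M"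
    using measurable_compose[OF measurable_component_singleton[of j J "\<lambda>_. PiM I (\<lambda>_. M)"]
        measurable_component_singleton[of i I "\<lambda>_. M"]] by simp
qed

text \<open>The data law is a product over observations, whereas both risk bounds condition on
  columns. The induction splits one column off all rows, transposes the rest by the induction
  hypothesis, and reattaches the column.\<close>

lemma nn_integral_PiM_transpose:
  assumes I: "finite I" and J: "finite J" and M: "prob_space M"
    and f: "f \<in> borel_measurable (PiM I (\<lambda>_. PiM J (\<lambda>_. M)))"
  shows "(\<integral>\<^sup>+w. f w \<partial>PiM I (\<lambda>_. PiM J (\<lambda>_. M)))
       = (\<integral>\<^sup>+c. f (\<lambda>i\<in>I. \<lambda>j\<in>J. c j i) \<partial>PiM J (\<lambda>_. PiM I (\<lambda>_. M)))"
  using J f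
proof (induction J arbitrary: f rule: finite_induct)
  case empty
  have p: "prob_space (PiM K (\<lambda>_. L))" if "prob_space L" for K :: "'x set" and L :: "'y measure"
    using that by (intro prob_space_PiM) auto
  interpret P1: prob_space "PiM I (\<lambda>_. PiM {} (\<lambda>_. M) :: ('b \<Rightarrow> 'c) measure)" by (intro p M)
  interpret P2: prob_space "PiM {} (\<lambda>_. PiM I (\<lambda>_. M)) :: ('b \<Rightarrow> 'a \<Rightarrow> 'c) measure" by (intro p M)
  \<comment> \<open>For empty J every row is the function that is constantly
    \<open>undefined\<close>, so f is evaluated at a single point on both sides.\<close>
  have "(\<integral>\<^sup>+w. f w \<partial>PiM I (\<lambda>_. PiM {} (\<lambda>_. M))) = (\<integral>\<^sup>+w. f (\<lambda>i\<in>I. \<lambda>_. undefined) \<partial>PiM I (\<lambda>_. PiM {} (\<lambda>_::'b. M)))"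
    by (intro nn_integral_cong, rule arg_cong[of _ _ f])
      (auto simp: space_PiM PiE_iff extensional_def fun_eq_iff)
  then show ?case by (simp add: P1.emeasure_space_1 P2.emeasure_space_1 restrict_def cong: if_cong)
next
  case (insert j J)
  have p: "prob_space (PiM K (\<lambda>_. L))" if "prob_space L" for K :: "'x set" and L :: "'y measure"
    using that by (intro prob_space_PiM) auto
  let ?J = "PiM J (\<lambda>_. M)" and ?J' = "PiM (insert j J) (\<lambda>_. M)" and ?I = "PiM I (\<lambda>_. M)"
  let ?g = "\<lambda>(X, x). X(j := x)"
  interpret M: prob_space M by fact
  interpret PM: product_prob_space "\<lambda>_. M" J ..
  interpret J: prob_space ?J by (intro p M)
  interpret II: prob_space ?I by (intro p M)
  interpret JM: pair_prob_space ?J M ..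
  interpret MJ: pair_prob_space M ?J ..
  interpret PI: product_prob_space "\<lambda>_. ?I" J ..
  note insert.prems[measurable]
  have g[measurable]: "?g \<in> measurable (?J \<Otimes>\<^sub>M M) ?J'" by measurable
  have "?J' = distr (M \<Otimes>\<^sub>M ?J) ?J' (\<lambda>(x, X). X(j := x))"
    by (rule distr_pair_PiM_eq_PiM[symmetric]) (auto intro: M)
  also have "\<dots> = distr (?J \<Otimes>\<^sub>M M) ?J' ?g"
    by (subst JM.distr_pair_swap, subst distr_distr) (auto simp: o_def case_prod_beta intro!: distr_cong)
  finally have eq: "?J' = distr (?J \<Otimes>\<^sub>M M) ?J' ?g" .
  have "(\<integral>\<^sup>+w. f w \<partial>PiM I (\<lambda>_. ?J')) = (\<integral>\<^sup>+w. f w \<partial>PiM I (\<lambda>_. distr (?J \<Otimes>\<^sub>M M) ?J' ?g))"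
    using eq by simp
  also have "\<dots> = (\<integral>\<^sup>+w. f (\<lambda>i\<in>I. ?g (w i)) \<partial>PiM I (\<lambda>_. ?J \<Otimes>\<^sub>M M))"
    by (rule nn_integral_PiM_distr[OF I]) (auto intro: p M JM.prob_space_axioms insert.prems)
  also have "\<dots> = (\<integral>\<^sup>+w. \<integral>\<^sup>+y. f (\<lambda>i\<in>I. (w i)(j := y i)) \<partial>?I \<partial>PiM I (\<lambda>_. ?J))"
    by (subst nn_integral_PiM_pair[OF I p[OF M] M]) (auto cong: restrict_cong)
  also have "\<dots> = (\<integral>\<^sup>+c. \<integral>\<^sup>+y. f (\<lambda>i\<in>I. (\<lambda>j'\<in>J. c j' i)(j := y i)) \<partial>?I \<partial>PiM J (\<lambda>_. ?I))"
    by (subst insert.IH) (auto cong: restrict_cong)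
  also have "\<dots> = (\<integral>\<^sup>+c. \<integral>\<^sup>+y. f (\<lambda>i\<in>I. \<lambda>j'\<in>insert j J. (c(j := y)) j' i) \<partial>?I \<partial>PiM J (\<lambda>_. ?I))"
    using insert.hyps
    by - (intro nn_integral_cong, rule arg_cong[of _ _ f], auto simp: fun_eq_iff)
  also have "\<dots> = (\<integral>\<^sup>+c. f (\<lambda>i\<in>I. \<lambda>j'\<in>insert j J. c j' i) \<partial>PiM (insert j J) (\<lambda>_. ?I))"
    using insert.hyps by (subst PI.product_nn_integral_insert)
      (auto intro!: measurable_compose[OF measurable_transpose] insert.prems)
  finally show ?case .
qed

section \<open>Translations and sums of normal variables\<close>

lemma nn_integral_shift_std_normal:
  assumes [measurable]: "f \<in> borel_measurable borel"
  shows "(\<integral>\<^sup>+z. f (z + a) \<partial>normal_measure 0 1)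
       = (\<integral>\<^sup>+z. ennreal (exp (a * z - a\<^sup>2 / 2)) * f z \<partial>normal_measure 0 1)"
proof -
  have "(\<integral>\<^sup>+z. f (z + a) \<partial>normal_measure 0 1)
      = (\<integral>\<^sup>+z. ennreal (normal_density 0 1 z) * f (z + a) \<partial>lborel)"
    by (subst nn_integral_normal_measure) auto
  also have "\<dots> = (\<integral>\<^sup>+z. ennreal (normal_density 0 1 (z - a)) * f z \<partial>lborel)"
    by (subst lborel_distr_plus[of a, symmetric], subst nn_integral_distr) (auto simp: add.commute)
  also have "\<dots> = (\<integral>\<^sup>+z. ennreal (normal_density 0 1 z) * (ennreal (exp (a * z - a\<^sup>2 / 2)) * f z) \<partial>lborel)"
  proof (intro nn_integral_cong)
    fix z
    have "normal_density 0 1 (z - a) = normal_density 0 1 z * exp (a * z - a\<^sup>2 / 2)"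
      by (simp add: normal_density_def exp_add[symmetric] power2_eq_square field_simps)
    then show "ennreal (normal_density 0 1 (z - a)) * f z
      = ennreal (normal_density 0 1 z) * (ennreal (exp (a * z - a\<^sup>2 / 2)) * f z)"
      by (simp add: ennreal_mult mult.assoc)
  qed
  also have "\<dots> = (\<integral>\<^sup>+z. ennreal (exp (a * z - a\<^sup>2 / 2)) * f z \<partial>normal_measure 0 1)"
    by (subst nn_integral_normal_measure) auto
  finally show ?thesis .
qed

text \<open>The finite-dimensional Cameron-Martin formula: a deterministic shift of the noise is
  traded for a density. When \<open>a i\<close> is the contribution of a spike to observation i, in
  units of the noise level, this density is the likelihood ratio of the spike.\<close>

lemma nn_integral_shift_PiM_std_normal:
  assumes I: "finite I" and f: "f \<in> borel_measurable (PiM I (\<lambda>_. normal_measure 0 1))"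
  shows "(\<integral>\<^sup>+u. f (\<lambda>i\<in>I. u i + a i) \<partial>PiM I (\<lambda>_. normal_measure 0 1))
       = (\<integral>\<^sup>+u. (\<Prod>i\<in>I. ennreal (exp (a i * u i - (a i)\<^sup>2 / 2))) * f u \<partial>PiM I (\<lambda>_. normal_measure 0 1))"
  using I f
proof (induction I arbitrary: f rule: finite_induct)
  case empty
  then show ?case by (intro nn_integral_cong) (auto simp: space_PiM restrict_def)
next
  case (insert i I)
  let ?N = "normal_measure 0 1" and ?e = "\<lambda>i z. ennreal (exp (a i * z - (a i)\<^sup>2 / 2))"
  interpret N: prob_space ?N by (rule prob_space_normal_measure) simp
  interpret PN: product_prob_space "\<lambda>_. ?N" I ..
  note insert.prems[measurable]
  have "(\<integral>\<^sup>+u. f (\<lambda>i'\<in>insert i I. u i' + a i') \<partial>PiM (insert i I) (\<lambda>_. ?N))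
      = (\<integral>\<^sup>+x. \<integral>\<^sup>+y. f (\<lambda>i'\<in>insert i I. (x(i := y)) i' + a i') \<partial>?N \<partial>PiM I (\<lambda>_. ?N))"
    using insert.hyps by (subst PN.product_nn_integral_insert) auto
  also have "\<dots> = (\<integral>\<^sup>+x. \<integral>\<^sup>+y. (\<lambda>y. f ((\<lambda>i'\<in>I. x i' + a i')(i := y))) (y + a i) \<partial>?N \<partial>PiM I (\<lambda>_. ?N))"
    using insert.hyps by - (intro nn_integral_cong, simp, rule arg_cong[of _ _ f], auto simp: fun_eq_iff)
  also have "\<dots> = (\<integral>\<^sup>+x. \<integral>\<^sup>+y. ?e i y * f ((\<lambda>i'\<in>I. x i' + a i')(i := y)) \<partial>?N \<partial>PiM I (\<lambda>_. ?N))"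
    by (intro nn_integral_cong nn_integral_shift_std_normal) (auto simp: space_PiM)
  also have "\<dots> = (\<integral>\<^sup>+x. (\<Prod>i\<in>I. ?e i (x i)) * (\<integral>\<^sup>+y. ?e i y * f (x(i := y)) \<partial>?N) \<partial>PiM I (\<lambda>_. ?N))"
    by (subst insert.IH[symmetric]) auto
  also have "\<dots> = (\<integral>\<^sup>+x. \<integral>\<^sup>+y. (\<Prod>i\<in>I. ?e i (x i)) * (?e i y * f (x(i := y))) \<partial>?N \<partial>PiM I (\<lambda>_. ?N))"
    by (intro nn_integral_cong nn_integral_cmult[symmetric]) auto
  also have "\<dots> = (\<integral>\<^sup>+x. \<integral>\<^sup>+y. (\<Prod>i'\<in>insert i I. ?e i' ((x(i := y)) i')) * f (x(i := y)) \<partial>?N \<partial>PiM I (\<lambda>_. ?N))"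
  proof -
    have "(\<Prod>i'\<in>insert i I. ?e i' ((x(i := y)) i')) = ?e i y * (\<Prod>i\<in>I. ?e i (x i))" for x y
      using insert.hyps by (auto intro!: arg_cong2[of _ _ _ _ "(*)"] prod.cong)
    then show ?thesis by (simp add: ac_simps)
  qed
  also have "\<dots> = (\<integral>\<^sup>+u. (\<Prod>i'\<in>insert i I. ?e i' (u i')) * f u \<partial>PiM (insert i I) (\<lambda>_. ?N))"
    using insert.hyps by (subst PN.product_nn_integral_insert) auto
  finally show ?case .
qed

text \<open>Each coordinate that is integrated out is absorbed into the scale s of the remaining
  normal variable, so the induction must be general in s.\<close>

lemma nn_integral_PiM_normal_add:
  fixes I :: "'i set"
  assumes I: "finite I" and v: "0 < v" and s: "0 \<le> s" and [measurable]: "f \<in> borel_measurable borel"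
  shows "(\<integral>\<^sup>+x. \<integral>\<^sup>+z. f (c + (\<Sum>i\<in>I. a i * x i) + s * z) \<partial>normal_measure 0 1 \<partial>PiM I (\<lambda>_. normal_measure 0 v))
       = (\<integral>\<^sup>+z. f (c + sqrt (s\<^sup>2 + v * (\<Sum>i\<in>I. (a i)\<^sup>2)) * z) \<partial>normal_measure 0 1)"
  using I s
proof (induction I arbitrary: s rule: finite_induct)
  case empty
  interpret P: prob_space "PiM {} (\<lambda>_::'i. normal_measure 0 v)" by (intro prob_space_PiM prob_space_normal_measure v)
  show ?case using P.emeasure_space_1 empty by simp
next
  case (insert i I)
  let ?N = "normal_measure 0 1" and ?V = "normal_measure 0 v"
  interpret N: prob_space ?N by (rule prob_space_normal_measure) simp
  interpret V: prob_space ?V by (rule prob_space_normal_measure) (rule v)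
  interpret PV: product_prob_space "\<lambda>_. ?V" I ..
  have *: "(\<Sum>i'\<in>insert i I. a i' * (x(i := y)) i') = (\<Sum>i\<in>I. a i * x i) + a i * y" for x and y :: real
    using insert.hyps by (auto simp: add.commute intro!: sum.cong)
  have "(\<integral>\<^sup>+x. \<integral>\<^sup>+z. f (c + (\<Sum>i\<in>insert i I. a i * x i) + s * z) \<partial>?N \<partial>PiM (insert i I) (\<lambda>_. ?V))
      = (\<integral>\<^sup>+x. \<integral>\<^sup>+y. \<integral>\<^sup>+z. f ((c + (\<Sum>i\<in>I. a i * x i)) + a i * y + s * z) \<partial>?N \<partial>?V \<partial>PiM I (\<lambda>_. ?V))"
    using insert.hyps by (subst PV.product_nn_integral_insert) (auto simp: * add.assoc simp del: sum.insert fun_upd_apply)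
  also have "\<dots> = (\<integral>\<^sup>+x. \<integral>\<^sup>+z. f (c + (\<Sum>i\<in>I. a i * x i) + sqrt (s\<^sup>2 + (a i)\<^sup>2 * v) * z) \<partial>?N \<partial>PiM I (\<lambda>_. ?V))"
    by (intro nn_integral_cong nn_integral_normal_add v insert.prems) auto
  also have "\<dots> = (\<integral>\<^sup>+z. f (c + sqrt ((sqrt (s\<^sup>2 + (a i)\<^sup>2 * v))\<^sup>2 + v * (\<Sum>i\<in>I. (a i)\<^sup>2)) * z) \<partial>?N)"
    using v by (intro insert.IH) auto
  also have "(sqrt (s\<^sup>2 + (a i)\<^sup>2 * v))\<^sup>2 + v * (\<Sum>i\<in>I. (a i)\<^sup>2) = s\<^sup>2 + v * (\<Sum>i\<in>insert i I. (a i)\<^sup>2)"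
    using insert.hyps v by (simp add: algebra_simps)
  finally show ?case .
qed

lemma measurable_column_data:
  assumes V: "sets V = sets borel" and N: "sets N = sets borel"
  shows "(\<lambda>(c, u). \<lambda>i\<in>{..<n}. ((\<Sum>j<p. c j i * \<beta> j) + \<sigma> * u i, \<lambda>j\<in>{..<p}. c j i))
    \<in> measurable (PiM {..<p} (\<lambda>_. PiM {..<n} (\<lambda>_. V)) \<Otimes>\<^sub>M PiM {..<n} (\<lambda>_. N)) (data_space n p)" (is "_ \<in> measurable ?M _")
proof -
  have c[measurable]: "(\<lambda>w. fst w j i) \<in> borel_measurable ?M" if "i < n" "j < p" for i j
  proof -
    have "(\<lambda>w. fst w j i) \<in> measurable ?M V"
      using measurable_compose[OF measurable_fst measurable_compose[OF measurable_component_singleton[of j "{..<p}" "\<lambda>_. PiM {..<n} (\<lambda>_. V)"]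
        measurable_component_singleton[of i "{..<n}" "\<lambda>_. V"]]] that by simp
    then show ?thesis using measurable_cong_sets[OF refl V] by auto
  qed
  have u[measurable]: "(\<lambda>w. snd w i) \<in> borel_measurable ?M" if "i < n" for i
  proof -
    have "(\<lambda>w. snd w i) \<in> measurable ?M N"
      using measurable_compose[OF measurable_snd measurable_component_singleton[of i "{..<n}" "\<lambda>_. N"]] that by simp
    then show ?thesis using measurable_cong_sets[OF refl N] by auto
  qed
  show ?thesis unfolding data_space_def borel_vec_def case_prod_beta
    by (intro measurable_restrict measurable_Pair borel_measurable_add borel_measurable_sum borel_measurable_times) auto
qed

text \<open>The entry \<open>c j i\<close> belongs to column j and observation i, and
  \<open>u i\<close> is the noise. The columns are independent of each other and of the noise; both
  halves of the theorem start from this representation.\<close>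

lemma nn_integral_data_law:
  fixes p :: nat
  assumes n: "0 < n" and [measurable]: "f \<in> borel_measurable (data_space n p)"
  shows "(\<integral>\<^sup>+D. f D \<partial>data_law n p \<sigma> \<beta>)
    = (\<integral>\<^sup>+c. \<integral>\<^sup>+u. f (\<lambda>i\<in>{..<n}. ((\<Sum>j<p. c j i * \<beta> j) + \<sigma> * u i, \<lambda>j\<in>{..<p}. c j i))
        \<partial>PiM {..<n} (\<lambda>_. normal_measure 0 1) \<partial>PiM {..<p} (\<lambda>_. PiM {..<n} (\<lambda>_. normal_measure 0 (1 / real n))))"
proof -
  let ?N = "normal_measure 0 1" and ?V = "normal_measure 0 (1 / real n)"
  let ?X = "PiM {..<p} (\<lambda>_. ?V)" and ?Y = "borel \<Otimes>\<^sub>M borel_vec p"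
  let ?g = "\<lambda>(x, z). ((\<Sum>j<p. x j * \<beta> j) + \<sigma> * z, x)"
  interpret N: prob_space ?N by (rule prob_space_normal_measure) simp
  have pV: "prob_space ?V" using n by (intro prob_space_normal_measure) simp
  interpret X: prob_space ?X by (intro prob_space_PiM pV)
  interpret XN: pair_prob_space ?X ?N ..
  have sX [measurable_cong]: "sets ?X = sets (borel_vec p)"
    unfolding borel_vec_def by (intro sets_PiM_cong) auto
  have g[measurable]: "?g \<in> measurable (?X \<Otimes>\<^sub>M ?N) ?Y"
  proof -
    have "(\<lambda>x. x j) \<in> borel_measurable ?X" if "j < p" for j
      using that measurable_component_singleton[of j "{..<p}" "\<lambda>_. ?V"]
        measurable_cong_sets[OF refl sets_normal_measure[of 0 "1 / real n"], of ?X] by auto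
    then have [measurable]: "(\<lambda>w. fst w j) \<in> borel_measurable (?X \<Otimes>\<^sub>M ?N)" if "j < p" for j
      using that by (intro measurable_compose[OF measurable_fst]) auto
    show ?thesis unfolding case_prod_beta by measurable
  qed
  let ?M0 = "distr (?X \<Otimes>\<^sub>M ?N) ?Y ?g"
  interpret M0: prob_space ?M0 by (intro XN.prob_space_distr g)
  have fm[measurable]: "f \<in> borel_measurable (PiM {..<n} (\<lambda>_. ?M0))"
    using assms(2) by (subst measurable_cong_sets[OF _ refl, of _ "data_space n p"])
      (auto simp: data_space_def intro!: sets_PiM_cong)
  have sP [measurable_cong]: "sets (PiM {..<n} (\<lambda>_. ?M0)) = sets (data_space n p)"
    unfolding data_space_def by (intro sets_PiM_cong) auto
  interpret N': prob_space "PiM {..<n} (\<lambda>_. ?N)" by (intro prob_space_PiM N.prob_space_axioms)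
  have rm: "(\<lambda>w. \<lambda>i\<in>{..<n}. ?g (fst w i, snd w i)) \<in> measurable (PiM {..<n} (\<lambda>_. ?X) \<Otimes>\<^sub>M PiM {..<n} (\<lambda>_. ?N)) (data_space n p)"
    unfolding data_space_def
    by (intro measurable_restrict measurable_compose[OF _ g] measurable_Pair
        measurable_compose[OF measurable_fst measurable_component_singleton]
        measurable_compose[OF measurable_snd measurable_component_singleton])
  \<comment> \<open>The target space of the image measure is replaced by \<open>?M0\<close> itself,
    because \<open>nn_integral_PiM_distr\<close> expects a probability measure as target.\<close>
  have "?M0 = distr (?X \<Otimes>\<^sub>M ?N) ?M0 ?g" by (intro distr_cong) auto
  then have "(\<integral>\<^sup>+D. f D \<partial>data_law n p \<sigma> \<beta>) = (\<integral>\<^sup>+D. f D \<partial>PiM {..<n} (\<lambda>_. distr (?X \<Otimes>\<^sub>M ?N) ?M0 ?g))"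
    unfolding data_law_def obs_law_def by simp
  also have "\<dots> = (\<integral>\<^sup>+w. f (\<lambda>i\<in>{..<n}. ?g (w i)) \<partial>PiM {..<n} (\<lambda>_. ?X \<Otimes>\<^sub>M ?N))"
    by (intro nn_integral_PiM_distr fm) (auto intro: XN.prob_space_axioms M0.prob_space_axioms)
  also have "\<dots> = (\<integral>\<^sup>+x. \<integral>\<^sup>+u. f (\<lambda>i\<in>{..<n}. ?g (x i, u i)) \<partial>PiM {..<n} (\<lambda>_. ?N) \<partial>PiM {..<n} (\<lambda>_. ?X))"
    by (subst nn_integral_PiM_pair[OF _ X.prob_space_axioms N.prob_space_axioms])
      (auto simp: data_space_def intro!: measurable_compose[OF _ assms(2)] cong: restrict_cong)
  also have "\<dots> = (\<integral>\<^sup>+c. \<integral>\<^sup>+u. f (\<lambda>i\<in>{..<n}. ?g ((\<lambda>i\<in>{..<n}. \<lambda>j\<in>{..<p}. c j i) i, u i))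
        \<partial>PiM {..<n} (\<lambda>_. ?N) \<partial>PiM {..<p} (\<lambda>_. PiM {..<n} (\<lambda>_. ?V)))"
    using N'.borel_measurable_nn_integral_fst[OF measurable_compose[OF rm assms(2)]]
    by (subst nn_integral_PiM_transpose[OF _ _ pV]) (auto cong: restrict_cong)
  also have "\<dots> = (\<integral>\<^sup>+c. \<integral>\<^sup>+u. f (\<lambda>i\<in>{..<n}. ((\<Sum>j<p. c j i * \<beta> j) + \<sigma> * u i, \<lambda>j\<in>{..<p}. c j i))
        \<partial>PiM {..<n} (\<lambda>_. ?N) \<partial>PiM {..<p} (\<lambda>_. PiM {..<n} (\<lambda>_. ?V)))"
    by (intro nn_integral_cong, rule arg_cong[of _ _ f]) (auto simp: fun_eq_iff)
  finally show ?thesis .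
qed

section \<open>The posterior of a single spike\<close>

text \<open>The product of 1 - y + y^2 / 2 with the Taylor minorant 1 + y + y^2 / 2 of exp y is 1 +
  y^4 / 4, hence at least 1. The bound lets the first two moments of L control the mean of exp (- t
  L).\<close>

lemma exp_minus_le_quadratic:
  fixes y :: real assumes "0 \<le> y" shows "exp (- y) \<le> 1 - y + y\<^sup>2 / 2"
proof -
  have "1 + y + y\<^sup>2 / 2 \<le> exp y" using exp_lower_Taylor_quadratic[OF assms] by simp
  moreover have "0 \<le> 1 - y + y\<^sup>2 / 2" using zero_le_power2[of "y - 1"] by (simp add: power2_eq_square algebra_simps)
  ultimately have "(1 - y + y\<^sup>2 / 2) * (1 + y + y\<^sup>2 / 2) \<le> (1 - y + y\<^sup>2 / 2) * exp y"
    by (intro mult_left_mono)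
  moreover have "(1 - y + y\<^sup>2 / 2) * (1 + y + y\<^sup>2 / 2) = 1 + (y\<^sup>2 / 2)\<^sup>2"
    by (simp add: power2_eq_square algebra_simps)
  ultimately have "1 \<le> (1 - y + y\<^sup>2 / 2) * exp y" by (smt (verit) zero_le_power2)
  then show ?thesis by (simp add: exp_minus field_simps)
qed

text \<open>It turns the exponentially small Chernoff term into one with the factor (card B -
  1)^(-2), the form in which it enters \<open>spike_gain\<close>.\<close>

lemma exp_minus_le_inverse_square:
  fixes x :: real assumes "0 < x" shows "exp (- x) \<le> 2 / x\<^sup>2"
proof -
  have "x\<^sup>2 / 2 \<le> exp x" using exp_lower_Taylor_quadratic[of x] assms by simp
  then show ?thesis using assms by (simp add: exp_minus field_simps)
qed

text \<open>
  Where the sum over \<open>B - {l}\<close> exceeds \<open>1 - \<delta>\<close> times its mean, it replaces the denominator; elsewhere the ratio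
  is at most \<open>L (c l)\<close>, and a Chernoff bound with \<open>t = \<delta> A1 / A2\<close> makes that event rare. A variance bound
  would only give \<open>1 / card B\<close>, the order of the main term.
\<close>

lemma nn_integral_ratio_bound:
  fixes M :: "'a measure" and J :: "'j set"
  assumes M: "prob_space M" and J: "finite J" "B \<subseteq> J" "l \<in> B" "2 \<le> card B"
    and [measurable]: "L \<in> borel_measurable M" "d \<in> borel_measurable M"
    and L: "\<And>x. 0 < L x" "\<And>x. \<bar>d x\<bar> \<le> L x"
    and A: "0 < A1" "0 < A2" "0 \<le> A3"
    and int: "(\<integral>\<^sup>+x. ennreal (L x) \<partial>M) = ennreal A1" "(\<integral>\<^sup>+x. ennreal ((L x)\<^sup>2) \<partial>M) \<le> ennreal A2"
      "(\<integral>\<^sup>+x. ennreal ((d x)\<^sup>2) \<partial>M) \<le> ennreal A3"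
    and \<delta>: "0 < \<delta>" "\<delta> < 1"
  shows "(\<integral>\<^sup>+c. ennreal ((d (c l))\<^sup>2 / (\<Sum>j\<in>B. L (c j))) \<partial>PiM J (\<lambda>_. M))
    \<le> ennreal (A3 / ((1 - \<delta>) * (real (card B) - 1) * A1) + 8 * A2\<^sup>2 / ((real (card B) - 1)\<^sup>2 * \<delta> ^ 4 * A1 ^ 3))"
proof -
  interpret M: prob_space M by fact
  interpret PM: product_prob_space "\<lambda>_. M" J ..
  define m where "m = real (card B) - 1"
  define t where "t = \<delta> * A1 / A2"
  define K where "K = (1 - \<delta>) * m * A1"
  have ne: "j \<noteq> l" if "j \<notin> B" for j using that J by auto
  have finB: "finite B" using J finite_subset by auto
  have lJ: "l \<in> J" using J by auto
  have m: "m > 0" "m = real (card (B - {l}))" using J finB by (auto simp: m_def card_Diff_singleton)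
  have t: "t > 0" using \<delta> A by (simp add: t_def)
  have K: "K > 0" using \<delta> A m by (simp add: K_def)
  \<comment> \<open>Both majorants are products over all of J with factor 1 at the unaffected
    indices, so their integrals over the product measure factorise.\<close>
  define f1 where "f1 = (\<lambda>j x. if j = l then ennreal ((d x)\<^sup>2 / K) else 1)"
  define f2 where "f2 = (\<lambda>j x. if j = l then ennreal (L x) else if j \<in> B then ennreal (exp (- (t * L x))) else 1)"
  have [measurable]: "f1 j \<in> borel_measurable M" "f2 j \<in> borel_measurable M" for j
    unfolding f1_def f2_def by (cases "j = l"; cases "j \<in> B"; simp)+
  have p1: "(\<Prod>j\<in>J. f1 j (c j)) = ennreal ((d (c l))\<^sup>2 / K)" for c
    using J lJ by (simp add: f1_def prod.delta)
  have split: "(\<Prod>j\<in>J. g j) = g l * (\<Prod>j\<in>B - {l}. g j)" if "\<And>j. j \<in> J - B \<Longrightarrow> g j = 1" for g :: "'j \<Rightarrow> ennreal"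
  proof -
    have "(\<Prod>j\<in>J. g j) = (\<Prod>j\<in>B. g j)" using J that by (intro prod.mono_neutral_right) auto
    then show ?thesis using finB J by (simp add: prod.remove)
  qed
  have p2: "(\<Prod>j\<in>J. f2 j (c j)) = ennreal (L (c l) * exp (- (t * (\<Sum>j\<in>B - {l}. L (c j)))))" for c
  proof -
    have "(\<Prod>j\<in>J. f2 j (c j)) = f2 l (c l) * (\<Prod>j\<in>B - {l}. f2 j (c j))"
      using J by (intro split) (auto simp: f2_def)
    also have "(\<Prod>j\<in>B - {l}. f2 j (c j)) = (\<Prod>j\<in>B - {l}. ennreal (exp (- (t * L (c j)))))"
      by (intro prod.cong) (auto simp: f2_def)
    also have "\<dots> = ennreal (exp (- (t * (\<Sum>j\<in>B - {l}. L (c j)))))"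
      using finB by (simp add: prod_ennreal exp_sum[symmetric] sum_negf sum_distrib_left)
    finally show ?thesis using L(1)[of "c l"] by (simp add: f2_def ennreal_mult)
  qed
  have pw: "ennreal ((d (c l))\<^sup>2 / (\<Sum>j\<in>B. L (c j))) \<le> (\<Prod>j\<in>J. f1 j (c j)) + ennreal (exp (t * K)) * (\<Prod>j\<in>J. f2 j (c j))" for c
  proof -
    let ?T = "\<Sum>j\<in>B - {l}. L (c j)"
    have T: "(\<Sum>j\<in>B. L (c j)) = L (c l) + ?T" using finB J by (simp add: sum.remove)
    have T0: "0 \<le> ?T" by (intro sum_nonneg less_imp_le L(1))
    have "(d (c l))\<^sup>2 / (L (c l) + ?T) \<le> (d (c l))\<^sup>2 / K + exp (t * K) * (L (c l) * exp (- (t * ?T)))"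
    proof (cases "K \<le> ?T")
      case True
      then have "(d (c l))\<^sup>2 / (L (c l) + ?T) \<le> (d (c l))\<^sup>2 / K"
        using K L(1)[of "c l"] by (intro divide_left_mono) (auto intro!: mult_pos_pos)
      moreover have "0 \<le> exp (t * K) * (L (c l) * exp (- (t * ?T)))" using L(1)[of "c l"] by auto
      ultimately show ?thesis by linarith
    next
      case False
      have "(d (c l))\<^sup>2 \<le> (L (c l))\<^sup>2" using L(2)[of "c l"] by (metis abs_ge_zero power2_abs power_mono)
      then have "(d (c l))\<^sup>2 / (L (c l) + ?T) \<le> (L (c l))\<^sup>2 / L (c l)"
        using T0 L(1)[of "c l"] by (intro frac_le) auto
      also have "\<dots> = 1 * L (c l)" using L(1)[of "c l"] by (simp add: power2_eq_square)
      also have "\<dots> \<le> exp (t * K - t * ?T) * L (c l)"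
        using False t L(1)[of "c l"] by (intro mult_right_mono) auto
      also have "\<dots> = exp (t * K) * (L (c l) * exp (- (t * ?T)))"
        by (simp add: exp_diff exp_minus field_simps)
      finally show ?thesis using K by (smt (verit) divide_nonneg_pos zero_le_power2)
    qed
    then show ?thesis unfolding p1 p2 T using K L(1)[of "c l"]
      by (simp add: ennreal_mult'[symmetric] ennreal_plus[symmetric] del: ennreal_plus)
  qed
  define E where "E = (\<integral>\<^sup>+x. ennreal (exp (- (t * L x))) \<partial>M)"
  have E: "E \<le> ennreal (exp (- t * A1 + t\<^sup>2 * A2 / 2))"
  proof -
    have "E \<le> (\<integral>\<^sup>+x. 1 \<partial>M)" unfolding E_def using t L(1)
      by (intro nn_integral_mono) (auto simp: less_imp_le)
    then have "E \<le> 1" by (simp add: M.emeasure_space_1)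
    then obtain e where e: "E = ennreal e" "0 \<le> e"
      by (metis ennreal_cases ennreal_one_neq_top infinity_ennreal_def top.extremum_unique)
    \<comment> \<open>The term t A1 stays on the left until the inequality is one between reals,
      since subtraction in \<open>ennreal\<close> truncates.\<close>
    have "E + ennreal t * ennreal A1 = (\<integral>\<^sup>+x. ennreal (exp (- (t * L x))) + ennreal t * ennreal (L x) \<partial>M)"
      unfolding E_def int(1)[symmetric] by (simp add: nn_integral_add nn_integral_cmult)
    also have "\<dots> \<le> (\<integral>\<^sup>+x. 1 + ennreal (t\<^sup>2 / 2) * ennreal ((L x)\<^sup>2) \<partial>M)"
    proof (intro nn_integral_mono)
      fix x
      have "exp (- (t * L x)) + t * L x \<le> 1 + t\<^sup>2 / 2 * (L x)\<^sup>2"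
        using exp_minus_le_quadratic[of "t * L x"] t L(1)[of x] by (simp add: power_mult_distrib)
      then have "ennreal (exp (- (t * L x)) + t * L x) \<le> ennreal (1 + t\<^sup>2 / 2 * (L x)\<^sup>2)" by (rule ennreal_leI)
      then show "ennreal (exp (- (t * L x))) + ennreal t * ennreal (L x) \<le> 1 + ennreal (t\<^sup>2 / 2) * ennreal ((L x)\<^sup>2)"
        using t L(1)[of x] by (simp add: ennreal_mult[symmetric] less_imp_le)
    qed
    also have "\<dots> = 1 + ennreal (t\<^sup>2 / 2) * (\<integral>\<^sup>+x. ennreal ((L x)\<^sup>2) \<partial>M)"
      by (simp add: nn_integral_add nn_integral_cmult M.emeasure_space_1)
    also have "\<dots> \<le> 1 + ennreal (t\<^sup>2 / 2) * ennreal A2"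
      by (intro add_left_mono mult_left_mono int) auto
    finally have "ennreal (e + t * A1) \<le> ennreal (1 + t\<^sup>2 / 2 * A2)"
      using e t A by (simp add: ennreal_mult[symmetric] less_imp_le)
    then have "e + t * A1 \<le> 1 + t\<^sup>2 / 2 * A2" using A by (subst (asm) ennreal_le_iff) auto
    then have "e \<le> 1 + (- t * A1 + t\<^sup>2 * A2 / 2)" by simp
    also have "\<dots> \<le> exp (- t * A1 + t\<^sup>2 * A2 / 2)" by (rule exp_ge_add_one_self)
    finally show ?thesis using e by (simp add: ennreal_leI)
  qed
  have i1: "(\<integral>\<^sup>+c. (\<Prod>j\<in>J. f1 j (c j)) \<partial>PiM J (\<lambda>_. M)) \<le> ennreal (A3 / K)"
  proof -
    have "(\<integral>\<^sup>+c. (\<Prod>j\<in>J. f1 j (c j)) \<partial>PiM J (\<lambda>_. M)) = (\<Prod>j\<in>J. integral\<^sup>N M (f1 j))"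
      by (intro PM.product_nn_integral_prod J) simp
    also have "\<dots> = integral\<^sup>N M (f1 l) * (\<Prod>j\<in>B - {l}. integral\<^sup>N M (f1 j))"
      using J by (intro split) (auto simp: f1_def ne M.emeasure_space_1)
    also have "(\<Prod>j\<in>B - {l}. integral\<^sup>N M (f1 j)) = 1"
      by (intro prod.neutral) (auto simp: f1_def M.emeasure_space_1)
    also have "integral\<^sup>N M (f1 l) = (\<integral>\<^sup>+x. ennreal (1 / K) * ennreal ((d x)\<^sup>2) \<partial>M)"
      using K by (intro nn_integral_cong) (auto simp: f1_def ennreal_mult'[symmetric])
    also have "\<dots> = ennreal (1 / K) * (\<integral>\<^sup>+x. ennreal ((d x)\<^sup>2) \<partial>M)" by (simp add: nn_integral_cmult)
    also have "\<dots> \<le> ennreal (1 / K) * ennreal A3" by (intro mult_left_mono int) auto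
    also have "\<dots> = ennreal (A3 / K)" using A K by (simp add: ennreal_mult'[symmetric])
    finally show ?thesis by (simp add: mult_right_mono)
  qed
  have i2: "ennreal (exp (t * K)) * (\<integral>\<^sup>+c. (\<Prod>j\<in>J. f2 j (c j)) \<partial>PiM J (\<lambda>_. M))
      \<le> ennreal (8 * A2\<^sup>2 / (m\<^sup>2 * \<delta> ^ 4 * A1 ^ 3))"
  proof -
    have "(\<integral>\<^sup>+c. (\<Prod>j\<in>J. f2 j (c j)) \<partial>PiM J (\<lambda>_. M)) = (\<Prod>j\<in>J. integral\<^sup>N M (f2 j))"
      by (intro PM.product_nn_integral_prod J) simp
    also have "\<dots> = integral\<^sup>N M (f2 l) * (\<Prod>j\<in>B - {l}. integral\<^sup>N M (f2 j))"
      using J by (intro split) (auto simp: f2_def ne M.emeasure_space_1)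
    also have "(\<Prod>j\<in>B - {l}. integral\<^sup>N M (f2 j)) = (\<Prod>j\<in>B - {l}. E)"
      by (intro prod.cong) (auto simp: f2_def E_def)
    also have "\<dots> \<le> ennreal (exp (- t * A1 + t\<^sup>2 * A2 / 2)) ^ card (B - {l})"
      using E by (simp add: power_mono)
    also have "\<dots> = ennreal (exp (m * (- t * A1 + t\<^sup>2 * A2 / 2)))"
      unfolding m(2) by (simp add: ennreal_power exp_of_nat_mult)
    also have "integral\<^sup>N M (f2 l) = ennreal A1" by (simp add: f2_def int(1))
    finally have "(\<integral>\<^sup>+c. (\<Prod>j\<in>J. f2 j (c j)) \<partial>PiM J (\<lambda>_. M)) \<le> ennreal A1 * ennreal (exp (m * (- t * A1 + t\<^sup>2 * A2 / 2)))"
      by (simp add: mult_left_mono)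
    then have "ennreal (exp (t * K)) * (\<integral>\<^sup>+c. (\<Prod>j\<in>J. f2 j (c j)) \<partial>PiM J (\<lambda>_. M))
      \<le> ennreal (exp (t * K)) * (ennreal A1 * ennreal (exp (m * (- t * A1 + t\<^sup>2 * A2 / 2))))"
      by (intro mult_left_mono) auto
    also have "\<dots> = ennreal (A1 * exp (t * K + m * (- t * A1 + t\<^sup>2 * A2 / 2)))"
      using A by (simp add: ennreal_mult'[symmetric] exp_add ac_simps)
    \<comment> \<open>The choice t = \<delta> A1 / A2 minimises this exponent, which is - \<delta> m
      t A1 + m t^2 A2 / 2.\<close>
    also have "t * K + m * (- t * A1 + t\<^sup>2 * A2 / 2) = - (m * \<delta>\<^sup>2 * A1\<^sup>2 / (2 * A2))"
      using A by (simp add: t_def K_def field_simps power2_eq_square)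
    also have "A1 * exp (- (m * \<delta>\<^sup>2 * A1\<^sup>2 / (2 * A2))) \<le> A1 * (2 / (m * \<delta>\<^sup>2 * A1\<^sup>2 / (2 * A2))\<^sup>2)"
      using m \<delta> A by (intro mult_left_mono exp_minus_le_inverse_square) auto
    also have "\<dots> = 8 * A2\<^sup>2 / (m\<^sup>2 * \<delta> ^ 4 * A1 ^ 3)"
      using m(1) \<delta> A by (simp add: field_simps power2_eq_square power_def numeral_eq_Suc)
    finally show ?thesis by (simp add: ennreal_leI)
  qed
  have "(\<integral>\<^sup>+c. ennreal ((d (c l))\<^sup>2 / (\<Sum>j\<in>B. L (c j))) \<partial>PiM J (\<lambda>_. M))
     \<le> (\<integral>\<^sup>+c. (\<Prod>j\<in>J. f1 j (c j)) + ennreal (exp (t * K)) * (\<Prod>j\<in>J. f2 j (c j)) \<partial>PiM J (\<lambda>_. M))"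
    by (intro nn_integral_mono pw)
  also have "\<dots> = (\<integral>\<^sup>+c. (\<Prod>j\<in>J. f1 j (c j)) \<partial>PiM J (\<lambda>_. M)) + ennreal (exp (t * K)) * (\<integral>\<^sup>+c. (\<Prod>j\<in>J. f2 j (c j)) \<partial>PiM J (\<lambda>_. M))"
    by (simp add: nn_integral_add nn_integral_cmult)
  also have "\<dots> \<le> ennreal (A3 / K) + ennreal (8 * A2\<^sup>2 / (m\<^sup>2 * \<delta> ^ 4 * A1 ^ 3))"
    by (intro add_mono i1 i2)
  also have "\<dots> = ennreal (A3 / K + 8 * A2\<^sup>2 / (m\<^sup>2 * \<delta> ^ 4 * A1 ^ 3))"
    using A K \<delta> m by (intro ennreal_plus[symmetric]) auto
  finally show ?thesis by (simp add: K_def m_def)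
qed

text \<open>P j and N j are unnormalised posterior weights of a spike t or -t at position j, and H
  is an arbitrary estimate. With total weight T, the weighted squared loss is smallest at the
  posterior mean t (P l - N l) / T; what is dropped is the sum of the squares (T H l - t (P l - N
  l))^2 / T.\<close>

lemma spike_quadratic_bound:
  fixes P N H :: "'a \<Rightarrow> real"
  assumes B: "finite B" and pos: "0 < (\<Sum>j\<in>B. P j + N j)"
  shows "t\<^sup>2 * (\<Sum>j\<in>B. P j + N j)
    \<le> (\<Sum>j\<in>B. P j * (\<Sum>l\<in>B. (H l - (if l = j then t else 0))\<^sup>2) + N j * (\<Sum>l\<in>B. (H l - (if l = j then - t else 0))\<^sup>2))
      + t\<^sup>2 * (\<Sum>l\<in>B. (P l - N l)\<^sup>2 / (\<Sum>j\<in>B. P j + N j))"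
proof -
  define T where "T = (\<Sum>j\<in>B. P j + N j)"
  have sq: "(\<Sum>l\<in>B. (H l - (if l = j then s else 0))\<^sup>2) = (\<Sum>l\<in>B. (H l)\<^sup>2) - 2 * s * H j + s\<^sup>2" if "j \<in> B" for j s
  proof -
    have "(\<Sum>l\<in>B. (H l - (if l = j then s else 0))\<^sup>2) = (\<Sum>l\<in>B. (H l)\<^sup>2 + (if l = j then s\<^sup>2 - 2 * s * H l else 0))"
      by (intro sum.cong) (auto simp: power2_eq_square algebra_simps)
    then show ?thesis using B that by (simp add: sum.distrib)
  qed
  have "(\<Sum>j\<in>B. P j * (\<Sum>l\<in>B. (H l - (if l = j then t else 0))\<^sup>2) + N j * (\<Sum>l\<in>B. (H l - (if l = j then - t else 0))\<^sup>2))
     = (\<Sum>j\<in>B. (P j + N j) * ((\<Sum>l\<in>B. (H l)\<^sup>2) + t\<^sup>2) - 2 * t * H j * (P j - N j))"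
    by (intro sum.cong refl) (simp add: sq algebra_simps)
  also have "\<dots> = T * ((\<Sum>l\<in>B. (H l)\<^sup>2) + t\<^sup>2) - (\<Sum>j\<in>B. 2 * t * H j * (P j - N j))"
    by (simp add: sum_subtractf sum_distrib_right T_def)
  finally have 1: "(\<Sum>j\<in>B. P j * (\<Sum>l\<in>B. (H l - (if l = j then t else 0))\<^sup>2) + N j * (\<Sum>l\<in>B. (H l - (if l = j then - t else 0))\<^sup>2))
     = T * ((\<Sum>l\<in>B. (H l)\<^sup>2) + t\<^sup>2) - (\<Sum>j\<in>B. 2 * t * H j * (P j - N j))" .
  have T: "0 < T" using pos by (simp add: T_def)
  have "0 \<le> (\<Sum>l\<in>B. (T * H l - t * (P l - N l))\<^sup>2 / T)"
    using pos by (intro sum_nonneg) (auto simp: T_def)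
  also have "\<dots> = (\<Sum>l\<in>B. T * (H l)\<^sup>2 - 2 * t * H l * (P l - N l) + t\<^sup>2 * ((P l - N l)\<^sup>2 / T))"
    using T by (intro sum.cong refl) (simp add: power2_eq_square field_simps)
  also have "\<dots> = T * (\<Sum>l\<in>B. (H l)\<^sup>2) - (\<Sum>l\<in>B. 2 * t * H l * (P l - N l)) + t\<^sup>2 * (\<Sum>l\<in>B. (P l - N l)\<^sup>2 / T)"
    by (simp add: sum.distrib sum_subtractf sum_distrib_left)
  finally show ?thesis unfolding 1 T_def[symmetric] by (simp add: algebra_simps)
qed

section \<open>Moments of the likelihood ratio of a spike\<close>

lemma nn_integral_PiM_normal_exp:
  assumes v: "0 < v" and c: "0 < 1 + c * v"
  shows "(\<integral>\<^sup>+x. ennreal (exp (\<Sum>i<n. \<alpha> * u i * x i - c * (x i)\<^sup>2 / 2)) \<partial>PiM {..<n} (\<lambda>_. normal_measure 0 v))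
    = ennreal (exp (\<alpha>\<^sup>2 * v / (2 * (1 + c * v)) * (\<Sum>i<n. (u i)\<^sup>2)) / sqrt (1 + c * v) ^ n)"
proof -
  interpret V: prob_space "normal_measure 0 v" by (rule prob_space_normal_measure) (rule v)
  interpret PV: product_prob_space "\<lambda>_. normal_measure 0 v" "{..<n}" ..
  have "(\<integral>\<^sup>+x. ennreal (exp (\<Sum>i<n. \<alpha> * u i * x i - c * (x i)\<^sup>2 / 2)) \<partial>PiM {..<n} (\<lambda>_. normal_measure 0 v))
     = (\<integral>\<^sup>+x. (\<Prod>i<n. ennreal (exp (\<alpha> * u i * x i - c * (x i)\<^sup>2 / 2))) \<partial>PiM {..<n} (\<lambda>_. normal_measure 0 v))"
    by (simp add: prod_ennreal exp_sum)
  also have "\<dots> = (\<Prod>i<n. \<integral>\<^sup>+x. ennreal (exp (\<alpha> * u i * x - c * x\<^sup>2 / 2)) \<partial>normal_measure 0 v)"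
    by (intro PV.product_nn_integral_prod) auto
  also have "\<dots> = (\<Prod>i<n. ennreal (exp ((\<alpha> * u i)\<^sup>2 * v / (2 * (1 + c * v))) / sqrt (1 + c * v)))"
    by (simp add: nn_integral_normal_exp[OF v c])
  also have "\<dots> = ennreal (\<Prod>i<n. exp ((\<alpha> * u i)\<^sup>2 * v / (2 * (1 + c * v))) / sqrt (1 + c * v))"
    using c by (intro prod_ennreal) auto
  also have "(\<Prod>i<n. exp ((\<alpha> * u i)\<^sup>2 * v / (2 * (1 + c * v))) / sqrt (1 + c * v))
     = exp (\<alpha>\<^sup>2 * v / (2 * (1 + c * v)) * (\<Sum>i<n. (u i)\<^sup>2)) / sqrt (1 + c * v) ^ n"
    by (simp add: prod_dividef exp_sum[symmetric] sum_distrib_left sum_divide_distrib power_mult_distrib ac_simps)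
  finally show ?thesis .
qed

text \<open>The likelihood ratio of adding the mean \<open>a x\<close> to the standard normal noise \<open>u\<close>.\<close>

definition tilt :: "nat \<Rightarrow> real \<Rightarrow> (nat \<Rightarrow> real) \<Rightarrow> (nat \<Rightarrow> real) \<Rightarrow> real" where
  "tilt n a x u = exp (\<Sum>i<n. a * x i * u i - (a * x i)\<^sup>2 / 2)"

lemma tilt_pos: "0 < tilt n a x u"
  by (simp add: tilt_def)

text \<open>Here the column is random and the noise is fixed. The result involves u only through its
  squared norm, so that the later integration over the noise is a matter of chi-square moment
  generating functions.\<close>

lemma nn_integral_tilt:
  assumes v: "0 < v"
  shows "(\<integral>\<^sup>+x. ennreal (tilt n a x u) \<partial>PiM {..<n} (\<lambda>_. normal_measure 0 v))
    = ennreal (exp (a\<^sup>2 * v / (2 * (1 + a\<^sup>2 * v)) * (\<Sum>i<n. (u i)\<^sup>2)) / sqrt (1 + a\<^sup>2 * v) ^ n)"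
  using nn_integral_PiM_normal_exp[OF v, of "a\<^sup>2" n a u] v
  by (simp add: tilt_def power_mult_distrib add_pos_nonneg mult.commute mult.left_commute)

lemma nn_integral_tilt_square:
  assumes v: "0 < v"
  shows "(\<integral>\<^sup>+x. ennreal ((tilt n a x u)\<^sup>2) \<partial>PiM {..<n} (\<lambda>_. normal_measure 0 v))
    = ennreal (exp (2 * a\<^sup>2 * v / (1 + 2 * a\<^sup>2 * v) * (\<Sum>i<n. (u i)\<^sup>2)) / sqrt (1 + 2 * a\<^sup>2 * v) ^ n)"
proof -
  have "(tilt n a x u)\<^sup>2 = exp (\<Sum>i<n. (2 * a) * u i * x i - (2 * a\<^sup>2) * (x i)\<^sup>2 / 2)" for x
    by (simp add: tilt_def power2_eq_square exp_add[symmetric] sum.distrib[symmetric] algebra_simps)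
  moreover have "(2 * a)\<^sup>2 * v / (2 * (1 + 2 * a\<^sup>2 * v)) = 2 * a\<^sup>2 * v / (1 + 2 * a\<^sup>2 * v)"
    using v by (simp add: power2_eq_square divide_simps add_pos_nonneg)
  ultimately show ?thesis
    using nn_integral_PiM_normal_exp[OF v, of "2 * a\<^sup>2" n "2 * a" u] v by (simp add: add_pos_nonneg)
qed

lemma measurable_tilt [measurable]:
  assumes "sets V = sets borel"
  shows "(\<lambda>x. tilt n a x u) \<in> borel_measurable (PiM {..<n} (\<lambda>_. V))"
proof -
  have [measurable]: "(\<lambda>x. x i) \<in> borel_measurable (PiM {..<n} (\<lambda>_. V))" if "i < n" for i
  proof -
    have "(\<lambda>x. x i) \<in> measurable (PiM {..<n} (\<lambda>_. V)) V"
      using that by (intro measurable_component_singleton) auto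
    then show ?thesis using measurable_cong_sets[OF refl assms, of "PiM {..<n} (\<lambda>_. V)"] by simp
  qed
  show ?thesis unfolding tilt_def by measurable
qed

text \<open>The ratio bound is applied, for fixed noise, to the sum L and the difference d of the
  likelihood ratios of the two signs. Its leading term is A3 / A1 = b / a, so A3 has to be sharp,
  while A2 enters only the tail term and may lose a constant factor.\<close>

lemma nn_integral_posterior_bound:
  fixes n p :: nat and \<mu> v :: real
  assumes v: "0 < v" and B: "B \<subseteq> {..<p}" "l \<in> B" "2 \<le> card B" and \<delta>: "0 < \<delta>" "\<delta> < 1"
  defines "a \<equiv> \<lambda>R. exp (\<mu>\<^sup>2 * v / (2 * (1 + \<mu>\<^sup>2 * v)) * R) / sqrt (1 + \<mu>\<^sup>2 * v) ^ n"
    and "b \<equiv> \<lambda>R. exp (2 * \<mu>\<^sup>2 * v / (1 + 2 * \<mu>\<^sup>2 * v) * R) / sqrt (1 + 2 * \<mu>\<^sup>2 * v) ^ n"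
  shows "(\<integral>\<^sup>+c. ennreal ((tilt n \<mu> (c l) u - tilt n (- \<mu>) (c l) u)\<^sup>2 / (\<Sum>j\<in>B. tilt n \<mu> (c j) u + tilt n (- \<mu>) (c j) u))
      \<partial>PiM {..<p} (\<lambda>_. PiM {..<n} (\<lambda>_. normal_measure 0 v)))
    \<le> ennreal (b (\<Sum>i<n. (u i)\<^sup>2) / a (\<Sum>i<n. (u i)\<^sup>2) / ((1 - \<delta>) * (real (card B) - 1))
        + 16 * ((b (\<Sum>i<n. (u i)\<^sup>2))\<^sup>2 / a (\<Sum>i<n. (u i)\<^sup>2) ^ 3) / ((real (card B) - 1)\<^sup>2 * \<delta> ^ 4))"
proof -
  define R where "R = (\<Sum>i<n. (u i)\<^sup>2)"
  let ?M = "PiM {..<n} (\<lambda>_. normal_measure 0 v)"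
  let ?p = "\<lambda>x. tilt n \<mu> x u" and ?q = "\<lambda>x. tilt n (- \<mu>) x u"
  have ab: "0 < a R" "0 < b R" using v by (auto simp: a_def b_def add_pos_nonneg)
  have M: "prob_space ?M" by (intro prob_space_PiM prob_space_normal_measure v)
  have [measurable]: "?p \<in> borel_measurable ?M" "?q \<in> borel_measurable ?M" by (auto intro!: measurable_tilt)
  have p1: "(\<integral>\<^sup>+x. ennreal (?p x) \<partial>?M) = ennreal (a R)" "(\<integral>\<^sup>+x. ennreal (?q x) \<partial>?M) = ennreal (a R)"
    using nn_integral_tilt[OF v, of n \<mu> u] nn_integral_tilt[OF v, of n "- \<mu>" u] by (auto simp: a_def R_def)
  have p2: "(\<integral>\<^sup>+x. ennreal ((?p x)\<^sup>2) \<partial>?M) = ennreal (b R)" "(\<integral>\<^sup>+x. ennreal ((?q x)\<^sup>2) \<partial>?M) = ennreal (b R)"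
    using nn_integral_tilt_square[OF v, of n \<mu> u] nn_integral_tilt_square[OF v, of n "- \<mu>" u] by (auto simp: b_def R_def)
  have two: "ennreal x + ennreal x = ennreal (2 * x)" if "0 < x" for x
    using ennreal_plus[of x x] that by simp
  have s2: "(\<integral>\<^sup>+x. ennreal ((?p x)\<^sup>2) + ennreal ((?q x)\<^sup>2) \<partial>?M) = ennreal (2 * b R)"
    using two[OF ab(2)] by (subst nn_integral_add) (auto simp: p2)
  have "(\<integral>\<^sup>+c. ennreal ((?p (c l) - ?q (c l))\<^sup>2 / (\<Sum>j\<in>B. ?p (c j) + ?q (c j))) \<partial>PiM {..<p} (\<lambda>_. ?M))
    \<le> ennreal ((2 * b R) / ((1 - \<delta>) * (real (card B) - 1) * (2 * a R)) + 8 * (4 * b R)\<^sup>2 / ((real (card B) - 1)\<^sup>2 * \<delta> ^ 4 * (2 * a R) ^ 3))"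
  proof (rule nn_integral_ratio_bound[where M="?M" and J="{..<p}" and B=B and l=l and L="\<lambda>x. ?p x + ?q x" and d="\<lambda>x. ?p x - ?q x" and \<delta>=\<delta>
      and ?A1.0="2 * a R" and ?A2.0="4 * b R" and ?A3.0="2 * b R"])
    show "0 < ?p x + ?q x" "\<bar>?p x - ?q x\<bar> \<le> ?p x + ?q x" for x
      using tilt_pos[of n \<mu> x u] tilt_pos[of n "- \<mu>" x u] by auto
    show "(\<integral>\<^sup>+x. ennreal (?p x + ?q x) \<partial>?M) = ennreal (2 * a R)"
      using two[OF ab(1)]
      by (simp add: nn_integral_add p1 ennreal_plus[OF less_imp_le[OF tilt_pos] less_imp_le[OF tilt_pos]] del: ennreal_plus)
    have "(\<integral>\<^sup>+x. ennreal ((?p x + ?q x)\<^sup>2) \<partial>?M) \<le> (\<integral>\<^sup>+x. ennreal 2 * (ennreal ((?p x)\<^sup>2) + ennreal ((?q x)\<^sup>2)) \<partial>?M)"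
    proof (intro nn_integral_mono)
      fix x
      have "(?p x + ?q x)\<^sup>2 \<le> 2 * ((?p x)\<^sup>2 + (?q x)\<^sup>2)"
        using zero_le_power2[of "?p x - ?q x"] by (simp add: power2_eq_square algebra_simps)
      then have "ennreal ((?p x + ?q x)\<^sup>2) \<le> ennreal (2 * ((?p x)\<^sup>2 + (?q x)\<^sup>2))" by (rule ennreal_leI)
      then show "ennreal ((?p x + ?q x)\<^sup>2) \<le> ennreal 2 * (ennreal ((?p x)\<^sup>2) + ennreal ((?q x)\<^sup>2))"
        by (subst (asm) ennreal_mult) auto
    qed
    also have "\<dots> = ennreal 2 * ennreal (2 * b R)"
      by (subst nn_integral_cmult) (auto simp: s2)
    also have "\<dots> = ennreal (4 * b R)" using ab by (subst ennreal_mult[symmetric]) auto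
    finally show "(\<integral>\<^sup>+x. ennreal ((?p x + ?q x)\<^sup>2) \<partial>?M) \<le> ennreal (4 * b R)" .
    \<comment> \<open>Dropping the negative cross term keeps A3 = 2 b; the cruder 4 b accepted for
      the sum would double the leading constant.\<close>
    have "(\<integral>\<^sup>+x. ennreal ((?p x - ?q x)\<^sup>2) \<partial>?M) \<le> (\<integral>\<^sup>+x. ennreal ((?p x)\<^sup>2) + ennreal ((?q x)\<^sup>2) \<partial>?M)"
    proof (intro nn_integral_mono)
      fix x
      have "(?p x - ?q x)\<^sup>2 \<le> (?p x)\<^sup>2 + (?q x)\<^sup>2"
        using mult_pos_pos[OF tilt_pos[of n \<mu> x u] tilt_pos[of n "- \<mu>" x u]] by (simp add: power2_eq_square algebra_simps)
      then show "ennreal ((?p x - ?q x)\<^sup>2) \<le> ennreal ((?p x)\<^sup>2) + ennreal ((?q x)\<^sup>2)"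
        by (simp add: ennreal_plus[symmetric] ennreal_leI del: ennreal_plus)
    qed
    then show "(\<integral>\<^sup>+x. ennreal ((?p x - ?q x)\<^sup>2) \<partial>?M) \<le> ennreal (2 * b R)" by (simp only: s2)
  qed (use ab \<delta> B M in auto)
  also have "(2 * b R) / ((1 - \<delta>) * (real (card B) - 1) * (2 * a R)) = b R / a R / ((1 - \<delta>) * (real (card B) - 1))"
    by simp
  also have "8 * (4 * b R)\<^sup>2 / ((real (card B) - 1)\<^sup>2 * \<delta> ^ 4 * (2 * a R) ^ 3) = 16 * ((b R)\<^sup>2 / a R ^ 3) / ((real (card B) - 1)\<^sup>2 * \<delta> ^ 4)"
    using B ab \<delta> by (simp add: field_simps power_mult_distrib)
  finally show ?thesis unfolding R_def .
qed

text \<open>The moment generating function is exactly (1 - 2 \<kappa> v)^(-n/2). The hypothesis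
  keeps 2 \<kappa> v within 1/2 of 0, where |ln (1 + y) - y| <= 2 y^2 is available; this is the
  source of the factor 4.\<close>

lemma nn_integral_chi_square_exp:
  assumes v: "0 < v" and \<kappa>: "\<bar>\<kappa> * v\<bar> \<le> 1 / 4"
  shows "(\<integral>\<^sup>+x. ennreal (exp (\<kappa> * (\<Sum>i<n. (x i)\<^sup>2))) \<partial>PiM {..<n} (\<lambda>_. normal_measure 0 v))
    \<le> ennreal (exp (real n * (\<kappa> * v + 4 * (\<kappa> * v)\<^sup>2)))"
proof -
  let ?y = "1 - 2 * (\<kappa> * v)"
  have y: "0 < ?y" using \<kappa> by auto
  have "(\<integral>\<^sup>+x. ennreal (exp (\<kappa> * (\<Sum>i<n. (x i)\<^sup>2))) \<partial>PiM {..<n} (\<lambda>_. normal_measure 0 v))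
     = ennreal (1 / sqrt ?y ^ n)"
    using nn_integral_PiM_normal_exp[OF v, of "- 2 * \<kappa>" n 0 "\<lambda>_. 0"] y by (simp add: sum_distrib_left mult.assoc)
  also have "1 / sqrt ?y ^ n = exp (real n * (- ln ?y / 2))"
  proof -
    have "sqrt ?y = exp (ln ?y / 2)"
      using y by (intro real_sqrt_unique) (auto simp: power2_eq_square exp_add[symmetric])
    moreover have "1 / exp t ^ n = exp (real n * (- t))" for t :: real
      by (simp add: exp_minus exp_of_nat_mult divide_inverse)
    ultimately show ?thesis by (simp only: minus_divide_left)
  qed
  also have "\<dots> \<le> exp (real n * (\<kappa> * v + 4 * (\<kappa> * v)\<^sup>2))"
  proof -
    have "\<bar>ln (1 + (- 2 * (\<kappa> * v))) - (- 2 * (\<kappa> * v))\<bar> \<le> 2 * (- 2 * (\<kappa> * v))\<^sup>2"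
      using \<kappa> by (intro abs_ln_one_plus_x_minus_x_bound) auto
    then have "- ln ?y / 2 \<le> \<kappa> * v + 4 * (\<kappa> * v)\<^sup>2" by (simp add: power_mult_distrib abs_le_iff)
    then show ?thesis unfolding exp_le_cancel_iff by (intro mult_left_mono) auto
  qed
  finally show ?thesis by (simp add: ennreal_leI)
qed

lemma one_plus_sqrt_bounds:
  fixes w :: real assumes "0 \<le> w" "w \<le> 1 / 100"
  shows "sqrt (1 + w) \<le> exp (w / 2)" "1 / sqrt (1 + 2 * w) \<le> exp (- w + 2 * w\<^sup>2)"
proof -
  have "1 + w \<le> exp w" by simp
  then have "sqrt (1 + w) \<le> sqrt (exp w)" by (rule real_sqrt_le_mono)
  also have "sqrt (exp w) = exp (w / 2)" by (rule real_sqrt_unique) (auto simp: power2_eq_square exp_add[symmetric])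
  finally show "sqrt (1 + w) \<le> exp (w / 2)" .
  have "2 * w - (2 * w)\<^sup>2 \<le> ln (1 + 2 * w)" using assms by (intro ln_one_plus_pos_lower_bound) auto
  then have "exp (2 * w - (2 * w)\<^sup>2) \<le> 1 + 2 * w" using assms by (simp add: ln_ge_iff)
  then have "sqrt (exp (2 * w - (2 * w)\<^sup>2)) \<le> sqrt (1 + 2 * w)" by (rule real_sqrt_le_mono)
  also have "sqrt (exp (2 * w - (2 * w)\<^sup>2)) = exp (w - 2 * w\<^sup>2)"
    by (rule real_sqrt_unique) (auto simp: power2_eq_square exp_add[symmetric])
  finally have "exp (w - 2 * w\<^sup>2) \<le> sqrt (1 + 2 * w)" .
  then have "1 / sqrt (1 + 2 * w) \<le> 1 / exp (w - 2 * w\<^sup>2)" using assms(1)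
    by (intro divide_left_mono mult_pos_pos) auto
  also have "\<dots> = exp (- w + 2 * w\<^sup>2)" by (simp add: exp_minus[symmetric] divide_inverse)
  finally show "1 / sqrt (1 + 2 * w) \<le> exp (- w + 2 * w\<^sup>2)" .
qed

text \<open>With w = \<mu>^2 / n and R the squared norm of the noise, which is about n, the
  first-order terms in the exponent of b / a are (2 w - w / 2) R from the numerators and n (- w + w
  / 2) from the normalisers; together they give n w = \<mu>^2. The second-order terms have size n
  w^2 = \<mu>^4 / n. For the second ratio any exponent of order \<mu>^2 suffices, so its constant 7
  is generous.\<close>

lemma nn_integral_tilt_ratios:
  fixes \<mu> :: real and n :: nat
  assumes n: "0 < n" and small: "\<mu>\<^sup>2 / real n \<le> 1 / 100"
  defines "v \<equiv> 1 / real n"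
  defines "a \<equiv> \<lambda>R. exp (\<mu>\<^sup>2 * v / (2 * (1 + \<mu>\<^sup>2 * v)) * R) / sqrt (1 + \<mu>\<^sup>2 * v) ^ n"
    and "b \<equiv> \<lambda>R. exp (2 * \<mu>\<^sup>2 * v / (1 + 2 * \<mu>\<^sup>2 * v) * R) / sqrt (1 + 2 * \<mu>\<^sup>2 * v) ^ n"
  shows "(\<integral>\<^sup>+u. ennreal (b (\<Sum>i<n. (u i)\<^sup>2) / a (\<Sum>i<n. (u i)\<^sup>2)) \<partial>PiM {..<n} (\<lambda>_. normal_measure 0 1))
      \<le> ennreal (exp (\<mu>\<^sup>2 + 12 * \<mu> ^ 4 / real n))" (is ?A)
    and "(\<integral>\<^sup>+u. ennreal ((b (\<Sum>i<n. (u i)\<^sup>2))\<^sup>2 / a (\<Sum>i<n. (u i)\<^sup>2) ^ 3) \<partial>PiM {..<n} (\<lambda>_. normal_measure 0 1))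
      \<le> ennreal (exp (7 * \<mu>\<^sup>2))" (is ?B)
proof -
  define w where "w = \<mu>\<^sup>2 * v"
  have w: "0 \<le> w" "w \<le> 1 / 100" using small by (auto simp: w_def v_def)
  have nw: "real n * w = \<mu>\<^sup>2" "real n * w\<^sup>2 = \<mu> ^ 4 / real n"
    using n by (auto simp: w_def v_def power2_eq_square power4_eq_xxxx)
  let ?U = "PiM {..<n} (\<lambda>_. normal_measure 0 1)"
  have a: "a R = exp (w / (2 * (1 + w)) * R) / sqrt (1 + w) ^ n" for R by (simp add: a_def w_def)
  have b: "b R = exp (2 * w / (1 + 2 * w) * R) / sqrt (1 + 2 * w) ^ n" for R by (simp add: b_def w_def mult.assoc)
  have e1: "w / (2 * (1 + w)) \<ge> w / 2 - w\<^sup>2 / 2"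
    using w by (simp add: field_simps power2_eq_square)
  have e2: "2 * w / (1 + 2 * w) \<le> 2 * w"
    using w by (simp add: field_simps)
  have b_le: "b R \<le> exp (2 * w * R) * exp (real n * (- w + 2 * w\<^sup>2))" if "0 \<le> R" for R
  proof -
    have "b R = exp (2 * w / (1 + 2 * w) * R) * (1 / sqrt (1 + 2 * w)) ^ n" by (simp add: b power_divide)
    also have "\<dots> \<le> exp (2 * w * R) * exp (- w + 2 * w\<^sup>2) ^ n"
      using mult_right_mono[OF e2 that] w one_plus_sqrt_bounds[OF w]
      by (intro mult_mono power_mono) auto
    finally show ?thesis unfolding exp_of_nat_mult .
  qed
  have ia_le: "1 / a R \<le> exp (- (w / 2 - w\<^sup>2 / 2) * R) * exp (real n * (w / 2))" if "0 \<le> R" for R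
  proof -
    have "1 / a R = exp (- (w / (2 * (1 + w)) * R)) * sqrt (1 + w) ^ n"
      by (simp add: a exp_minus divide_inverse)
    also have "\<dots> \<le> exp (- (w / 2 - w\<^sup>2 / 2) * R) * exp (w / 2) ^ n"
    proof (intro mult_mono power_mono)
      show "exp (- (w / (2 * (1 + w)) * R)) \<le> exp (- (w / 2 - w\<^sup>2 / 2) * R)"
        unfolding exp_le_cancel_iff using mult_right_mono[OF e1 that] by linarith
    qed (use w one_plus_sqrt_bounds[OF w] in auto)
    finally show ?thesis unfolding exp_of_nat_mult .
  qed
  have pos: "0 < a R" "0 < b R" for R using w by (auto simp: a b)
  have R0: "0 \<le> (\<Sum>i<n. (u i)\<^sup>2)" for u :: "nat \<Rightarrow> real" by (intro sum_nonneg) auto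
  have mgf: "(\<integral>\<^sup>+u. ennreal (F (\<Sum>i<n. (u i)\<^sup>2)) \<partial>?U) \<le> ennreal (exp (real n * (e + (\<kappa> + 4 * \<kappa>\<^sup>2))))"
    if F: "\<And>R. 0 \<le> R \<Longrightarrow> F R \<le> exp (\<kappa> * R) * exp (real n * e)" and \<kappa>: "\<bar>\<kappa>\<bar> \<le> 1 / 4" for F \<kappa> e
  proof -
    have [measurable]: "(\<lambda>u. u i) \<in> borel_measurable ?U" if "i < n" for i
      using measurable_component_singleton[of i "{..<n}" "\<lambda>_. normal_measure 0 1"] that
        measurable_cong_sets[OF refl sets_normal_measure[of 0 1], of ?U] by auto
    have "(\<integral>\<^sup>+u. ennreal (F (\<Sum>i<n. (u i)\<^sup>2)) \<partial>?U)
      \<le> (\<integral>\<^sup>+u. ennreal (exp (real n * e)) * ennreal (exp (\<kappa> * (\<Sum>i<n. (u i)\<^sup>2))) \<partial>?U)"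
    proof (intro nn_integral_mono)
      fix u
      show "ennreal (F (\<Sum>i<n. (u i)\<^sup>2)) \<le> ennreal (exp (real n * e)) * ennreal (exp (\<kappa> * (\<Sum>i<n. (u i)\<^sup>2)))"
        using ennreal_leI[OF F[OF R0[of u]]] by (subst (asm) ennreal_mult) (auto simp: mult.commute)
    qed
    also have "\<dots> = ennreal (exp (real n * e)) * (\<integral>\<^sup>+u. ennreal (exp (\<kappa> * (\<Sum>i<n. (u i)\<^sup>2))) \<partial>?U)"
      by (intro nn_integral_cmult measurable_compose[OF _ measurable_ennreal] borel_measurable_exp
          borel_measurable_times borel_measurable_sum borel_measurable_power borel_measurable_const) auto
    also have "\<dots> \<le> ennreal (exp (real n * e)) * ennreal (exp (real n * (\<kappa> + 4 * \<kappa>\<^sup>2)))"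
      using nn_integral_chi_square_exp[of 1 \<kappa> n] \<kappa> by (intro mult_left_mono) auto
    also have "\<dots> = ennreal (exp (real n * (e + (\<kappa> + 4 * \<kappa>\<^sup>2))))"
      by (simp add: ennreal_mult'[symmetric] exp_add[symmetric] distrib_left)
    finally show ?thesis .
  qed
  define \<kappa> where "\<kappa> = 2 * w - (w / 2 - w\<^sup>2 / 2)"
  have w2: "0 \<le> w\<^sup>2" "w\<^sup>2 \<le> w / 100" using mult_left_mono[OF w(2,1)] by (auto simp: power2_eq_square)
  have k: "0 \<le> \<kappa>" "\<kappa> \<le> 151 / 100 * w" using w w2 unfolding \<kappa>_def by linarith+
  have "\<kappa>\<^sup>2 \<le> (151 / 100 * w)\<^sup>2" using k by (intro power_mono) auto
  also have "(151 / 100 * w)\<^sup>2 = 22801 / 10000 * w\<^sup>2" by (simp add: power_mult_distrib power_divide)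
  \<comment> \<open>The coefficients of w^2 will add up to at most 2 + 1 / 2 + 19 / 2 = 12.\<close>
  finally have k2: "4 * \<kappa>\<^sup>2 \<le> 19 / 2 * w\<^sup>2" using w2 by linarith
  have k3: "\<kappa> = 3 / 2 * w + w\<^sup>2 / 2" by (simp add: \<kappa>_def)
  have "(\<integral>\<^sup>+u. ennreal (b (\<Sum>i<n. (u i)\<^sup>2) / a (\<Sum>i<n. (u i)\<^sup>2)) \<partial>?U)
     \<le> ennreal (exp (real n * ((- w + 2 * w\<^sup>2 + w / 2) + (\<kappa> + 4 * \<kappa>\<^sup>2))))"
  proof (rule mgf[where F="\<lambda>R. b R / a R" and \<kappa>=\<kappa> and e="- w + 2 * w\<^sup>2 + w / 2"])
    fix R :: real assume R: "0 \<le> R"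
    have "b R / a R = b R * (1 / a R)" by simp
    also have "\<dots> \<le> (exp (2 * w * R) * exp (real n * (- w + 2 * w\<^sup>2))) * (exp (- (w / 2 - w\<^sup>2 / 2) * R) * exp (real n * (w / 2)))"
      using b_le[OF R] ia_le[OF R] pos[of R] by (intro mult_mono) auto
    also have "\<dots> = exp (\<kappa> * R) * exp (real n * (- w + 2 * w\<^sup>2 + w / 2))"
      unfolding exp_add[symmetric] exp_inj_iff \<kappa>_def by (simp add: algebra_simps)
    finally show "b R / a R \<le> exp (\<kappa> * R) * exp (real n * (- w + 2 * w\<^sup>2 + w / 2))" .
  qed (use w k in linarith)
  also have "\<dots> \<le> ennreal (exp (real n * (w + 12 * w\<^sup>2)))"
    using k2 k3 w2 by (intro ennreal_leI, unfold exp_le_cancel_iff, intro mult_left_mono) linarith+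
  also have "real n * (w + 12 * w\<^sup>2) = \<mu>\<^sup>2 + 12 * \<mu> ^ 4 / real n" using nw by (simp add: distrib_left)
  finally show ?A .
  have "(\<integral>\<^sup>+u. ennreal ((b (\<Sum>i<n. (u i)\<^sup>2))\<^sup>2 / a (\<Sum>i<n. (u i)\<^sup>2) ^ 3) \<partial>?U)
     \<le> ennreal (exp (real n * ((2 * (- w + 2 * w\<^sup>2) + 3 * (w / 2)) + (4 * w + 4 * (4 * w)\<^sup>2))))"
  proof (rule mgf[where F="\<lambda>R. (b R)\<^sup>2 / a R ^ 3" and \<kappa>="4 * w" and e="2 * (- w + 2 * w\<^sup>2) + 3 * (w / 2)"])
    fix R :: real assume R: "0 \<le> R"
    have "(b R)\<^sup>2 / a R ^ 3 = (b R)\<^sup>2 * (1 / a R) ^ 3" by (simp add: power_divide)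
    also have "\<dots> \<le> (exp (2 * w * R) * exp (real n * (- w + 2 * w\<^sup>2)))\<^sup>2 * (exp (- (w / 2 - w\<^sup>2 / 2) * R) * exp (real n * (w / 2))) ^ 3"
      by (intro mult_mono power_mono b_le[OF R] ia_le[OF R] less_imp_le[OF pos(2)] zero_le_power zero_le_power2
          less_imp_le[OF divide_pos_pos[OF zero_less_one pos(1)]])
    also have "\<dots> = exp ((4 * w - 3 * (w / 2 - w\<^sup>2 / 2)) * R) * exp (real n * (2 * (- w + 2 * w\<^sup>2) + 3 * (w / 2)))"
    proof -
      have *: "(exp x * exp y)\<^sup>2 * (exp z * exp t) ^ 3 = exp (2 * (x + y) + 3 * (z + t))" for x y z t :: real
        by (simp add: exp_add[symmetric] exp_of_nat_mult[symmetric])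
      show ?thesis
        unfolding * unfolding exp_add[symmetric] exp_inj_iff by (simp add: algebra_simps)
    qed
    also have "\<dots> \<le> exp (4 * w * R) * exp (real n * (2 * (- w + 2 * w\<^sup>2) + 3 * (w / 2)))"
    proof (intro mult_right_mono)
      show "exp ((4 * w - 3 * (w / 2 - w\<^sup>2 / 2)) * R) \<le> exp (4 * w * R)"
      proof -
        have "0 \<le> w / 2 - w\<^sup>2 / 2" using w w2 by linarith
        then have "4 * w - 3 * (w / 2 - w\<^sup>2 / 2) \<le> 4 * w" by simp
        then show ?thesis unfolding exp_le_cancel_iff using R by (rule mult_right_mono)
      qed
    qed auto
    finally show "(b R)\<^sup>2 / a R ^ 3 \<le> exp (4 * w * R) * exp (real n * (2 * (- w + 2 * w\<^sup>2) + 3 * (w / 2)))" .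
  qed (use w in linarith)
  also have "\<dots> \<le> ennreal (exp (real n * (7 * w)))"
  proof -
    have e: "(4 * w)\<^sup>2 = 16 * w\<^sup>2" by (simp add: power_mult_distrib)
    have "(2 * (- w + 2 * w\<^sup>2) + 3 * (w / 2)) + (4 * w + 4 * (4 * w)\<^sup>2) = 7 / 2 * w + 68 * w\<^sup>2" unfolding e by simp
    also have "\<dots> \<le> 7 * w" using w w2 by linarith
    finally have "(2 * (- w + 2 * w\<^sup>2) + 3 * (w / 2)) + (4 * w + 4 * (4 * w)\<^sup>2) \<le> 7 * w" .
    then show ?thesis by (intro ennreal_leI, unfold exp_le_cancel_iff, intro mult_left_mono) auto
  qed
  also have "real n * (7 * w) = 7 * \<mu>\<^sup>2" using nw(1) by simp
  finally show ?B .
qed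

text \<open>Given the columns, a spike s at a coordinate where \<beta> vanishes shifts the noise by
  s / \<sigma> times column j, so the shift formula applies. All positions and signs of the spike
  thereby share one probability space and differ only by the weight \<open>tilt\<close>.\<close>

lemma nn_integral_data_law_spike:
  fixes p :: nat
  assumes n: "0 < n" and \<sigma>: "0 < \<sigma>" and j: "j < p" "\<beta> j = 0"
    and f[measurable]: "f \<in> borel_measurable (data_space n p)"
  shows "(\<integral>\<^sup>+D. f D \<partial>data_law n p \<sigma> (\<beta>(j := s)))
    = (\<integral>\<^sup>+c. \<integral>\<^sup>+u. ennreal (tilt n (s / \<sigma>) (c j) u)
          * f (\<lambda>i\<in>{..<n}. ((\<Sum>j<p. c j i * \<beta> j) + \<sigma> * u i, \<lambda>j\<in>{..<p}. c j i))
        \<partial>PiM {..<n} (\<lambda>_. normal_measure 0 1) \<partial>PiM {..<p} (\<lambda>_. PiM {..<n} (\<lambda>_. normal_measure 0 (1 / real n))))"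
  unfolding nn_integral_data_law[OF n f]
proof (rule nn_integral_cong)
  let ?C = "PiM {..<p} (\<lambda>_. PiM {..<n} (\<lambda>_. normal_measure 0 (1 / real n)))" and ?U = "PiM {..<n} (\<lambda>_. normal_measure 0 1)"
  fix c assume c: "c \<in> space ?C"
  define g where "g = (\<lambda>u. f (\<lambda>i\<in>{..<n}. ((\<Sum>j<p. c j i * \<beta> j) + \<sigma> * u i, \<lambda>j\<in>{..<p}. c j i)))"
  have g: "g \<in> borel_measurable ?U"
    using measurable_compose[OF measurable_compose[OF measurable_Pair1'[OF c]
        measurable_column_data[OF sets_normal_measure sets_normal_measure, where \<beta>=\<beta> and \<sigma>=\<sigma>]] f]
    by (simp add: g_def)
  have "(\<Sum>l<p. c l i * (\<beta>(j := s)) l) = (\<Sum>l<p. c l i * \<beta> l) + c j i * s" for i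
  proof -
    have "(\<Sum>l<p. c l i * (\<beta>(j := s)) l) = (\<Sum>l<p. c l i * \<beta> l + (if l = j then c j i * s else 0))"
      using j by (intro sum.cong) auto
    then show ?thesis using j by (simp add: sum.distrib)
  qed
  then have "(\<integral>\<^sup>+u. f (\<lambda>i\<in>{..<n}. ((\<Sum>l<p. c l i * (\<beta>(j := s)) l) + \<sigma> * u i, \<lambda>j\<in>{..<p}. c j i)) \<partial>?U)
      = (\<integral>\<^sup>+u. g (\<lambda>i\<in>{..<n}. u i + s / \<sigma> * c j i) \<partial>?U)"
    unfolding g_def using \<sigma>
    by - (intro nn_integral_cong, rule arg_cong[of _ _ f], auto simp: fun_eq_iff field_simps)
  also have "\<dots> = (\<integral>\<^sup>+u. (\<Prod>i<n. ennreal (exp (s / \<sigma> * c j i * u i - (s / \<sigma> * c j i)\<^sup>2 / 2))) * g u \<partial>?U)"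
    by (rule nn_integral_shift_PiM_std_normal) (auto intro: g)
  also have "\<dots> = (\<integral>\<^sup>+u. ennreal (tilt n (s / \<sigma>) (c j) u) * g u \<partial>?U)"
    by (simp add: tilt_def prod_ennreal exp_sum)
  finally show "(\<integral>\<^sup>+u. f (\<lambda>i\<in>{..<n}. ((\<Sum>l<p. c l i * (\<beta>(j := s)) l) + \<sigma> * u i, \<lambda>j\<in>{..<p}. c j i)) \<partial>?U)
     = (\<integral>\<^sup>+u. ennreal (tilt n (s / \<sigma>) (c j) u) * f (\<lambda>i\<in>{..<n}. ((\<Sum>j<p. c j i * \<beta> j) + \<sigma> * u i, \<lambda>j\<in>{..<p}. c j i)) \<partial>?U)"
    by (simp add: g_def)
qed

text \<open>The noise is integrated with the column fixed, in contrast to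
  \<open>nn_integral_tilt\<close>: a likelihood ratio has total mass one under the reference
  noise.\<close>

lemma nn_integral_tilt_noise:
  "(\<integral>\<^sup>+u. ennreal (tilt n a x u) \<partial>PiM {..<n} (\<lambda>_. normal_measure 0 1)) = 1"
proof -
  interpret U: prob_space "PiM {..<n} (\<lambda>_. normal_measure 0 1)" by (intro prob_space_PiM prob_space_normal_measure) auto
  show ?thesis
    using nn_integral_shift_PiM_std_normal[of "{..<n}" "\<lambda>_. 1" "\<lambda>i. a * x i"] U.emeasure_space_1
    by (simp add: tilt_def prod_ennreal exp_sum)
qed

lemma measurable_tilt_pair:
  assumes "j < p"
  shows "(\<lambda>w. tilt n a (fst w j) (snd w)) \<in> borel_measurable
    (PiM {..<p} (\<lambda>_. PiM {..<n} (\<lambda>_. normal_measure 0 v)) \<Otimes>\<^sub>M PiM {..<n} (\<lambda>_. normal_measure 0 1))" (is "_ \<in> borel_measurable ?M")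
proof -
  have c[measurable]: "(\<lambda>w. fst w j i) \<in> borel_measurable ?M" if "i < n" for i
  proof -
    have "(\<lambda>w. fst w j i) \<in> measurable ?M (normal_measure 0 v)"
      using measurable_compose[OF measurable_fst measurable_compose[OF measurable_component_singleton[of j "{..<p}" "\<lambda>_. PiM {..<n} (\<lambda>_. normal_measure 0 v)"]
        measurable_component_singleton[of i "{..<n}" "\<lambda>_. normal_measure 0 v"]]] that assms by simp
    then show ?thesis using measurable_cong_sets[OF refl sets_normal_measure[of 0 v]] by auto
  qed
  have u[measurable]: "(\<lambda>w. snd w i) \<in> borel_measurable ?M" if "i < n" for i
  proof -
    have "(\<lambda>w. snd w i) \<in> measurable ?M (normal_measure 0 1)"
      using measurable_compose[OF measurable_snd measurable_component_singleton[of i "{..<n}" "\<lambda>_. normal_measure 0 1"]] that by simp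
    then show ?thesis using measurable_cong_sets[OF refl sets_normal_measure[of 0 1]] by auto
  qed
  show ?thesis unfolding tilt_def by measurable
qed

text \<open>A bound for the mean of (P l - N l)^2 / T at one position l of a block with m positions.
  The first summand is the leading term, about exp (\<mu>^2) / m; the second pays for the event that
  the normalising sum is too small.\<close>

definition spike_gain :: "nat \<Rightarrow> real \<Rightarrow> nat \<Rightarrow> real \<Rightarrow> real" where
  "spike_gain n \<mu> m \<delta> = exp (\<mu>\<^sup>2 + 12 * \<mu> ^ 4 / real n) / ((1 - \<delta>) * (real m - 1))
     + 16 * exp (7 * \<mu>\<^sup>2) / ((real m - 1)\<^sup>2 * \<delta> ^ 4)"

lemma nn_integral_spike_gain:
  fixes p :: nat
  assumes n: "0 < n" and small: "\<mu>\<^sup>2 / real n \<le> 1 / 100"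
    and B: "B \<subseteq> {..<p}" "l \<in> B" "2 \<le> card B" and \<delta>: "0 < \<delta>" "\<delta> < 1"
  shows "(\<integral>\<^sup>+u. \<integral>\<^sup>+c. ennreal ((tilt n \<mu> (c l) u - tilt n (- \<mu>) (c l) u)\<^sup>2 / (\<Sum>j\<in>B. tilt n \<mu> (c j) u + tilt n (- \<mu>) (c j) u))
      \<partial>PiM {..<p} (\<lambda>_. PiM {..<n} (\<lambda>_. normal_measure 0 (1 / real n))) \<partial>PiM {..<n} (\<lambda>_. normal_measure 0 1))
    \<le> ennreal (spike_gain n \<mu> (card B) \<delta>)"
proof -
  define v where "v = 1 / real n"
  define a where "a = (\<lambda>R. exp (\<mu>\<^sup>2 * v / (2 * (1 + \<mu>\<^sup>2 * v)) * R) / sqrt (1 + \<mu>\<^sup>2 * v) ^ n)"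
  define b where "b = (\<lambda>R. exp (2 * \<mu>\<^sup>2 * v / (1 + 2 * \<mu>\<^sup>2 * v) * R) / sqrt (1 + 2 * \<mu>\<^sup>2 * v) ^ n)"
  define K1 where "K1 = 1 / ((1 - \<delta>) * (real (card B) - 1))"
  define K2 where "K2 = 16 / ((real (card B) - 1)\<^sup>2 * \<delta> ^ 4)"
  have v: "0 < v" using n by (simp add: v_def)
  have K: "0 \<le> K1" "0 \<le> K2" using B \<delta> by (auto simp: K1_def K2_def)
  have pos: "0 < a R" "0 < b R" for R using v by (auto simp: a_def b_def add_pos_nonneg)
  let ?U = "PiM {..<n} (\<lambda>_. normal_measure 0 1)" and ?R = "\<lambda>u. \<Sum>i<n. (u i)\<^sup>2"
  have [measurable]: "?R \<in> borel_measurable ?U"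
  proof -
    have "(\<lambda>u. u i) \<in> borel_measurable ?U" if "i < n" for i
      using measurable_component_singleton[of i "{..<n}" "\<lambda>_. normal_measure 0 1"] that
        measurable_cong_sets[OF refl sets_normal_measure[of 0 1], of ?U] by auto
    then show ?thesis by (intro borel_measurable_sum borel_measurable_power) auto
  qed
  have "(\<integral>\<^sup>+u. \<integral>\<^sup>+c. ennreal ((tilt n \<mu> (c l) u - tilt n (- \<mu>) (c l) u)\<^sup>2 / (\<Sum>j\<in>B. tilt n \<mu> (c j) u + tilt n (- \<mu>) (c j) u))
      \<partial>PiM {..<p} (\<lambda>_. PiM {..<n} (\<lambda>_. normal_measure 0 (1 / real n))) \<partial>?U)
    \<le> (\<integral>\<^sup>+u. ennreal K1 * ennreal (b (?R u) / a (?R u)) + ennreal K2 * ennreal ((b (?R u))\<^sup>2 / a (?R u) ^ 3) \<partial>?U)"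
  proof (rule nn_integral_mono)
    fix u
    have "0 \<le> b (?R u) / a (?R u)" "0 \<le> (b (?R u))\<^sup>2 / a (?R u) ^ 3" using pos by (auto simp: less_imp_le)
    then have "ennreal (K1 * (b (?R u) / a (?R u)) + K2 * ((b (?R u))\<^sup>2 / a (?R u) ^ 3))
      = ennreal K1 * ennreal (b (?R u) / a (?R u)) + ennreal K2 * ennreal ((b (?R u))\<^sup>2 / a (?R u) ^ 3)"
      using K by (simp only: ennreal_plus ennreal_mult mult_nonneg_nonneg)
    moreover have "b (?R u) / a (?R u) / ((1 - \<delta>) * (real (card B) - 1)) + 16 * ((b (?R u))\<^sup>2 / a (?R u) ^ 3) / ((real (card B) - 1)\<^sup>2 * \<delta> ^ 4)
      = K1 * (b (?R u) / a (?R u)) + K2 * ((b (?R u))\<^sup>2 / a (?R u) ^ 3)"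
      by (simp add: K1_def K2_def mult.commute)
    ultimately show "(\<integral>\<^sup>+c. ennreal ((tilt n \<mu> (c l) u - tilt n (- \<mu>) (c l) u)\<^sup>2 / (\<Sum>j\<in>B. tilt n \<mu> (c j) u + tilt n (- \<mu>) (c j) u))
        \<partial>PiM {..<p} (\<lambda>_. PiM {..<n} (\<lambda>_. normal_measure 0 (1 / real n))))
      \<le> ennreal K1 * ennreal (b (?R u) / a (?R u)) + ennreal K2 * ennreal ((b (?R u))\<^sup>2 / a (?R u) ^ 3)"
      using nn_integral_posterior_bound[OF v B \<delta>, of n \<mu> u] unfolding a_def b_def v_def by simp
  qed
  also have "\<dots> = ennreal K1 * (\<integral>\<^sup>+u. ennreal (b (?R u) / a (?R u)) \<partial>?U) + ennreal K2 * (\<integral>\<^sup>+u. ennreal ((b (?R u))\<^sup>2 / a (?R u) ^ 3) \<partial>?U)"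
    unfolding a_def b_def by (subst nn_integral_add) (auto simp: nn_integral_cmult)
  also have "\<dots> \<le> ennreal K1 * ennreal (exp (\<mu>\<^sup>2 + 12 * \<mu> ^ 4 / real n)) + ennreal K2 * ennreal (exp (7 * \<mu>\<^sup>2))"
    using nn_integral_tilt_ratios[OF n small]
    unfolding a_def b_def v_def by (intro add_mono mult_left_mono) auto
  also have "\<dots> = ennreal (spike_gain n \<mu> (card B) \<delta>)"
    using K by (simp add: ennreal_mult[symmetric] ennreal_plus[symmetric] spike_gain_def K1_def K2_def del: ennreal_plus)
  finally show ?thesis .
qed

text \<open>Over the 2 m spikes of a block with m positions the weights have total mass 2 m, while
  the posterior-mean term amounts to at most m times \<open>spike_gain\<close>; this ratio explains
  the halved gain. \<open>spike_quadratic_bound\<close> is applied pointwise in columns and noise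
  and therefore covers every measurable h.\<close>

lemma block_risk_bound:
  fixes p :: nat and \<beta> :: "nat \<Rightarrow> real"
  assumes n: "0 < n" and \<sigma>: "0 < \<sigma>" and \<tau>: "0 < \<tau>" and small: "(\<tau> / \<sigma>)\<^sup>2 / real n \<le> 1 / 100"
    and B: "B \<subseteq> {..<p}" "2 \<le> card B" and \<beta>: "\<And>j. j \<in> B \<Longrightarrow> \<beta> j = 0"
    and \<delta>: "0 < \<delta>" "\<delta> < 1" and h: "h \<in> estimators n p"
  shows "ennreal (2 * real (card B) * \<tau>\<^sup>2 * (1 - spike_gain n (\<tau> / \<sigma>) (card B) \<delta> / 2))
    \<le> (\<Sum>j\<in>B. \<Sum>s\<in>{\<tau>, - \<tau>}. \<integral>\<^sup>+D. ennreal (\<Sum>l\<in>B. (h D l - (\<beta>(j := s)) l)\<^sup>2) \<partial>data_law n p \<sigma> (\<beta>(j := s)))"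
proof -
  define \<mu> where "\<mu> = \<tau> / \<sigma>"
  let ?C = "PiM {..<p} (\<lambda>_. PiM {..<n} (\<lambda>_. normal_measure 0 (1 / real n)))" and ?U = "PiM {..<n} (\<lambda>_. normal_measure 0 1)"
  define DD where "DD = (\<lambda>(c :: nat \<Rightarrow> nat \<Rightarrow> real) (u :: nat \<Rightarrow> real). \<lambda>i\<in>{..<n}. ((\<Sum>j<p. c j i * \<beta> j) + \<sigma> * u i, \<lambda>j\<in>{..<p}. c j i))"
  define P where "P = (\<lambda>(c :: nat \<Rightarrow> nat \<Rightarrow> real) (u :: nat \<Rightarrow> real) j. tilt n \<mu> (c j) u)"
  define N where "N = (\<lambda>(c :: nat \<Rightarrow> nat \<Rightarrow> real) (u :: nat \<Rightarrow> real) j. tilt n (- \<mu>) (c j) u)"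
  define G where "G = (\<lambda>(c :: nat \<Rightarrow> nat \<Rightarrow> real) (u :: nat \<Rightarrow> real) j s. \<Sum>l\<in>B. (h (DD c u) l - (if l = j then s else 0))\<^sup>2)"
  define T where "T = (\<lambda>(c :: nat \<Rightarrow> nat \<Rightarrow> real) (u :: nat \<Rightarrow> real). \<Sum>j\<in>B. P c u j + N c u j)"
  define X where "X = (\<lambda>(c :: nat \<Rightarrow> nat \<Rightarrow> real) (u :: nat \<Rightarrow> real). \<Sum>l\<in>B. (P c u l - N c u l)\<^sup>2 / T c u)"
  define S where "S = (\<lambda>(c :: nat \<Rightarrow> nat \<Rightarrow> real) (u :: nat \<Rightarrow> real). \<Sum>j\<in>B. P c u j * G c u j \<tau> + N c u j * G c u j (- \<tau>))"
  let ?m = "card B"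
  have finB: "finite B" using B(1) finite_subset by auto
  have neB: "B \<noteq> {}" using B(2) by auto
  interpret U: prob_space ?U by (intro prob_space_PiM prob_space_normal_measure) auto
  have pC: "prob_space ?C" using n by (intro prob_space_PiM prob_space_normal_measure) auto
  interpret C: prob_space ?C by (rule pC)
  interpret CU: pair_prob_space ?C ?U ..
  have hl[measurable]: "(\<lambda>D. h D l) \<in> borel_measurable (data_space n p)" if "l < p" for l
  proof -
    have "h \<in> measurable (data_space n p) (PiM {..<p} (\<lambda>_. borel))" using h by (simp add: estimators_def borel_vec_def)
    from measurable_compose[OF this measurable_component_singleton[of l]] that show ?thesis by simp
  qed
  have DD[measurable]: "(\<lambda>w. DD (fst w) (snd w)) \<in> measurable (?C \<Otimes>\<^sub>M ?U) (data_space n p)"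
    using measurable_column_data[OF sets_normal_measure[of 0 "1 / real n"] sets_normal_measure[of 0 1], where n=n and p=p and \<beta>=\<beta> and \<sigma>=\<sigma>]
    unfolding DD_def case_prod_beta .
  have mP[measurable]: "(\<lambda>w. P (fst w) (snd w) j) \<in> borel_measurable (?C \<Otimes>\<^sub>M ?U)"
    and mN[measurable]: "(\<lambda>w. N (fst w) (snd w) j) \<in> borel_measurable (?C \<Otimes>\<^sub>M ?U)" if "j \<in> B" for j
    unfolding P_def N_def using B(1) that by (auto intro!: measurable_tilt_pair)
  have mG[measurable]: "(\<lambda>w. G (fst w) (snd w) j s) \<in> borel_measurable (?C \<Otimes>\<^sub>M ?U)" for j s
  proof -
    have "(\<lambda>w. h (DD (fst w) (snd w)) l) \<in> borel_measurable (?C \<Otimes>\<^sub>M ?U)" if "l \<in> B" for l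
      using measurable_compose[OF DD hl] B(1) that by auto
    then show ?thesis unfolding G_def
      by (intro borel_measurable_sum borel_measurable_power borel_measurable_diff) auto
  qed
  have mT[measurable]: "(\<lambda>w. T (fst w) (snd w)) \<in> borel_measurable (?C \<Otimes>\<^sub>M ?U)"
    unfolding T_def by (intro borel_measurable_sum borel_measurable_add mP mN)
  have mX1[measurable]: "(\<lambda>w. (P (fst w) (snd w) l - N (fst w) (snd w) l)\<^sup>2 / T (fst w) (snd w)) \<in> borel_measurable (?C \<Otimes>\<^sub>M ?U)" if "l \<in> B" for l
    by (intro borel_measurable_divide borel_measurable_power borel_measurable_diff mP mN mT that)
  have mX[measurable]: "(\<lambda>w. X (fst w) (snd w)) \<in> borel_measurable (?C \<Otimes>\<^sub>M ?U)"
    unfolding X_def by (intro borel_measurable_sum mX1)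
  have mS[measurable]: "(\<lambda>w. S (fst w) (snd w)) \<in> borel_measurable (?C \<Otimes>\<^sub>M ?U)"
    unfolding S_def by (intro borel_measurable_sum borel_measurable_add borel_measurable_times mP mN mG)
  have PN: "0 < P c u j" "0 < N c u j" for c u j by (auto simp: P_def N_def tilt_pos)
  have G0: "0 \<le> G c u j s" for c u j s unfolding G_def by (intro sum_nonneg) auto
  have T0: "0 < T c u" for c u unfolding T_def using finB neB PN by (intro sum_pos add_pos_pos) auto
  have X1: "0 \<le> (P c u l - N c u l)\<^sup>2 / T c u" for c u l using T0[of c u] by (simp add: less_imp_le)
  have X0: "0 \<le> X c u" for c u unfolding X_def by (intro sum_nonneg X1)
  have PG0: "0 \<le> P c u j * G c u j s" "0 \<le> N c u j * G c u j s" for c u j s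
    using G0[of c u j s] PN[of c u j] by (simp_all add: less_imp_le)
  have S0: "0 \<le> S c u" for c u unfolding S_def by (intro sum_nonneg add_nonneg_nonneg PG0)
  \<comment> \<open>Both orders of integration are reduced to Q: the risks come with the noise as
    inner variable, the bound on the gain with the columns as inner variable.\<close>
  define Q where "Q = (\<lambda>f :: (nat \<Rightarrow> nat \<Rightarrow> real) \<Rightarrow> (nat \<Rightarrow> real) \<Rightarrow> real. \<integral>\<^sup>+w. ennreal (f (fst w) (snd w)) \<partial>(?C \<Otimes>\<^sub>M ?U))"
  have it: "(\<integral>\<^sup>+c. \<integral>\<^sup>+u. ennreal (f c u) \<partial>?U \<partial>?C) = Q f"
    if "(\<lambda>w. f (fst w) (snd w)) \<in> borel_measurable (?C \<Otimes>\<^sub>M ?U)" for f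
    unfolding Q_def using U.nn_integral_fst[OF measurable_compose[OF that measurable_ennreal]] by simp
  have it2: "(\<integral>\<^sup>+u. \<integral>\<^sup>+c. ennreal (f c u) \<partial>?C \<partial>?U) = Q f"
    if "(\<lambda>w. f (fst w) (snd w)) \<in> borel_measurable (?C \<Otimes>\<^sub>M ?U)" for f
    unfolding Q_def using CU.nn_integral_snd[of "\<lambda>w. ennreal (f (fst w) (snd w))"] measurable_compose[OF that measurable_ennreal]
    by (simp add: case_prod_beta)
  have Qadd: "Q (\<lambda>c u. f c u + g c u) = Q f + Q g"
    if "(\<lambda>w. f (fst w) (snd w)) \<in> borel_measurable (?C \<Otimes>\<^sub>M ?U)" "(\<lambda>w. g (fst w) (snd w)) \<in> borel_measurable (?C \<Otimes>\<^sub>M ?U)"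
      "\<And>c u. 0 \<le> f c u" "\<And>c u. 0 \<le> g c u" for f g
    unfolding Q_def ennreal_plus[OF that(3,4)] by (intro nn_integral_add measurable_compose[OF _ measurable_ennreal] that)
  have Qsum: "Q (\<lambda>c u. \<Sum>j\<in>B. f j c u) = (\<Sum>j\<in>B. Q (f j))"
    if "\<And>j. j \<in> B \<Longrightarrow> (\<lambda>w. f j (fst w) (snd w)) \<in> borel_measurable (?C \<Otimes>\<^sub>M ?U)" "\<And>j c u. 0 \<le> f j c u" for f :: "nat \<Rightarrow> _"
    unfolding Q_def sum_ennreal[OF that(2), symmetric]
    by (intro nn_integral_sum measurable_compose[OF _ measurable_ennreal] that)
  have Qmult: "Q (\<lambda>c u. k * f c u) = ennreal k * Q f"
    if "(\<lambda>w. f (fst w) (snd w)) \<in> borel_measurable (?C \<Otimes>\<^sub>M ?U)" "\<And>c u. 0 \<le> f c u" "0 \<le> k" for f k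
    unfolding Q_def ennreal_mult[OF that(3,2)] by (intro nn_integral_cmult measurable_compose[OF _ measurable_ennreal] that)
  have risk: "(\<integral>\<^sup>+D. ennreal (\<Sum>l\<in>B. (h D l - (\<beta>(j := s)) l)\<^sup>2) \<partial>data_law n p \<sigma> (\<beta>(j := s)))
      = Q (\<lambda>c u. tilt n (s / \<sigma>) (c j) u * G c u j s)" if "j \<in> B" for j s
  proof -
    have "(\<integral>\<^sup>+D. ennreal (\<Sum>l\<in>B. (h D l - (\<beta>(j := s)) l)\<^sup>2) \<partial>data_law n p \<sigma> (\<beta>(j := s)))
        = (\<integral>\<^sup>+D. ennreal (\<Sum>l\<in>B. (h D l - (if l = j then s else 0))\<^sup>2) \<partial>data_law n p \<sigma> (\<beta>(j := s)))"
      using \<beta> by (intro nn_integral_cong arg_cong[of _ _ ennreal] sum.cong) auto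
    also have "\<dots> = (\<integral>\<^sup>+c. \<integral>\<^sup>+u. ennreal (tilt n (s / \<sigma>) (c j) u) * ennreal (G c u j s) \<partial>?U \<partial>?C)"
      unfolding G_def DD_def using B(1) that \<beta>[OF that]
      by (intro nn_integral_data_law_spike n \<sigma> measurable_compose[OF _ measurable_ennreal]
          borel_measurable_sum borel_measurable_power borel_measurable_diff hl borel_measurable_const) auto
    also have "\<dots> = (\<integral>\<^sup>+c. \<integral>\<^sup>+u. ennreal (tilt n (s / \<sigma>) (c j) u * G c u j s) \<partial>?U \<partial>?C)"
      by (simp add: ennreal_mult less_imp_le[OF tilt_pos] G0)
    also have "\<dots> = Q (\<lambda>c u. tilt n (s / \<sigma>) (c j) u * G c u j s)"
      using B(1) that by (intro it borel_measurable_times measurable_tilt_pair mG) auto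
    finally show ?thesis .
  qed
  have QS: "(\<Sum>j\<in>B. \<Sum>s\<in>{\<tau>, - \<tau>}. \<integral>\<^sup>+D. ennreal (\<Sum>l\<in>B. (h D l - (\<beta>(j := s)) l)\<^sup>2) \<partial>data_law n p \<sigma> (\<beta>(j := s))) = Q S"
  proof -
    have "\<tau> \<noteq> - \<tau>" using \<tau> by simp
    then have "(\<Sum>j\<in>B. \<Sum>s\<in>{\<tau>, - \<tau>}. \<integral>\<^sup>+D. ennreal (\<Sum>l\<in>B. (h D l - (\<beta>(j := s)) l)\<^sup>2) \<partial>data_law n p \<sigma> (\<beta>(j := s)))
      = (\<Sum>j\<in>B. Q (\<lambda>c u. P c u j * G c u j \<tau>) + Q (\<lambda>c u. N c u j * G c u j (- \<tau>)))"
      by (intro sum.cong refl) (simp add: risk P_def N_def \<mu>_def del: fun_upd_apply)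
    also have "\<dots> = (\<Sum>j\<in>B. Q (\<lambda>c u. P c u j * G c u j \<tau> + N c u j * G c u j (- \<tau>)))"
      by (intro sum.cong refl Qadd[symmetric] borel_measurable_times mP mN mG PG0)
    also have "\<dots> = Q S" unfolding S_def
      by (intro Qsum[symmetric] borel_measurable_add borel_measurable_times mP mN mG add_nonneg_nonneg PG0)
    finally show ?thesis .
  qed
  have QT: "Q T = ennreal (2 * real ?m)"
  proof -
    have Q1: "Q (\<lambda>c u. tilt n a (c j) u) = 1" if "j \<in> B" for a j
      using it[OF measurable_tilt_pair, of j a] that B(1) by (simp add: nn_integral_tilt_noise C.emeasure_space_1 subset_iff)
    have "Q T = (\<Sum>j\<in>B. Q (\<lambda>c u. P c u j + N c u j))" unfolding T_def
      by (intro Qsum borel_measurable_add mP mN add_nonneg_nonneg less_imp_le PN)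
    also have "\<dots> = (\<Sum>j\<in>B. Q (\<lambda>c u. P c u j) + Q (\<lambda>c u. N c u j))"
      by (intro sum.cong refl Qadd mP mN less_imp_le PN)
    also have "\<dots> = (\<Sum>j\<in>B. 2)" by (intro sum.cong refl) (simp add: P_def N_def Q1)
    finally show ?thesis by (simp add: ennreal_mult'' ennreal_of_nat_eq_real_of_nat mult.commute)
  qed
  define g where "g = spike_gain n \<mu> ?m \<delta>"
  have g0: "0 \<le> g" using B(2) \<delta> by (auto simp: g_def spike_gain_def intro!: add_nonneg_nonneg divide_nonneg_nonneg)
  have QX: "Q X \<le> ennreal (real ?m * g)"
  proof -
    have "Q X = (\<Sum>l\<in>B. Q (\<lambda>c u. (P c u l - N c u l)\<^sup>2 / T c u))" unfolding X_def
      by (intro Qsum mX1 X1)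
    also have "\<dots> \<le> (\<Sum>l\<in>B. ennreal g)"
    proof (rule sum_mono)
      fix l assume l: "l \<in> B"
      show "Q (\<lambda>c u. (P c u l - N c u l)\<^sup>2 / T c u) \<le> ennreal g"
        using nn_integral_spike_gain[OF n small B(1) l B(2) \<delta>] it2[OF mX1[OF l]]
        unfolding P_def N_def T_def g_def \<mu>_def by simp
    qed
    also have "\<dots> = ennreal (real ?m * g)" using g0 by (simp add: ennreal_mult ennreal_of_nat_eq_real_of_nat)
    finally show ?thesis .
  qed
  have "ennreal (\<tau>\<^sup>2 * (2 * real ?m)) = Q (\<lambda>c u. \<tau>\<^sup>2 * T c u)"
    using QT Qmult[OF mT less_imp_le[OF T0], of "\<tau>\<^sup>2"] by (simp add: ennreal_mult)
  also have "\<dots> \<le> Q (\<lambda>c u. S c u + \<tau>\<^sup>2 * X c u)"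
    unfolding Q_def
  proof (intro nn_integral_mono ennreal_leI)
    fix w
    show "\<tau>\<^sup>2 * T (fst w) (snd w) \<le> S (fst w) (snd w) + \<tau>\<^sup>2 * X (fst w) (snd w)"
      using spike_quadratic_bound[OF finB, of "P (fst w) (snd w)" "N (fst w) (snd w)" \<tau> "h (DD (fst w) (snd w))"] T0[of "fst w" "snd w"]
      unfolding T_def S_def X_def G_def by blast
  qed
  also have "\<dots> = Q S + Q (\<lambda>c u. \<tau>\<^sup>2 * X c u)"
    by (intro Qadd mS borel_measurable_times borel_measurable_const mX S0 mult_nonneg_nonneg X0) auto
  also have "Q (\<lambda>c u. \<tau>\<^sup>2 * X c u) = ennreal (\<tau>\<^sup>2) * Q X" by (intro Qmult mX X0) auto
  also have "\<dots> \<le> ennreal (\<tau>\<^sup>2) * ennreal (real ?m * g)" by (intro mult_left_mono QX) auto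
  also have "\<dots> = ennreal (\<tau>\<^sup>2 * (real ?m * g))" using g0 by (simp add: ennreal_mult)
  finally have *: "ennreal (\<tau>\<^sup>2 * (2 * real ?m)) \<le> ennreal (\<tau>\<^sup>2 * (real ?m * g)) + Q S"
    by (simp add: add_left_mono add.commute)
  \<comment> \<open>Subtraction is postponed to this point because it truncates in
    \<open>ennreal\<close>; the truncation also covers g > 2, where the left-hand side is
    zero.\<close>
  have "ennreal (2 * real ?m * \<tau>\<^sup>2 * (1 - g / 2)) = ennreal (\<tau>\<^sup>2 * (2 * real ?m) - \<tau>\<^sup>2 * (real ?m * g))"
    by (simp add: algebra_simps)
  also have "\<dots> = ennreal (\<tau>\<^sup>2 * (2 * real ?m)) - ennreal (\<tau>\<^sup>2 * (real ?m * g))"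
    using g0 by (intro ennreal_minus[symmetric]) auto
  also have "\<dots> \<le> Q S" using * by (simp add: ennreal_minus_le_iff)
  finally show ?thesis unfolding QS g_def \<mu>_def .
qed

section \<open>The minimax lower bound\<close>

text \<open>A configuration q picks an offset and a value for each block. Coordinates from k * m on,
  left over by the division into blocks, carry no spike.\<close>

definition spike_vector :: "nat \<Rightarrow> nat \<Rightarrow> nat \<Rightarrow> (nat \<Rightarrow> nat \<times> real) \<Rightarrow> nat \<Rightarrow> real" where
  "spike_vector p k m q = (\<lambda>j\<in>{..<p}. if j < k * m \<and> j mod m = fst (q (j div m)) then snd (q (j div m)) else 0)"

definition spike_configs :: "nat \<Rightarrow> nat \<Rightarrow> real \<Rightarrow> (nat \<Rightarrow> nat \<times> real) set" where
  "spike_configs k m \<tau> = ({..<k} \<rightarrow>\<^sub>E {..<m} \<times> {\<tau>, - \<tau>})"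

text \<open>The prior lives on the parameter set itself: at most one nonzero entry per block, of
  modulus |\<tau>|, meets both constraints, so Bayes risks bound the maximal risk without truncating
  the prior.\<close>

lemma spike_vector_in_param_set:
  assumes m: "0 < m" and q: "q \<in> spike_configs k m \<tau>"
  shows "spike_vector p k m q \<in> param_set p k \<tau>"
proof -
  let ?\<beta> = "spike_vector p k m q"
  let ?S = "{j. j < p \<and> ?\<beta> j \<noteq> 0}"
  have "?S \<subseteq> (\<lambda>b. b * m + fst (q b)) ` {..<k}"
  proof
    fix j assume "j \<in> ?S"
    then have "j < k * m" "j mod m = fst (q (j div m))" by (auto simp: spike_vector_def split: if_splits)
    then have "j div m < k" "j = j div m * m + fst (q (j div m))"
      using m by (auto simp: less_mult_imp_div_less) (metis div_mult_mod_eq)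
    then show "j \<in> (\<lambda>b. b * m + fst (q b)) ` {..<k}" by blast
  qed
  then have "card ?S \<le> card ((\<lambda>b. b * m + fst (q b)) ` {..<k})" by (intro card_mono) auto
  also have "\<dots> \<le> k" using card_image_le[of "{..<k}"] by fastforce
  finally have S: "card ?S \<le> k" .
  have sq: "(?\<beta> j)\<^sup>2 \<le> \<tau>\<^sup>2" if "j < p" for j
  proof (cases "j < k * m")
    case True
    then have "j div m < k" by (auto simp: less_mult_imp_div_less)
    then have "q (j div m) \<in> {..<m} \<times> {\<tau>, - \<tau>}" using q by (simp add: spike_configs_def PiE_iff)
    then have "snd (q (j div m)) \<in> {\<tau>, - \<tau>}" unfolding mem_Times_iff by simp
    then show ?thesis using True that by (auto simp: spike_vector_def)
  qed (use that in \<open>auto simp: spike_vector_def\<close>)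
  have "(\<Sum>j<p. (?\<beta> j)\<^sup>2) = (\<Sum>j\<in>?S. (?\<beta> j)\<^sup>2)" by (intro sum.mono_neutral_right) auto
  also have "\<dots> \<le> real (card ?S) * \<tau>\<^sup>2" using sq by (intro sum_bounded_above) auto
  also have "\<dots> \<le> real k * \<tau>\<^sup>2" using S by (intro mult_right_mono) auto
  finally have "(L2_set ?\<beta> {..<p})\<^sup>2 \<le> real k * \<tau>\<^sup>2" by (simp add: L2_set_def sum_nonneg)
  then show ?thesis using S by (simp add: param_set_def) (simp add: spike_vector_def)
qed

text \<open>The outer sum is the conditioning on the spikes of all blocks other than b, the inner
  one the prior on block b.\<close>

lemma spike_configs_insert:
  assumes b: "b < k"
  shows "(\<Sum>q\<in>spike_configs k m \<tau>. f q)
    = (\<Sum>q\<in>(({..<k} - {b}) \<rightarrow>\<^sub>E ({..<m} \<times> {\<tau>, - \<tau>})). \<Sum>y\<in>({..<m} \<times> {\<tau>, - \<tau>}). f (q(b := y)))"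
proof -
  let ?A = "{..<m} \<times> {\<tau>, - \<tau>}" and ?I = "{..<k} - {b}"
  have "{..<k} = insert b ?I" using b by auto
  then have "spike_configs k m \<tau> = (\<lambda>(y, g). g(b := y)) ` (?A \<times> (?I \<rightarrow>\<^sub>E ?A))"
    unfolding spike_configs_def by (subst PiE_insert_eq[symmetric]) simp
  moreover have "inj_on (\<lambda>(y, g). g(b := y)) (?A \<times> (?I \<rightarrow>\<^sub>E ?A))"
    using inj_combinator[of b ?I "\<lambda>_. ?A"] by simp
  ultimately have "(\<Sum>q\<in>spike_configs k m \<tau>. f q) = (\<Sum>(y, g)\<in>?A \<times> (?I \<rightarrow>\<^sub>E ?A). f (g(b := y)))"
    by (simp only: sum.reindex) (simp add: comp_def case_prod_beta)
  also have "\<dots> = (\<Sum>g\<in>(?I \<rightarrow>\<^sub>E ?A). \<Sum>y\<in>?A. f (g(b := y)))"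
    by (subst sum.swap) (simp add: sum.cartesian_product)
  finally show ?thesis .
qed

text \<open>With block b erased, \<beta> vanishes there, as \<open>block_risk_bound\<close>
  requires; varying the spike of block b then becomes a one-point update of a fixed vector.\<close>

lemma spike_vector_update:
  fixes q :: "nat \<Rightarrow> nat \<times> real"
  assumes b: "b < k" and m: "k * m \<le> p" and j: "j < m"
  defines "\<beta> \<equiv> (\<lambda>j\<in>{..<p}. if j < k * m \<and> j div m \<noteq> b \<and> j mod m = fst (q (j div m)) then snd (q (j div m)) else 0)"
  shows "spike_vector p k m (q(b := (j, s))) = \<beta>(b * m + j := s)"
proof
  fix i
  have "(b + 1) * m \<le> k * m" using b by (intro mult_right_mono) auto
  then have bj: "b * m + j < k * m" "b * m + j < p" using j m by auto
  have "i = b * m + j \<longleftrightarrow> i div m = b \<and> i mod m = j" using j by (metis add.right_neutral div_less div_mult_mod_eq div_mult_self3 gr_implies_not0 mod_less mod_mult_self3)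
  then show "spike_vector p k m (q(b := (j, s))) i = (\<beta>(b * m + j := s)) i"
    using bj by (cases "i = b * m + j") (auto simp: spike_vector_def \<beta>_def)
qed

text \<open>The maximal risk dominates the average over the (2 m)^k configurations. The squared loss
  splits over the disjoint blocks, and each block is bounded with the other spikes frozen. All
  inequalities stay multiplied by (2 m)^k, which avoids division in \<open>ennreal\<close>.\<close>

lemma minimax_risk_lower_bound:
  assumes n: "0 < n" and \<sigma>: "0 < \<sigma>" and \<tau>: "0 < \<tau>" and small: "(\<tau> / \<sigma>)\<^sup>2 / real n \<le> 1 / 100"
    and m: "2 \<le> m" "k * m \<le> p" and \<delta>: "0 < \<delta>" "\<delta> < 1"
  shows "ennreal (real k * \<tau>\<^sup>2 * (1 - spike_gain n (\<tau> / \<sigma>) m \<delta> / 2)) \<le> minimax_risk n p k \<tau> \<sigma>"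
  unfolding minimax_risk_def
proof (rule INF_greatest)
  fix h assume h: "h \<in> estimators n p"
  define X where "X = \<tau>\<^sup>2 * (1 - spike_gain n (\<tau> / \<sigma>) m \<delta> / 2)"
  let ?A = "{..<m} \<times> {\<tau>, - \<tau>}"
  define B where "B = (\<lambda>b. (\<lambda>j. b * m + j) ` {..<m})"
  define r where "r = (\<lambda>b \<beta>. \<integral>\<^sup>+D. ennreal (\<Sum>l\<in>B b. (h D l - \<beta> l)\<^sup>2) \<partial>data_law n p \<sigma> \<beta>)"
  have BS: "B b \<subseteq> {..<p}" if "b < k" for b
  proof -
    have "(b + 1) * m \<le> k * m" using that by (intro mult_right_mono) auto
    then show ?thesis using m(2) by (auto simp: B_def)
  qed
  have cB: "card (B b) = m" for b by (simp add: B_def card_image)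
  have Bdiv: "l \<in> B b \<Longrightarrow> l div m = b" for l b using m by (auto simp: B_def)
  have block: "ennreal (2 * real m * X) \<le> (\<Sum>y\<in>?A. r b (spike_vector p k m (q(b := y))))" if b: "b < k" for b q
  proof -
    define \<beta> where "\<beta> = (\<lambda>j\<in>{..<p}. if j < k * m \<and> j div m \<noteq> b \<and> j mod m = fst (q (j div m)) then snd (q (j div m)) else 0)"
    have "\<beta> j = 0" if "j \<in> B b" for j using that Bdiv[OF that] BS[OF b] by (auto simp: \<beta>_def)
    then have "ennreal (2 * real m * X) \<le> (\<Sum>j\<in>B b. \<Sum>s\<in>{\<tau>, - \<tau>}. r b (\<beta>(j := s)))"
      using block_risk_bound[OF n \<sigma> \<tau> small BS[OF b] _ _ \<delta> h, of \<beta>] m(1) unfolding r_def X_def cB by (simp add: mult.assoc)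
    also have "\<dots> = (\<Sum>j<m. \<Sum>s\<in>{\<tau>, - \<tau>}. r b (\<beta>(b * m + j := s)))"
      unfolding B_def by (subst sum.reindex) auto
    also have "\<dots> = (\<Sum>y\<in>?A. r b (spike_vector p k m (q(b := y))))"
      unfolding sum.cartesian_product
      by (intro sum.cong refl) (auto simp: spike_vector_update[OF b m(2)] \<beta>_def)
    finally show ?thesis .
  qed
  have "ennreal (real ((2 * m) ^ k) * (real k * X)) \<le> (\<Sum>b<k. \<Sum>q\<in>spike_configs k m \<tau>. r b (spike_vector p k m q))"
  \<comment> \<open>The other blocks have (2 m)^(k - 1) configurations, an expression that is
    meaningful only for positive k.\<close>
  proof (cases "k = 0")
    case False
    have cA: "card ?A = 2 * m" using \<tau> by (simp add: card_cartesian_product card_insert_if)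
    have "ennreal (real ((2 * m) ^ (k - 1)) * (2 * real m * X)) \<le> (\<Sum>q\<in>spike_configs k m \<tau>. r b (spike_vector p k m q))" if b: "b < k" for b
    proof -
      have "ennreal (real ((2 * m) ^ (k - 1)) * (2 * real m * X)) = (\<Sum>q\<in>(({..<k} - {b}) \<rightarrow>\<^sub>E ?A). ennreal (2 * real m * X))"
      proof -
        have "card (({..<k} - {b}) \<rightarrow>\<^sub>E ?A) = (2 * m) ^ (k - 1)"
          using b by (subst card_PiE) (simp_all only: prod_constant cA card_Diff_singleton lessThan_iff card_lessThan finite_Diff finite_lessThan)
        then show ?thesis
          by (simp only: sum_constant ennreal_mult'[OF of_nat_0_le_iff] ennreal_of_nat_eq_real_of_nat)
      qed
      also have "\<dots> \<le> (\<Sum>q\<in>spike_configs k m \<tau>. r b (spike_vector p k m q))"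
        unfolding spike_configs_insert[OF b] by (intro sum_mono block b)
      finally show ?thesis .
    qed
    then have "(\<Sum>b<k. ennreal (real ((2 * m) ^ (k - 1)) * (2 * real m * X))) \<le> (\<Sum>b<k. \<Sum>q\<in>spike_configs k m \<tau>. r b (spike_vector p k m q))"
      by (intro sum_mono) auto
    moreover have "(\<Sum>b<k. ennreal (real ((2 * m) ^ (k - 1)) * (2 * real m * X))) = ennreal (real k * (real ((2 * m) ^ (k - 1)) * (2 * real m * X)))"
      by (simp add: ennreal_mult' ennreal_of_nat_eq_real_of_nat)
    moreover have "real k * (real ((2 * m) ^ (k - 1)) * (2 * real m * X)) = real ((2 * m) ^ k) * (real k * X)"
      using False by (cases k) auto
    ultimately show ?thesis by (simp only:)
  qed auto
  also have "\<dots> = (\<Sum>q\<in>spike_configs k m \<tau>. \<Sum>b<k. r b (spike_vector p k m q))" by (rule sum.swap)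
  also have "\<dots> \<le> (\<Sum>q\<in>spike_configs k m \<tau>. max_risk n p k \<tau> \<sigma> h)"
  proof (rule sum_mono)
    fix q assume q: "q \<in> spike_configs k m \<tau>"
    let ?\<beta> = "spike_vector p k m q"
    have sD: "sets (data_law n p \<sigma> ?\<beta>) = sets (data_space n p)"
      unfolding data_law_def data_space_def by (intro sets_PiM_cong) (auto simp: obs_law_def)
    have hl: "(\<lambda>D. h D l) \<in> borel_measurable (data_law n p \<sigma> ?\<beta>)" if "l < p" for l
    proof -
      have "h \<in> measurable (data_law n p \<sigma> ?\<beta>) (PiM {..<p} (\<lambda>_. borel))"
        using h measurable_cong_sets[OF sD refl] by (auto simp: estimators_def borel_vec_def)
      from measurable_compose[OF this measurable_component_singleton[of l]] that show ?thesis by simp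
    qed
    have disj: "(\<Union>b<k. B b) \<subseteq> {..<p}" using BS by auto
    have "(\<Sum>b<k. r b ?\<beta>) = (\<integral>\<^sup>+D. (\<Sum>b<k. ennreal (\<Sum>l\<in>B b. (h D l - ?\<beta> l)\<^sup>2)) \<partial>data_law n p \<sigma> ?\<beta>)"
      unfolding r_def using BS
      by (intro nn_integral_sum[symmetric] measurable_compose[OF _ measurable_ennreal] borel_measurable_sum
          borel_measurable_power borel_measurable_diff hl borel_measurable_const) auto
    also have "\<dots> \<le> (\<integral>\<^sup>+D. ennreal ((L2_set (\<lambda>j. h D j - ?\<beta> j) {..<p})\<^sup>2) \<partial>data_law n p \<sigma> ?\<beta>)"
    proof (rule nn_integral_mono)
      fix D
      have "(\<Sum>b<k. ennreal (\<Sum>l\<in>B b. (h D l - ?\<beta> l)\<^sup>2)) = ennreal (\<Sum>b<k. \<Sum>l\<in>B b. (h D l - ?\<beta> l)\<^sup>2)"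
        by (intro sum_ennreal sum_nonneg) auto
      also have "(\<Sum>b<k. \<Sum>l\<in>B b. (h D l - ?\<beta> l)\<^sup>2) = (\<Sum>l\<in>(\<Union>b<k. B b). (h D l - ?\<beta> l)\<^sup>2)"

      proof (intro sum.UNION_disjoint[symmetric] ballI impI)
        show "B i \<inter> B j = {}" if "i \<noteq> j" for i j using Bdiv[of _ i] Bdiv[of _ j] that by blast
      qed (auto simp: B_def)
      also have "\<dots> \<le> (\<Sum>l<p. (h D l - ?\<beta> l)\<^sup>2)" using disj by (intro sum_mono2) auto
      also have "\<dots> = (L2_set (\<lambda>j. h D j - ?\<beta> j) {..<p})\<^sup>2" by (simp add: L2_set_def sum_nonneg)
      finally show "(\<Sum>b<k. ennreal (\<Sum>l\<in>B b. (h D l - ?\<beta> l)\<^sup>2)) \<le> ennreal ((L2_set (\<lambda>j. h D j - ?\<beta> j) {..<p})\<^sup>2)"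
        by (simp add: ennreal_leI)
    qed
    also have "\<dots> = risk n p \<sigma> h ?\<beta>" by (simp add: risk_def)
    also have "\<dots> \<le> max_risk n p k \<tau> \<sigma> h"
      unfolding max_risk_def using m by (intro SUP_upper spike_vector_in_param_set q) auto
    finally show "(\<Sum>b<k. r b ?\<beta>) \<le> max_risk n p k \<tau> \<sigma> h" .
  qed
  also have "\<dots> = ennreal (real ((2 * m) ^ k)) * max_risk n p k \<tau> \<sigma> h"
    using \<tau> by (simp add: spike_configs_def card_PiE card_cartesian_product card_insert_if ennreal_of_nat_eq_real_of_nat)
  finally have "ennreal (real ((2 * m) ^ k)) * ennreal (real k * X) \<le> ennreal (real ((2 * m) ^ k)) * max_risk n p k \<tau> \<sigma> h"
    by (subst ennreal_mult'[symmetric]) auto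
  then have "ennreal (real k * X) \<le> max_risk n p k \<tau> \<sigma> h"
    using m by (subst (asm) ennreal_mult_le_mult_iff) auto
  then show "ennreal (real k * \<tau>\<^sup>2 * (1 - spike_gain n (\<tau> / \<sigma>) m \<delta> / 2)) \<le> max_risk n p k \<tau> \<sigma> h"
    by (simp add: X_def mult.assoc)
qed

section \<open>Asymptotics of the lower bound\<close>

lemma exp_square_powr_tendsto_0:
  fixes x \<mu> :: "nat \<Rightarrow> real"
  assumes x: "filterlim x at_top sequentially" and \<mu>: "(\<lambda>n. \<mu> n / sqrt (ln (x n))) \<longlonglongrightarrow> 0" and d: "0 < d"
  shows "(\<lambda>n. exp (c * (\<mu> n)\<^sup>2) * x n powr (- d)) \<longlonglongrightarrow> 0"
proof (rule tendsto_sandwich[where f="\<lambda>_. 0" and h="\<lambda>n. x n powr (- (d / 2))"])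
  \<comment> \<open>Since \<mu>^2 = o(ln x), the exponent c \<mu>^2 is eventually below (d / 2) ln
    x: the exponential costs at most half of the power.\<close>
  have "(\<lambda>n. c * (\<mu> n / sqrt (ln (x n)))\<^sup>2) \<longlonglongrightarrow> c * 0\<^sup>2" by (intro tendsto_intros \<mu>)
  then have "\<forall>\<^sub>F n in sequentially. c * (\<mu> n / sqrt (ln (x n)))\<^sup>2 < d / 2"
    by (rule order_tendstoD) (use d in auto)
  moreover have "\<forall>\<^sub>F n in sequentially. 1 < x n" using x by (auto simp: filterlim_at_top_dense)
  ultimately show "\<forall>\<^sub>F n in sequentially. exp (c * (\<mu> n)\<^sup>2) * x n powr (- d) \<le> x n powr (- (d / 2))"
  proof eventually_elim
    case (elim n)
    then have l: "0 < ln (x n)" by simp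
    have "c * (\<mu> n)\<^sup>2 = c * (\<mu> n / sqrt (ln (x n)))\<^sup>2 * ln (x n)" using l by (simp add: power_divide)
    also have "\<dots> \<le> d / 2 * ln (x n)" using elim l by (intro mult_right_mono) auto
    finally have "exp (c * (\<mu> n)\<^sup>2) \<le> x n powr (d / 2)" using elim by (simp add: powr_def)
    then have "exp (c * (\<mu> n)\<^sup>2) * x n powr (- d) \<le> x n powr (d / 2) * x n powr (- d)"
      by (intro mult_right_mono) auto
    then show ?case by (simp add: powr_add[symmetric])
  qed
  have "((\<lambda>y::real. y powr (- (d / 2))) \<longlongrightarrow> 0) at_top" using d by real_asymp
  from filterlim_compose[OF this x] show "(\<lambda>n. x n powr (- (d / 2))) \<longlonglongrightarrow> 0" .
qed auto

text \<open>As p div k is the floor of p / k and p / k tends to infinity, neither the rounding nor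
  the subtracted 1, which comes from excluding the position l from the normalising sum, matters in
  the limit.\<close>

lemma floor_ratio_tendsto_1:
  fixes p k :: "nat \<Rightarrow> nat"
  assumes k: "\<And>n. 1 \<le> k n" and x: "filterlim (\<lambda>n. real (p n) / real (k n)) at_top sequentially"
  shows "(\<lambda>n. (real (p n) / real (k n)) / (real (p n div k n) - 1)) \<longlonglongrightarrow> 1"
proof -
  define X where "X = (\<lambda>n. real (p n) / real (k n))"
  have m: "real (p n div k n) \<le> X n" "X n - 1 \<le> real (p n div k n)" for n
  proof -
    have "int (p n div k n) = \<lfloor>X n\<rfloor>" unfolding X_def by (rule floor_divide_of_nat_eq[symmetric])
    then have "real (p n div k n) = real_of_int \<lfloor>X n\<rfloor>" by (metis of_int_of_nat_eq)
    then show "real (p n div k n) \<le> X n" "X n - 1 \<le> real (p n div k n)"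
      using real_of_int_floor_gt_diff_one[of "X n"] by simp_all
  qed
  have "(\<lambda>n. (real (p n div k n) - 1) / X n) \<longlonglongrightarrow> 1"
  proof (rule tendsto_sandwich)
    have ev: "\<forall>\<^sub>F n in sequentially. 1 < X n" using x by (auto simp: filterlim_at_top_dense X_def)
    show "\<forall>\<^sub>F n in sequentially. 1 - 2 / X n \<le> (real (p n div k n) - 1) / X n"
      using ev
    proof eventually_elim
      case (elim n)
      have "1 - 2 / X n = (X n - 2) / X n" using elim by (simp add: field_simps)
      also have "\<dots> \<le> (real (p n div k n) - 1) / X n" using m(2)[of n] elim by (intro divide_right_mono) auto
      finally show ?case .
    qed
    show "\<forall>\<^sub>F n in sequentially. (real (p n div k n) - 1) / X n \<le> 1"
      using ev
    proof eventually_elim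
      case (elim n)
      have "(real (p n div k n) - 1) / X n \<le> X n / X n" using m(1)[of n] elim by (intro divide_right_mono) auto
      then show ?case using elim by simp
    qed
    have "((\<lambda>y::real. 1 - 2 / y) \<longlongrightarrow> 1) at_top" by real_asymp
    from filterlim_compose[OF this x] show "(\<lambda>n. 1 - 2 / X n) \<longlonglongrightarrow> 1" by (simp add: X_def)
  qed auto
  then have "(\<lambda>n. inverse ((real (p n div k n) - 1) / X n)) \<longlonglongrightarrow> inverse 1" by (intro tendsto_inverse) auto
  then show ?thesis by (simp add: X_def mult.commute)
qed

lemma minimax_risk_asymptotic_lower_bound:
  fixes p k :: "nat \<Rightarrow> nat" and \<sigma> \<tau> :: "nat \<Rightarrow> real"
  assumes k: "\<And>n. 1 \<le> k n" "\<And>n. k n \<le> p n" and pos: "\<And>n. \<sigma> n > 0" "\<And>n. \<tau> n > 0"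
    and x: "filterlim (\<lambda>n. real (p n) / real (k n)) at_top sequentially"
    and \<mu>: "filterlim (\<lambda>n. \<tau> n / \<sigma> n) at_top sequentially"
      "(\<lambda>n. (\<tau> n / \<sigma> n) / sqrt (ln (real (p n) / real (k n)))) \<longlonglongrightarrow> 0"
    and t4: "(\<lambda>n. \<tau> n ^ 4 / (real n * \<sigma> n ^ 4)) \<longlonglongrightarrow> 0"
  shows "\<exists>\<epsilon>::nat \<Rightarrow> real. \<epsilon> \<longlonglongrightarrow> 0 \<and>
        (\<forall>\<^sub>F n in sequentially.
          minimax_risk n (p n) (k n) (\<tau> n) (\<sigma> n) \<ge>
            ennreal (real (k n) * (\<tau> n)\<^sup>2 *
              (1 - (1 + \<epsilon> n) / 2 * (real (k n) / real (p n)) * exp ((\<tau> n)\<^sup>2 / (\<sigma> n)\<^sup>2))))"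
proof -
  define X where "X = (\<lambda>n. real (p n) / real (k n))"
  define u where "u = (\<lambda>n. \<tau> n / \<sigma> n)"
  define m where "m = (\<lambda>n. p n div k n)"
  define d where "d = (\<lambda>n. X n powr (- (1 / 8)))" \<comment> \<open>\<open>d \<longlonglongrightarrow> 0\<close>, yet \<open>d\<^sup>4\<close> costs only half a power of \<open>X\<close>\<close>
  define r where "r = (\<lambda>n. X n / (real (m n) - 1))"
  \<comment> \<open>The error is defined by (1 + e) exp (u^2) / X = \<open>spike_gain\<close>, so
    that the claim is literally \<open>minimax_risk_lower_bound\<close> and only the convergence of
    e to 0 is left.\<close>
  define e where "e = (\<lambda>n. spike_gain n (u n) (m n) (d n) * X n * exp (- (u n)\<^sup>2) - 1)"
  have X: "filterlim X at_top sequentially" using x by (simp add: X_def)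
  have u: "filterlim u at_top sequentially" using \<mu> by (simp add: u_def)
  have u4: "(\<lambda>n. u n ^ 4 / real n) \<longlonglongrightarrow> 0" using t4 by (simp add: u_def power_divide mult.commute)
  have r: "r \<longlonglongrightarrow> 1" using floor_ratio_tendsto_1[of k p] k x by (simp add: r_def X_def m_def)
  have dt: "d \<longlonglongrightarrow> 0"
  proof -
    have "((\<lambda>y::real. y powr (- (1 / 8))) \<longlongrightarrow> 0) at_top" by real_asymp
    from filterlim_compose[OF this X] show ?thesis by (simp add: d_def)
  qed
  have evX: "\<forall>\<^sub>F n in sequentially. 4 < X n" using X by (auto simp: filterlim_at_top_dense)
  have m2: "3 \<le> m n" if "4 < X n" for n
  proof -
    have "int (m n) = \<lfloor>X n\<rfloor>" unfolding X_def m_def by (rule floor_divide_of_nat_eq[symmetric])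
    then show ?thesis using that by linarith
  qed
  have "(\<lambda>n. exp (12 * (u n ^ 4 / real n)) * r n / (1 - d n) + 16 * (r n)\<^sup>2 * (exp (6 * (u n)\<^sup>2) * X n powr (- (1 / 2))))
     \<longlonglongrightarrow> exp (12 * 0) * 1 / (1 - 0) + 16 * 1\<^sup>2 * 0"
    using X \<mu>(2) by (intro tendsto_intros u4 r dt exp_square_powr_tendsto_0) (auto simp: X_def u_def)
  then have "(\<lambda>n. exp (12 * (u n ^ 4 / real n)) * r n / (1 - d n) + 16 * (r n)\<^sup>2 * (exp (6 * (u n)\<^sup>2) * X n powr (- (1 / 2))) - 1) \<longlonglongrightarrow> 0"
    by (simp add: LIM_zero)
  moreover have "\<forall>\<^sub>F n in sequentially. exp (12 * (u n ^ 4 / real n)) * r n / (1 - d n) + 16 * (r n)\<^sup>2 * (exp (6 * (u n)\<^sup>2) * X n powr (- (1 / 2))) - 1 = e n"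
    using evX
  proof eventually_elim
    case (elim n)
    \<comment> \<open>By the choice of d the factor d^(-4) equals X^(1/2), so the tail term keeps
      the power X^(-1/2) against exp (6 u^2).\<close>
    have d4: "inverse (d n ^ 4) = X n * X n powr (- (1 / 2))"
      using elim by (simp add: d_def powr_power powr_minus[symmetric] powr_mult_base)
    have "spike_gain n (u n) (m n) (d n) * X n * exp (- (u n)\<^sup>2)
      = (exp ((u n)\<^sup>2 + 12 * u n ^ 4 / real n) * exp (- (u n)\<^sup>2)) * r n / (1 - d n)
        + 16 * (exp (7 * (u n)\<^sup>2) * exp (- (u n)\<^sup>2)) * (X n / (real (m n) - 1)\<^sup>2) * inverse (d n ^ 4)"
      by (simp add: spike_gain_def r_def divide_inverse distrib_right distrib_left ac_simps)
    also have "\<dots> = exp (12 * (u n ^ 4 / real n)) * r n / (1 - d n) + 16 * (r n)\<^sup>2 * (exp (6 * (u n)\<^sup>2) * X n powr (- (1 / 2)))"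
      unfolding d4 exp_add[symmetric] by (simp add: r_def power_divide power2_eq_square)
    finally show ?case by (simp add: e_def)
  qed
  ultimately have e: "e \<longlonglongrightarrow> 0" by (rule Lim_transform_eventually)
  have ev: "\<forall>\<^sub>F n in sequentially. u n ^ 4 / real n < 1 / 100"
    using order_tendstoD(2)[OF u4, of "1 / 100"] by simp
  have ev1: "\<forall>\<^sub>F n in sequentially. 1 < u n" using u by (auto simp: filterlim_at_top_dense)
  have ev2: "\<forall>\<^sub>F n in sequentially. d n < 1" using order_tendstoD(2)[OF dt, of 1] by simp
  have "\<forall>\<^sub>F n in sequentially. minimax_risk n (p n) (k n) (\<tau> n) (\<sigma> n) \<ge>
            ennreal (real (k n) * (\<tau> n)\<^sup>2 *
              (1 - (1 + e n) / 2 * (real (k n) / real (p n)) * exp ((\<tau> n)\<^sup>2 / (\<sigma> n)\<^sup>2)))"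
    using ev ev1 ev2 evX eventually_gt_at_top[of 0]
  proof eventually_elim
    case (elim n)
    have "(u n)\<^sup>2 * 1 \<le> (u n)\<^sup>2 * (u n)\<^sup>2" using elim by (intro mult_left_mono) auto
    then have "(u n)\<^sup>2 / real n \<le> u n ^ 4 / real n"
      by (intro divide_right_mono) (auto simp: power2_eq_square power4_eq_xxxx)
    then have small: "(\<tau> n / \<sigma> n)\<^sup>2 / real n \<le> 1 / 100" using elim unfolding u_def by linarith
    have "ennreal (real (k n) * (\<tau> n)\<^sup>2 * (1 - spike_gain n (\<tau> n / \<sigma> n) (m n) (d n) / 2)) \<le> minimax_risk n (p n) (k n) (\<tau> n) (\<sigma> n)"
      using m2[of n] elim k[of n] by (intro minimax_risk_lower_bound small pos) (auto simp: m_def d_def)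
    moreover have "(1 + e n) / 2 * (real (k n) / real (p n)) * exp ((\<tau> n)\<^sup>2 / (\<sigma> n)\<^sup>2) = spike_gain n (\<tau> n / \<sigma> n) (m n) (d n) / 2"
    proof -
      have "real (k n) / real (p n) = 1 / X n" by (simp add: X_def)
      moreover have "exp ((\<tau> n)\<^sup>2 / (\<sigma> n)\<^sup>2) = exp ((u n)\<^sup>2)" by (simp add: u_def power_divide)
      ultimately show ?thesis using elim
        by (simp add: e_def u_def[symmetric] exp_minus field_simps) (use k(1)[of n] in \<open>auto simp: u_def\<close>)
    qed
    ultimately show ?case by (simp only:)
  qed
  then show ?thesis using e by blast
qed

section \<open>Normal tails and soft thresholding\<close>

abbreviation std_normal :: "real measure" where "std_normal \<equiv> normal_measure 0 1"

definition upper_tail :: "real \<Rightarrow> real" where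
  "upper_tail c = measure std_normal {c..}"

text \<open>The mean of the positive part of Z - c for a standard normal Z, see
  \<open>nn_integral_normal_excess\<close>.\<close>

definition normal_excess :: "real \<Rightarrow> real" where
  "normal_excess c = std_normal_density c - c * upper_tail c"

lemma DERIV_std_normal_density:
  "(std_normal_density has_field_derivative - x * std_normal_density x) (at x)"
proof -
  have "((\<lambda>x. K * exp (- x\<^sup>2 / 2)) has_field_derivative - x * (K * exp (- x\<^sup>2 / 2))) (at x)" for K
    by (auto intro!: derivative_eq_intros simp: power2_eq_square)
  from this[of "1 / sqrt (2 * pi)"] show ?thesis by (simp add: std_normal_density_def[abs_def])
qed

lemma nn_integral_std_normal_atLeast:
  fixes f :: "real \<Rightarrow> real"
  assumes [measurable]: "f \<in> borel_measurable borel"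
    and F: "\<And>x. a \<le> x \<Longrightarrow> DERIV F x :> std_normal_density x * f x" "\<And>x. a \<le> x \<Longrightarrow> 0 \<le> f x" "(F \<longlongrightarrow> T) at_top"
  shows "(\<integral>\<^sup>+x. ennreal (f x) * indicator {a..} x \<partial>std_normal) = ennreal (T - F a)"
proof -
  have "(\<integral>\<^sup>+x. ennreal (f x) * indicator {a..} x \<partial>std_normal)
     = (\<integral>\<^sup>+x. ennreal (std_normal_density x * f x) * indicator {a..} x \<partial>lborel)"
    by (subst nn_integral_normal_measure) (auto simp: ennreal_mult' mult.assoc)
  also have "\<dots> = ennreal (T - F a)"
    by (rule nn_integral_FTC_atLeast[OF _ F(1) _ F(3)]) (use F(2) in auto)
  finally show ?thesis .
qed

lemma prob_space_std_normal: "prob_space std_normal"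
  by (rule prob_space_normal_measure) simp

text \<open>The normal density has no elementary antiderivative, so an abstract one, F, is taken
  from continuity; increments of the tail are then increments of F with the opposite sign.\<close>

lemma DERIV_upper_tail: "(upper_tail has_field_derivative - std_normal_density x) (at x)"
proof -
  interpret prob_space std_normal by (rule prob_space_std_normal)
  have "\<exists>F. \<forall>x::real. - \<infinity> < ereal x \<longrightarrow> ereal x < \<infinity> \<longrightarrow> (F has_vector_derivative std_normal_density x) (at x)"
    by (rule einterval_antiderivative) (auto intro: DERIV_isCont[OF DERIV_std_normal_density])
  then obtain F where F: "\<And>x. (F has_field_derivative std_normal_density x) (at x)"
    by (auto simp: has_real_derivative_iff_has_vector_derivative)
  have diff: "upper_tail a - upper_tail b = F b - F a" if "a \<le> b" for a b
  proof -
    have "{a..} = {a..<b} \<union> {b..}" using that by auto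
    then have "upper_tail a = measure std_normal {a..<b} + upper_tail b"
      unfolding upper_tail_def using finite_measure_Union[of "{a..<b}" "{b..}"] by (simp add: ivl_disj_int)
    moreover have "emeasure std_normal {a..<b} = ennreal (F b - F a)"
    proof -
      have "emeasure std_normal {a..<b} = (\<integral>\<^sup>+x. ennreal (std_normal_density x) * indicator {a..<b} x \<partial>lborel)"
        unfolding normal_measure_def by (subst emeasure_density) auto
      also have "\<dots> = (\<integral>\<^sup>+x. ennreal (std_normal_density x) * indicator {a..b} x \<partial>lborel)"
        by (intro nn_integral_cong_AE eventually_mono[OF AE_lborel_singleton[of b]]) (auto split: split_indicator)
      also have "\<dots> = ennreal (F b - F a)"
        by (rule nn_integral_FTC_Icc) (use F that in \<open>auto intro: has_field_derivative_at_within\<close>)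
      finally show ?thesis .
    qed
    moreover have "F a \<le> F b" using that F by (metis DERIV_nonneg_imp_nondecreasing normal_density_nonneg)
    ultimately show ?thesis by (simp add: emeasure_eq_measure)
  qed
  have eq: "upper_tail y = upper_tail 0 + F 0 - F y" for y
    using diff[of 0 y] diff[of y 0] by (cases "0 \<le> y") auto
  have "((\<lambda>y. upper_tail 0 + F 0 - F y) has_field_derivative - std_normal_density x) (at x)"
    by (auto intro!: derivative_eq_intros F)
  then show ?thesis using eq by (metis (no_types, lifting) ext)
qed

lemma upper_tail_nonneg: "0 \<le> upper_tail c" and upper_tail_le_1: "upper_tail c \<le> 1"
  using prob_space.prob_le_1[OF prob_space_std_normal] by (auto simp: upper_tail_def)

lemma std_normal_density_tendsto_0: "(std_normal_density \<longlongrightarrow> 0) at_top"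
  unfolding std_normal_density_def by real_asymp

lemma upper_tail_emeasure: "emeasure std_normal {c..} = ennreal (upper_tail c)"
proof -
  interpret prob_space std_normal by (rule prob_space_std_normal)
  show ?thesis by (simp add: upper_tail_def emeasure_eq_measure)
qed

text \<open>On the range of integration x is at least c, and x times the density has minus the
  density as antiderivative.\<close>

lemma upper_tail_le_density: assumes "0 < c" shows "upper_tail c \<le> std_normal_density c / c"
proof -
  have "ennreal c * emeasure std_normal {c..} = (\<integral>\<^sup>+x. ennreal c * indicator {c..} x \<partial>std_normal)"
    by (simp add: nn_integral_cmult)
  also have "\<dots> \<le> (\<integral>\<^sup>+x. ennreal x * indicator {c..} x \<partial>std_normal)"
    by (intro nn_integral_mono) (auto split: split_indicator intro: ennreal_leI)
  also have "\<dots> = ennreal (0 - - std_normal_density c)"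
    using assms std_normal_density_tendsto_0
    by (intro nn_integral_std_normal_atLeast) (auto intro!: derivative_eq_intros DERIV_std_normal_density tendsto_eq_intros)
  finally have "ennreal (c * upper_tail c) \<le> ennreal (std_normal_density c)"
    using assms by (simp add: upper_tail_emeasure ennreal_mult upper_tail_nonneg)
  then show ?thesis using assms by (simp add: field_simps)
qed

lemma upper_tail_tendsto_0: "(upper_tail \<longlongrightarrow> 0) at_top"
proof (rule tendsto_sandwich[where f="\<lambda>_. 0" and h="\<lambda>c. std_normal_density c / c"])
  show "((\<lambda>c. std_normal_density c / c) \<longlongrightarrow> 0) at_top" unfolding std_normal_density_def by real_asymp
  show "\<forall>\<^sub>F c in at_top. upper_tail c \<le> std_normal_density c / c"
    using eventually_gt_at_top[of 0] by eventually_elim (rule upper_tail_le_density)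
qed (auto simp: upper_tail_nonneg)

lemma nn_integral_normal_excess:
  "(\<integral>\<^sup>+x. ennreal (max (x - c) 0) \<partial>std_normal) = ennreal (normal_excess c)"
proof -
  have "(\<integral>\<^sup>+x. ennreal (max (x - c) 0) \<partial>std_normal) = (\<integral>\<^sup>+x. ennreal (x - c) * indicator {c..} x \<partial>std_normal)"
    by (intro nn_integral_cong) (auto split: split_indicator simp: max_def)
  also have "\<dots> = ennreal (0 - (- std_normal_density c + c * upper_tail c))"
  proof (rule nn_integral_std_normal_atLeast[where F="\<lambda>x. - std_normal_density x + c * upper_tail x"])
    show "((\<lambda>x. - std_normal_density x + c * upper_tail x) \<longlongrightarrow> 0) at_top"
      by (auto intro!: tendsto_eq_intros std_normal_density_tendsto_0 upper_tail_tendsto_0)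
    show "((\<lambda>x. - std_normal_density x + c * upper_tail x) has_field_derivative std_normal_density x * (x - c)) (at x)" for x
      by (auto intro!: derivative_eq_intros DERIV_std_normal_density DERIV_upper_tail simp: algebra_simps)
  qed auto
  finally show ?thesis by (simp add: normal_excess_def)
qed

lemma DERIV_normal_excess: "(normal_excess has_field_derivative - upper_tail x) (at x)"
  unfolding normal_excess_def[abs_def]
  by (auto intro!: derivative_eq_intros DERIV_std_normal_density DERIV_upper_tail simp: algebra_simps)

lemma normal_excess_antimono: "a \<le> b \<Longrightarrow> normal_excess b \<le> normal_excess a"
  by (rule DERIV_nonpos_imp_nonincreasing) (use DERIV_normal_excess upper_tail_nonneg in \<open>auto intro!: exI[of _ "- upper_tail _"]\<close>)

lemma normal_excess_nonneg: "0 \<le> normal_excess c"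
proof (cases "c \<le> 0")
  case True
  then show ?thesis
    using mult_nonpos_nonneg[OF True upper_tail_nonneg[of c]] normal_density_nonneg[of 0 1 c]
    unfolding normal_excess_def by linarith
next
  case False
  then show ?thesis using upper_tail_le_density[of c] by (simp add: normal_excess_def field_simps)
qed

lemma normal_excess_le_density: "0 \<le> c \<Longrightarrow> normal_excess c \<le> std_normal_density c"
  using upper_tail_nonneg by (simp add: normal_excess_def)

text \<open>\<open>?F\<close> is minus the density times 1 / x - 1 / x^3 + 3 / x^5, a partial sum of
  the Mills-ratio expansion; its derivative is the density times 1 + 15 / x^6, which bounds the tail
  from above. Three terms are taken because the first cancels against the density in
  \<open>normal_excess\<close>, leaving 1 / c^2 with a relative error of order 1 / c^2.\<close>

lemma normal_excess_lower_bound: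
  assumes "0 < c" shows "std_normal_density c * (1 / c\<^sup>2 - 3 / c ^ 4) \<le> normal_excess c"
proof -
  let ?F = "\<lambda>x. - (std_normal_density x * (1 / x - 1 / x ^ 3 + 3 / x ^ 5))"
  have "emeasure std_normal {c..} = (\<integral>\<^sup>+x. 1 * indicator {c..} x \<partial>std_normal)" by simp
  also have "\<dots> \<le> (\<integral>\<^sup>+x. ennreal (1 + 15 / x ^ 6) * indicator {c..} x \<partial>std_normal)"
    by (intro nn_integral_mono) (auto split: split_indicator)
  also have "\<dots> = ennreal (0 - ?F c)"
  proof (rule nn_integral_std_normal_atLeast[where F="?F"])
    show "(?F \<longlongrightarrow> 0) at_top" unfolding std_normal_density_def by real_asymp
    fix x assume "c \<le> x"
    then have x: "x > 0" using assms by auto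
    show "DERIV ?F x :> std_normal_density x * (1 + 15 / x ^ 6)"
      using x by (auto intro!: derivative_eq_intros DERIV_std_normal_density simp: field_simps power_numeral_reduce)
  qed auto
  finally have "ennreal (upper_tail c) \<le> ennreal (std_normal_density c * (1 / c - 1 / c ^ 3 + 3 / c ^ 5))"
    by (simp add: upper_tail_emeasure)
  moreover have "0 \<le> 1 / c - 1 / c ^ 3 + 3 / c ^ 5"
  proof -
    have "0 \<le> (c\<^sup>2 - 1 / 2)\<^sup>2 + 11 / 4" by (intro add_nonneg_nonneg) auto
    also have "\<dots> = c ^ 4 - c\<^sup>2 + 3" by (simp add: power2_eq_square power4_eq_xxxx algebra_simps)
    finally have "0 \<le> (c ^ 4 - c\<^sup>2 + 3) / c ^ 5" using assms by simp
    also have "\<dots> = 1 / c - 1 / c ^ 3 + 3 / c ^ 5" using assms by (simp add: field_simps power_numeral_reduce)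
    finally show ?thesis .
  qed
  ultimately have "upper_tail c \<le> std_normal_density c * (1 / c - 1 / c ^ 3 + 3 / c ^ 5)"
    by (subst (asm) ennreal_le_iff) auto
  then have "c * upper_tail c \<le> c * (std_normal_density c * (1 / c - 1 / c ^ 3 + 3 / c ^ 5))"
    using assms by (intro mult_left_mono) auto
  also have "\<dots> = std_normal_density c - std_normal_density c * (1 / c\<^sup>2 - 3 / c ^ 4)"
    using assms by (simp add: field_simps power_numeral_reduce)
  finally show ?thesis by (simp add: normal_excess_def)
qed

text \<open>The exponent - x^2 / 2 lies below its tangent at c, so beyond c the density is dominated
  by an exponential of rate c, and y^2 exp (- c y) integrates to 2 / c^3.\<close>

lemma nn_integral_excess_square_bound:
  assumes c: "0 < c"
  shows "(\<integral>\<^sup>+x. ennreal ((max (x - c) 0)\<^sup>2) \<partial>std_normal) \<le> ennreal (2 * std_normal_density c / c ^ 3)"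
proof -
  let ?g = "\<lambda>x. std_normal_density c * exp (- c * (x - c)) * (x - c)\<^sup>2"
  let ?F = "\<lambda>x. - std_normal_density c * exp (- c * (x - c)) * ((x - c)\<^sup>2 / c + 2 * (x - c) / c\<^sup>2 + 2 / c ^ 3)"
  have "(\<integral>\<^sup>+x. ennreal ((max (x - c) 0)\<^sup>2) \<partial>std_normal) = (\<integral>\<^sup>+x. ennreal (std_normal_density x * (max (x - c) 0)\<^sup>2) \<partial>lborel)"
    by (subst nn_integral_normal_measure) (auto simp: ennreal_mult')
  also have "\<dots> \<le> (\<integral>\<^sup>+x. ennreal (?g x) * indicator {c..} x \<partial>lborel)"
  proof (intro nn_integral_mono)
    fix x
    show "ennreal (std_normal_density x * (max (x - c) 0)\<^sup>2) \<le> ennreal (?g x) * indicator {c..} x"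
    proof (cases "c \<le> x")
      case True
      have "- x\<^sup>2 / 2 \<le> - c\<^sup>2 / 2 + - c * (x - c)"
        using zero_le_power2[of "x - c"] by (simp add: power2_eq_square algebra_simps)
      then have "exp (- x\<^sup>2 / 2) \<le> exp (- c\<^sup>2 / 2) * exp (- c * (x - c))" unfolding exp_add[symmetric] by simp
      then have "std_normal_density x \<le> std_normal_density c * exp (- c * (x - c))"
        unfolding std_normal_density_def mult.assoc by (intro mult_left_mono) auto
      then have "std_normal_density x * (x - c)\<^sup>2 \<le> ?g x" by (intro mult_right_mono) auto
      then show ?thesis using True by (simp add: max_def ennreal_leI)
    qed (auto simp: max_def)
  qed
  also have "\<dots> = ennreal (0 - ?F c)"
  proof (rule nn_integral_FTC_atLeast[where F="?F"])
    have "((\<lambda>x. exp (- c * (x - c)) * ((x - c)\<^sup>2 / c + 2 * (x - c) / c\<^sup>2 + 2 / c ^ 3)) \<longlongrightarrow> 0) at_top"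
      using c by real_asymp
    from tendsto_mult_left[OF this, of "- std_normal_density c"]
    show "(?F \<longlongrightarrow> 0) at_top" by (simp add: mult.assoc)
    show "DERIV ?F x :> ?g x" for x
      using c by (auto intro!: derivative_eq_intros simp: field_simps power_numeral_reduce)
  qed auto
  finally show ?thesis by (simp add: mult.commute)
qed

section \<open>Soft thresholding of a normal variable\<close>

lemma std_normal_symmetric:
  assumes [measurable]: "f \<in> borel_measurable borel"
  shows "(\<integral>\<^sup>+x. f (- x) \<partial>std_normal) = (\<integral>\<^sup>+x. f x \<partial>std_normal)"
  using nn_integral_normal_scale[of 1 f "- 1"] by simp

text \<open>For t >= 0 this agrees with the sign of x times the positive part of |x| - t. As a
  difference of positive parts it has a Gaussian mean that is a difference of two values of
  \<open>normal_excess\<close>.\<close>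

definition soft :: "real \<Rightarrow> real \<Rightarrow> real" where
  "soft t x = max (x - t) 0 - max (- x - t) 0"

lemma measurable_soft [measurable]: "soft t \<in> borel_measurable borel"
  unfolding soft_def[abs_def] by measurable

lemma soft_abs_le: "0 \<le> t \<Longrightarrow> \<bar>soft t x\<bar> \<le> \<bar>x\<bar>"
  by (auto simp: soft_def max_def)

lemma soft_minus: "soft t (- x) = - soft t x"
  by (auto simp: soft_def max_def)

text \<open>The slope of \<open>soft t\<close> is 1 where |x| > t and 0 where |x| < t. As |a + y| >=
  |a - y|, whenever the argument a - y lowers the sum as y grows, the argument a + y makes up for
  it.\<close>

lemma soft_pair_mono:
  assumes "0 \<le> t" "0 \<le> a" "0 \<le> y" "y \<le> y'"
  shows "soft t (a + y) + soft t (a - y) \<le> soft t (a + y') + soft t (a - y')"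
  using assms by (auto simp: soft_def max_def)

lemma integrable_std_normal_iff:
  fixes f :: "real \<Rightarrow> real"
  assumes [measurable]: "f \<in> borel_measurable borel"
  shows "integrable std_normal f \<longleftrightarrow> integrable lborel (\<lambda>x. std_normal_density x * f x)"
  unfolding normal_measure_def by (subst integrable_density) auto

lemma integral_std_normal:
  fixes f :: "real \<Rightarrow> real"
  assumes [measurable]: "f \<in> borel_measurable borel"
  shows "integral\<^sup>L std_normal f = (\<integral>x. std_normal_density x * f x \<partial>lborel)"
  unfolding normal_measure_def by (subst integral_density) auto

lemma integrable_std_normal [simp]:
  "integrable std_normal (\<lambda>x. x)" "integrable std_normal (\<lambda>x. \<bar>x\<bar>)" "integrable std_normal (\<lambda>x. x\<^sup>2)"
  using integrable_std_normal_moment[of 1] integrable_std_normal_moment_abs[of 1] integrable_std_normal_moment[of 2]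
  by (simp_all add: integrable_std_normal_iff)

lemma integral_std_normal_moments:
  "(\<integral>x. x \<partial>std_normal) = 0" "(\<integral>x. x\<^sup>2 \<partial>std_normal) = 1"
  using integral_std_normal_moment_odd[of 0] integral_std_normal_moment_even[of 1]
  by (simp_all add: integral_std_normal)

lemma integral_std_normal_symmetric:
  fixes f :: "real \<Rightarrow> real"
  assumes [measurable]: "f \<in> borel_measurable borel"
  shows "(\<integral>x. f (- x) \<partial>std_normal) = (\<integral>x. f x \<partial>std_normal)"
proof -
  have "distr std_normal borel uminus = std_normal"
  proof (rule measure_eqI)
    fix A assume "A \<in> sets (distr std_normal borel uminus)"
    then have [measurable]: "A \<in> sets borel" by simp
    have "emeasure (distr std_normal borel uminus) A = (\<integral>\<^sup>+x. indicator A x \<partial>distr std_normal borel uminus)" by simp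
    also have "\<dots> = (\<integral>\<^sup>+x. indicator A (- x) \<partial>std_normal)" by (subst nn_integral_distr) auto
    also have "\<dots> = (\<integral>\<^sup>+x. indicator A x \<partial>std_normal)" by (rule std_normal_symmetric) auto
    finally show "emeasure (distr std_normal borel uminus) A = emeasure std_normal A" by simp
  qed simp
  then have "(\<integral>x. f x \<partial>std_normal) = (\<integral>x. f x \<partial>distr std_normal borel uminus)" by simp
  also have "\<dots> = (\<integral>x. f (- x) \<partial>std_normal)" by (subst integral_distr) auto
  finally show ?thesis by simp
qed

lemma measure_std_normal_UNIV: "measure std_normal UNIV = 1"
  using prob_space.prob_space[OF prob_space_std_normal] by simp

definition soft_mean :: "real \<Rightarrow> real \<Rightarrow> real \<Rightarrow> real" where
  "soft_mean t a w = (\<integral>z. soft t (a + w * z) \<partial>std_normal)"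

context
  fixes t :: real
  assumes t: "0 \<le> t"
begin

interpretation N: prob_space std_normal by (rule prob_space_std_normal)

lemma integrable_soft [simp]: "integrable std_normal (\<lambda>z. soft t (a + w * z))"
proof (rule Bochner_Integration.integrable_bound)
  show "integrable std_normal (\<lambda>z. \<bar>a\<bar> + \<bar>w\<bar> * \<bar>z\<bar>)" by auto
  have "\<bar>soft t (a + w * z)\<bar> \<le> \<bar>a\<bar> + \<bar>w\<bar> * \<bar>z\<bar>" for z
    using soft_abs_le[OF t, of "a + w * z"] abs_triangle_ineq[of a "w * z"] by (simp add: abs_mult)
  then show "AE z in std_normal. norm (soft t (a + w * z)) \<le> norm (\<bar>a\<bar> + \<bar>w\<bar> * \<bar>z\<bar>)"
    by (intro AE_I2) (simp add: order_trans[OF _ abs_ge_self])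
qed auto

lemma square_soft_le: "(soft t x)\<^sup>2 \<le> x\<^sup>2"
  using soft_abs_le[OF t, of x] by (metis abs_ge_zero power2_abs power_mono)

lemma integrable_linear_square: "integrable std_normal (\<lambda>z. (a + w * z)\<^sup>2)"
  by (simp add: power2_sum power_mult_distrib)

lemma integrable_soft_square [simp]: "integrable std_normal (\<lambda>z. (soft t (a + w * z))\<^sup>2)"
  by (rule Bochner_Integration.integrable_bound[OF integrable_linear_square[of a w]]) (auto simp: square_soft_le)

lemma integral_soft_square_le: "(\<integral>z. (soft t (a + w * z))\<^sup>2 \<partial>std_normal) \<le> a\<^sup>2 + w\<^sup>2"
proof -
  have "(\<integral>z. (soft t (a + w * z))\<^sup>2 \<partial>std_normal) \<le> (\<integral>z. (a + w * z)\<^sup>2 \<partial>std_normal)"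
    by (intro integral_mono integrable_linear_square square_soft_le integrable_soft_square)
  also have "\<dots> = (\<integral>z. a\<^sup>2 + (w\<^sup>2 * z\<^sup>2 + 2 * a * w * z) \<partial>std_normal)"
    by (intro Bochner_Integration.integral_cong) (auto simp: power2_eq_square algebra_simps)
  also have "\<dots> = a\<^sup>2 + w\<^sup>2"
    by (simp add: integral_std_normal_moments measure_std_normal_UNIV)
  finally show ?thesis .
qed

text \<open>Only the cross term, linear in \<theta>, has to be sharp. The coefficient of \<theta>^2
  is replaced by the second moment without thresholding; on the support this contributes the term
  \<open>II\<close>, which vanishes in \<open>enet_asymptotic_upper_bound\<close>.\<close>

lemma integrable_soft_risk: "integrable std_normal (\<lambda>z. (\<theta> * soft t (a + w * z) - b)\<^sup>2)"
  and integral_soft_risk_le: "(\<integral>z. (\<theta> * soft t (a + w * z) - b)\<^sup>2 \<partial>std_normal)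
    \<le> b\<^sup>2 - 2 * \<theta> * b * soft_mean t a w + \<theta>\<^sup>2 * (a\<^sup>2 + w\<^sup>2)"
proof -
  have eq: "(\<theta> * soft t (a + w * z) - b)\<^sup>2 = b\<^sup>2 - 2 * \<theta> * b * soft t (a + w * z) + \<theta>\<^sup>2 * (soft t (a + w * z))\<^sup>2" for z
    by (simp add: power2_eq_square algebra_simps)
  show "integrable std_normal (\<lambda>z. (\<theta> * soft t (a + w * z) - b)\<^sup>2)" unfolding eq by simp
  have "(\<integral>z. (\<theta> * soft t (a + w * z) - b)\<^sup>2 \<partial>std_normal)
     = b\<^sup>2 - 2 * \<theta> * b * soft_mean t a w + \<theta>\<^sup>2 * (\<integral>z. (soft t (a + w * z))\<^sup>2 \<partial>std_normal)"
    unfolding eq soft_mean_def by (simp add: measure_std_normal_UNIV)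
  also have "\<dots> \<le> b\<^sup>2 - 2 * \<theta> * b * soft_mean t a w + \<theta>\<^sup>2 * (a\<^sup>2 + w\<^sup>2)"
    using integral_soft_square_le by (intro add_left_mono mult_left_mono) auto
  finally show "(\<integral>z. (\<theta> * soft t (a + w * z) - b)\<^sup>2 \<partial>std_normal)
    \<le> b\<^sup>2 - 2 * \<theta> * b * soft_mean t a w + \<theta>\<^sup>2 * (a\<^sup>2 + w\<^sup>2)" .
qed

lemma soft_risk_bound_nonneg: "0 \<le> b\<^sup>2 - 2 * \<theta> * b * soft_mean t a w + \<theta>\<^sup>2 * (a\<^sup>2 + w\<^sup>2)"
  using integral_soft_risk_le[of \<theta> a w b] by (rule order_trans[rotated]) (rule integral_nonneg_AE, simp)

lemma nn_integral_soft_risk_le: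
  "(\<integral>\<^sup>+z. ennreal ((\<theta> * soft t (a + w * z) - b)\<^sup>2) \<partial>std_normal)
    \<le> ennreal (b\<^sup>2 - 2 * \<theta> * b * soft_mean t a w + \<theta>\<^sup>2 * (a\<^sup>2 + w\<^sup>2))"
  by (subst nn_integral_eq_integral[OF integrable_soft_risk]) (auto intro!: ennreal_leI integral_soft_risk_le)

lemma soft_mean_pair:
  "2 * soft_mean t a w = (\<integral>z. soft t (a + w * \<bar>z\<bar>) + soft t (a - w * \<bar>z\<bar>) \<partial>std_normal)"
proof -
  have i: "integrable std_normal (\<lambda>z. soft t (a - w * z))" using integrable_soft[of a "- w"] by simp
  have "(\<integral>z. soft t (a + w * (- z)) \<partial>std_normal) = soft_mean t a w"
    unfolding soft_mean_def by (rule integral_std_normal_symmetric) auto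
  then have "2 * soft_mean t a w = (\<integral>z. soft t (a + w * z) \<partial>std_normal) + (\<integral>z. soft t (a - w * z) \<partial>std_normal)"
    by (simp add: soft_mean_def)
  also have "\<dots> = (\<integral>z. soft t (a + w * z) + soft t (a - w * z) \<partial>std_normal)"
    by (rule Bochner_Integration.integral_add[symmetric]) (auto simp: i)
  also have "\<dots> = (\<integral>z. soft t (a + w * \<bar>z\<bar>) + soft t (a - w * \<bar>z\<bar>) \<partial>std_normal)"
    by (intro Bochner_Integration.integral_cong) (auto simp: abs_if)
  finally show ?thesis .
qed

lemma integrable_soft_abs: "integrable std_normal (\<lambda>z. soft t (a + w * \<bar>z\<bar>) + soft t (a - w * \<bar>z\<bar>))"
proof -
  have i: "integrable std_normal (\<lambda>z. soft t (a - w * z))" using integrable_soft[of a "- w"] by simp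
  have "(\<lambda>z. soft t (a + w * \<bar>z\<bar>) + soft t (a - w * \<bar>z\<bar>)) = (\<lambda>z. soft t (a + w * z) + soft t (a - w * z))"
    by (auto simp: abs_if fun_eq_iff)
  then show ?thesis using i by simp
qed

text \<open>Pairing z with -z reduces the claim to \<open>soft_pair_mono\<close>. It allows the true
  noise scale, which depends on the other coordinates of \<beta>, to be replaced by \<sigma> in the
  gain.\<close>

lemma soft_mean_mono:
  assumes "0 \<le> a" "0 \<le> w" "w \<le> w'"
  shows "soft_mean t a w \<le> soft_mean t a w'"
proof -
  have "2 * soft_mean t a w \<le> 2 * soft_mean t a w'" unfolding soft_mean_pair
    using assms t by (intro integral_mono integrable_soft_abs soft_pair_mono mult_right_mono) auto
  then show ?thesis by simp
qed

lemma soft_mean_nonneg: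
  assumes "0 \<le> a" "0 \<le> w" shows "0 \<le> soft_mean t a w"
proof -
  have "0 \<le> soft t a" using t assms by (auto simp: soft_def max_def)
  also have "soft t a = soft_mean t a 0" by (simp add: soft_mean_def measure_std_normal_UNIV)
  also have "\<dots> \<le> soft_mean t a w" by (rule soft_mean_mono) (use assms in auto)
  finally show ?thesis .
qed

lemma soft_mean_eq:
  assumes w: "0 < w"
  shows "soft_mean t a w = w * (normal_excess ((t - a) / w) - normal_excess ((t + a) / w))"
proof -
  have e1: "has_bochner_integral std_normal (\<lambda>z. max (z - c) 0) (normal_excess c)" for c
    by (rule has_bochner_integral_nn_integral[OF _ _ normal_excess_nonneg nn_integral_normal_excess]) auto
  have e2: "has_bochner_integral std_normal (\<lambda>z. max (- z - c) 0) (normal_excess c)" for c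
    by (rule has_bochner_integral_nn_integral[OF _ _ normal_excess_nonneg
          trans[OF std_normal_symmetric[of "\<lambda>z. ennreal (max (z - c) 0)"] nn_integral_normal_excess]]) auto
  have "soft t (a + w * z) = w * (max (z - (t - a) / w) 0 - max (- z - (t + a) / w) 0)" for z
  proof -
    have m: "max (w * x) 0 = w * max x 0" for x using w by (auto simp: max_def zero_le_mult_iff mult_le_0_iff)
    have p: "a + w * z - t = w * (z - (t - a) / w)" "- (a + w * z) - t = w * (- z - (t + a) / w)"
      using w by (auto simp: field_simps)
    show ?thesis unfolding soft_def p m by (simp add: right_diff_distrib)
  qed
  then show ?thesis unfolding soft_mean_def
    using has_bochner_integral_integral_eq[OF has_bochner_integral_mult_right[OF has_bochner_integral_diff[OF e1 e2], of w]]
    by simp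
qed

text \<open>The probability that a + w Z has modulus at least t, for a standard normal Z and w > 0;
  it is the derivative in a of the thresholded mean.\<close>

definition soft_slope :: "real \<Rightarrow> real \<Rightarrow> real" where
  "soft_slope a w = upper_tail ((t - a) / w) + upper_tail ((t + a) / w)"

lemma soft_slope_bounds: "0 \<le> soft_slope a w" "soft_slope a w \<le> 2"
  using upper_tail_nonneg upper_tail_le_1[of "(t - a) / w"] upper_tail_le_1[of "(t + a) / w"]
  by (auto simp: soft_slope_def)

lemma DERIV_soft_mean:
  assumes w: "0 < w"
  shows "((\<lambda>a. soft_mean t a w) has_field_derivative soft_slope a w) (at a)"
proof -
  have "((\<lambda>a. w * (normal_excess ((t - a) / w) - normal_excess ((t + a) / w))) has_field_derivative soft_slope a w) (at a)"
    using w by (auto intro!: derivative_eq_intros DERIV_chain2[OF DERIV_normal_excess] simp: soft_slope_def field_simps)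
  then show ?thesis using soft_mean_eq[OF w] by simp
qed

text \<open>This is the convexity of the mean on the half-line: the derivative of the slope compares
  the densities at t - x and t + x, and |t - x| <= t + x.\<close>

lemma soft_slope_mono:
  assumes w: "0 < w" and a: "0 \<le> a" "a \<le> b"
  shows "soft_slope a w \<le> soft_slope b w"
proof (rule DERIV_nonneg_imp_nondecreasing[OF a(2)])
  fix x assume x: "a \<le> x" "x \<le> b"
  let ?d = "(std_normal_density ((t - x) / w) - std_normal_density ((t + x) / w)) / w"
  have "((\<lambda>a. soft_slope a w) has_field_derivative ?d) (at x)"
    unfolding soft_slope_def
    using w by (auto intro!: derivative_eq_intros DERIV_chain2[OF DERIV_upper_tail] simp: field_simps)
  moreover have "0 \<le> ?d"
  proof -
    have "((t - x) / w)\<^sup>2 \<le> ((t + x) / w)\<^sup>2"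
      unfolding power_divide using t x a by (intro divide_right_mono) (auto simp: power2_eq_square algebra_simps)
    then have "std_normal_density ((t + x) / w) \<le> std_normal_density ((t - x) / w)"
      unfolding std_normal_density_def by (intro mult_left_mono) auto
    then show ?thesis using w by simp
  qed
  ultimately show "\<exists>y. ((\<lambda>a. soft_slope a w) has_real_derivative y) (at x) \<and> 0 \<le> y" by blast
qed

lemma soft_mean_tangent:
  assumes w: "0 < w" and a: "0 \<le> a" and b: "0 \<le> b"
  shows "soft_mean t a w + soft_slope a w * (b - a) \<le> soft_mean t b w"
proof (cases a b rule: linorder_cases)
  case less
  from MVT2[OF this, of "\<lambda>a. soft_mean t a w" "\<lambda>a. soft_slope a w"] DERIV_soft_mean[OF w]
  obtain z where z: "a < z" "soft_mean t b w - soft_mean t a w = (b - a) * soft_slope z w" by blast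
  have "(b - a) * soft_slope a w \<le> (b - a) * soft_slope z w"
    using soft_slope_mono[OF w a, of z] z less by (intro mult_left_mono) auto
  then show ?thesis using z(2) by (simp add: mult.commute)
next
  case greater
  from MVT2[OF this, of "\<lambda>a. soft_mean t a w" "\<lambda>a. soft_slope a w"] DERIV_soft_mean[OF w]
  obtain z where z: "b < z" "z < a" "soft_mean t a w - soft_mean t b w = (a - b) * soft_slope z w" by blast
  have "(a - b) * soft_slope z w \<le> (a - b) * soft_slope a w"
    using soft_slope_mono[OF w _ , of z a] z b greater by (intro mult_left_mono) auto
  then show ?thesis using z(3) by (simp add: algebra_simps)
qed simp

end

text \<open>
  The right-hand side is log-linear in \<open>A\<close>, by \<open>A \<le> exp (A - 1)\<close> and \<open>1 / A \<ge> 2 - A\<close>, so that a chi-square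
  moment generating function suffices to integrate it.
\<close>

lemma nn_integral_soft_square_null:
  assumes t: "0 < t" and s: "0 < s" and A: "0 \<le> A"
  shows "(\<integral>\<^sup>+z. ennreal ((soft t (s * sqrt A * z))\<^sup>2) \<partial>std_normal)
    \<le> ennreal (4 * s ^ 5 / (t ^ 3 * sqrt (2 * pi)) * exp (5 / 2 * (A - 1) - t\<^sup>2 / (2 * s\<^sup>2) * (2 - A)))"
proof (cases "A = 0")
  case True
  then show ?thesis using t by (simp add: soft_def)
next
  case False
  then have A: "0 < A" using A by simp
  define w where "w = s * sqrt A"
  define c where "c = t / w"
  have w: "0 < w" and c: "0 < c" using A s t by (auto simp: w_def c_def)
  have "(soft t (w * z))\<^sup>2 = w\<^sup>2 * ((max (z - c) 0)\<^sup>2 + (max (- z - c) 0)\<^sup>2)" for z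
  proof -
    have m: "max (w * x) 0 = w * max x 0" for x using w by (auto simp: max_def zero_le_mult_iff mult_le_0_iff)
    have p: "w * z - t = w * (z - c)" "- (w * z) - t = w * (- z - c)"
      using w by (auto simp: c_def field_simps)
    have "(w * x - w * y)\<^sup>2 = w\<^sup>2 * (x\<^sup>2 + y\<^sup>2)" if "x = 0 \<or> y = 0" for x y
      using that by (auto simp: power_mult_distrib)
    moreover have "max (z - c) 0 = 0 \<or> max (- z - c) 0 = 0" using c by (auto simp: max_def)
    ultimately show ?thesis unfolding soft_def p m by blast
  qed
  then have "(\<integral>\<^sup>+z. ennreal ((soft t (w * z))\<^sup>2) \<partial>std_normal)
     = (\<integral>\<^sup>+z. ennreal (w\<^sup>2) * (ennreal ((max (z - c) 0)\<^sup>2) + ennreal ((max (- z - c) 0)\<^sup>2)) \<partial>std_normal)"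
    by (simp add: ennreal_mult ennreal_plus)
  also have "\<dots> = ennreal (w\<^sup>2) * ((\<integral>\<^sup>+z. ennreal ((max (z - c) 0)\<^sup>2) \<partial>std_normal) + (\<integral>\<^sup>+z. ennreal ((max (- z - c) 0)\<^sup>2) \<partial>std_normal))"
    by (subst nn_integral_cmult, simp, subst nn_integral_add) auto
  also have "(\<integral>\<^sup>+z. ennreal ((max (- z - c) 0)\<^sup>2) \<partial>std_normal) = (\<integral>\<^sup>+z. ennreal ((max (z - c) 0)\<^sup>2) \<partial>std_normal)"
    by (rule std_normal_symmetric[of "\<lambda>z. ennreal ((max (z - c) 0)\<^sup>2)"]) auto
  also have "ennreal (w\<^sup>2) * ((\<integral>\<^sup>+z. ennreal ((max (z - c) 0)\<^sup>2) \<partial>std_normal) + (\<integral>\<^sup>+z. ennreal ((max (z - c) 0)\<^sup>2) \<partial>std_normal))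
     \<le> ennreal (w\<^sup>2) * (ennreal (2 * std_normal_density c / c ^ 3) + ennreal (2 * std_normal_density c / c ^ 3))"
    by (intro mult_left_mono add_mono nn_integral_excess_square_bound c) auto
  also have "\<dots> = ennreal (4 * w\<^sup>2 * std_normal_density c / c ^ 3)"
    using c by (subst ennreal_plus[symmetric], simp, simp, subst ennreal_mult[symmetric]) auto
  also have "4 * w\<^sup>2 * std_normal_density c / c ^ 3 \<le> 4 * s ^ 5 / (t ^ 3 * sqrt (2 * pi)) * exp (5 / 2 * (A - 1) - t\<^sup>2 / (2 * s\<^sup>2) * (2 - A))"
  proof -
    \<comment> \<open>The fifth power collects w^2 from the scaling of the square and w^3 from 1 /
      c^3.\<close>
    have 1: "w ^ 5 \<le> s ^ 5 * exp (5 / 2 * (A - 1))"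
    proof -
      have "sqrt A \<le> sqrt (exp (A - 1))" using exp_ge_add_one_self[of "A - 1"] by (intro real_sqrt_le_mono) simp
      also have "sqrt (exp (A - 1)) = exp ((A - 1) / 2)" by (rule real_sqrt_unique) (auto simp: power2_eq_square exp_add[symmetric])
      finally have "sqrt A ^ 5 \<le> exp ((A - 1) / 2) ^ 5" using A by (intro power_mono) auto
      also have "\<dots> = exp (5 / 2 * (A - 1))" by (simp add: exp_of_nat_mult[symmetric])
      finally show ?thesis using s by (simp add: w_def power_mult_distrib)
    qed
    have 2: "c\<^sup>2 = t\<^sup>2 / s\<^sup>2 * (1 / A)" using A s by (simp add: c_def w_def power_divide power_mult_distrib)
    have "0 \<le> (A - 1)\<^sup>2 / A" using A by auto
    then have "2 - A \<le> 1 / A" using A by (simp add: power2_eq_square field_simps)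
    then have "t\<^sup>2 / s\<^sup>2 * (2 - A) \<le> c\<^sup>2" unfolding 2 by (intro mult_left_mono) auto
    then have 3: "exp (- c\<^sup>2 / 2) \<le> exp (- (t\<^sup>2 / (2 * s\<^sup>2) * (2 - A)))" by simp
    define K where "K = 4 / (t ^ 3 * sqrt (2 * pi))"
    have K: "0 \<le> K" using t by (simp add: K_def)
    have c3: "c ^ 3 = t ^ 3 / w ^ 3" by (simp add: c_def power_divide)
    have w5: "w\<^sup>2 * w ^ 3 = w ^ 5" by (simp flip: power_add)
    have "4 * w\<^sup>2 * std_normal_density c / c ^ 3 = 4 * std_normal_density c * (w\<^sup>2 * w ^ 3) / t ^ 3"
      unfolding c3 by simp
    also have "\<dots> = K * (w ^ 5 * exp (- c\<^sup>2 / 2))"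
      unfolding w5 std_normal_density_def K_def by (simp add: mult.commute)
    also have "\<dots> \<le> K * ((s ^ 5 * exp (5 / 2 * (A - 1))) * exp (- (t\<^sup>2 / (2 * s\<^sup>2) * (2 - A))))"
      by (rule mult_left_mono[OF mult_mono[OF 1 3] K]) (use s in simp_all)
    also have "\<dots> = 4 * s ^ 5 / (t ^ 3 * sqrt (2 * pi)) * exp (5 / 2 * (A - 1) - t\<^sup>2 / (2 * s\<^sup>2) * (2 - A))"
    proof -
      have "exp x * exp (- y) = exp (x - y)" for x y :: real by (simp add: exp_diff exp_minus divide_inverse)
      then show ?thesis unfolding K_def mult.assoc by simp
    qed
    finally show ?thesis .
  qed
  finally show ?thesis by (simp add: w_def ennreal_leI)
qed

section \<open>The risk of the elastic net\<close>

definition score :: "nat \<Rightarrow> (nat \<Rightarrow> real \<times> (nat \<Rightarrow> real)) \<Rightarrow> nat \<Rightarrow> real" where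
  "score n D j = (\<Sum>i<n. fst (D i) * snd (D i) j)"

lemma measurable_score:
  assumes "j < p" shows "(\<lambda>D. score n D j) \<in> borel_measurable (data_space n p)"
proof -
  have "(\<lambda>D. D i) \<in> measurable (data_space n p) (borel \<Otimes>\<^sub>M borel_vec p)" if "i < n" for i
    using that unfolding data_space_def by (intro measurable_component_singleton) auto
  note D = this
  have "(\<lambda>x. x j) \<in> measurable (borel_vec p) borel"
    using assms unfolding borel_vec_def by (intro measurable_component_singleton) auto
  note x = this
  have "(\<lambda>D. fst (D i) * snd (D i) j) \<in> borel_measurable (data_space n p)" if "i < n" for i
    by (intro borel_measurable_times measurable_compose[OF D[OF that] measurable_fst]
        measurable_compose[OF measurable_compose[OF D[OF that] measurable_snd] x])
  then show ?thesis unfolding score_def by (intro borel_measurable_sum) auto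
qed

lemma measurable_entry:
  assumes "l \<in> J" "i < n"
  shows "(\<lambda>c. c l i) \<in> borel_measurable (PiM J (\<lambda>_. PiM {..<n} (\<lambda>_. normal_measure 0 v)))"
proof -
  have "(\<lambda>c. c l i) \<in> measurable (PiM J (\<lambda>_. PiM {..<n} (\<lambda>_. normal_measure 0 v))) (normal_measure 0 v)"
    using measurable_compose[OF measurable_component_singleton[of l J "\<lambda>_. PiM {..<n} (\<lambda>_. normal_measure 0 v)"]
        measurable_component_singleton[of i "{..<n}" "\<lambda>_. normal_measure 0 v"]] assms by simp
  then show ?thesis using measurable_cong_sets[OF refl sets_normal_measure[of 0 v]] by auto
qed

text \<open>For fixed x, the inner product of x with another column is normal with variance v times
  the squared norm of x. The other coordinates of \<beta> thus act on the score as additional noise,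
  again absorbed into s along the induction.\<close>

lemma nn_integral_columns_add:
  fixes J :: "nat set" and x \<beta> :: "nat \<Rightarrow> real"
  assumes J: "finite J" and v: "0 < v" and s: "0 \<le> s" and f[measurable]: "f \<in> borel_measurable borel"
  shows "(\<integral>\<^sup>+c. \<integral>\<^sup>+z. f (e + (\<Sum>l\<in>J. \<beta> l * (\<Sum>i<n. c l i * x i)) + s * z) \<partial>std_normal
      \<partial>PiM J (\<lambda>_. PiM {..<n} (\<lambda>_. normal_measure 0 v)))
    = (\<integral>\<^sup>+z. f (e + sqrt (s\<^sup>2 + v * (\<Sum>i<n. (x i)\<^sup>2) * (\<Sum>l\<in>J. (\<beta> l)\<^sup>2)) * z) \<partial>std_normal)"
  using J s
proof (induction J arbitrary: s rule: finite_induct)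
  case empty
  let ?M = "PiM {} (\<lambda>_::nat. PiM {..<n} (\<lambda>_. normal_measure 0 v))"
  interpret P: prob_space ?M by (intro prob_space_PiM prob_space_normal_measure v)
  show ?case using P.emeasure_space_1 empty by simp
next
  case (insert l J)
  let ?V = "PiM {..<n} (\<lambda>_. normal_measure 0 v)"
  interpret N: prob_space std_normal by (rule prob_space_std_normal)
  interpret V: prob_space ?V by (intro prob_space_PiM prob_space_normal_measure v)
  interpret PV: product_prob_space "\<lambda>_. ?V" J ..
  have *: "(\<Sum>l'\<in>insert l J. \<beta> l' * (\<Sum>i<n. (c(l := y)) l' i * x i)) = (\<Sum>l\<in>J. \<beta> l * (\<Sum>i<n. c l i * x i)) + (\<Sum>i<n. (\<beta> l * x i) * y i)"
    for c :: "nat \<Rightarrow> nat \<Rightarrow> real" and y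
  proof -
    have "(\<Sum>l'\<in>J. \<beta> l' * (\<Sum>i<n. (c(l := y)) l' i * x i)) = (\<Sum>l\<in>J. \<beta> l * (\<Sum>i<n. c l i * x i))"
      using insert.hyps by (intro sum.cong) auto
    then show ?thesis using insert.hyps by (simp add: sum_distrib_left ac_simps)
  qed
  have m: "(\<lambda>c. \<integral>\<^sup>+z. f (e + (\<Sum>l\<in>insert l J. \<beta> l * (\<Sum>i<n. c l i * x i)) + s * z) \<partial>std_normal)
      \<in> borel_measurable (PiM (insert l J) (\<lambda>_. ?V))"
  proof -
    have S: "(\<lambda>c. (\<Sum>l\<in>insert l J. \<beta> l * (\<Sum>i<n. c l i * x i))) \<in> borel_measurable (PiM (insert l J) (\<lambda>_. ?V))"
      by (intro borel_measurable_sum borel_measurable_times borel_measurable_const measurable_entry) auto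
    have "(\<lambda>r. \<integral>\<^sup>+z. f (e + r + s * z) \<partial>std_normal) \<in> borel_measurable borel" by measurable
    from measurable_compose[OF S this] show ?thesis .
  qed
  have "(\<integral>\<^sup>+c. \<integral>\<^sup>+z. f (e + (\<Sum>l\<in>insert l J. \<beta> l * (\<Sum>i<n. c l i * x i)) + s * z) \<partial>std_normal \<partial>PiM (insert l J) (\<lambda>_. ?V))
     = (\<integral>\<^sup>+c. \<integral>\<^sup>+y. \<integral>\<^sup>+z. f ((e + (\<Sum>l\<in>J. \<beta> l * (\<Sum>i<n. c l i * x i))) + (\<Sum>i<n. (\<beta> l * x i) * y i) + s * z) \<partial>std_normal \<partial>?V \<partial>PiM J (\<lambda>_. ?V))"
    unfolding PV.product_nn_integral_insert[OF insert.hyps(1,2) m] by (simp only: * add.assoc)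
  also have "\<dots> = (\<integral>\<^sup>+c. \<integral>\<^sup>+z. f (e + (\<Sum>l\<in>J. \<beta> l * (\<Sum>i<n. c l i * x i)) + sqrt (s\<^sup>2 + v * (\<Sum>i<n. (\<beta> l * x i)\<^sup>2)) * z) \<partial>std_normal \<partial>PiM J (\<lambda>_. ?V))"
    by (intro nn_integral_cong nn_integral_PiM_normal_add v insert.prems f) auto
  also have "\<dots> = (\<integral>\<^sup>+z. f (e + sqrt ((sqrt (s\<^sup>2 + v * (\<Sum>i<n. (\<beta> l * x i)\<^sup>2)))\<^sup>2 + v * (\<Sum>i<n. (x i)\<^sup>2) * (\<Sum>l\<in>J. (\<beta> l)\<^sup>2)) * z) \<partial>std_normal)"
    using v by (intro insert.IH) (auto intro!: add_nonneg_nonneg mult_nonneg_nonneg sum_nonneg)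
  also have "(sqrt (s\<^sup>2 + v * (\<Sum>i<n. (\<beta> l * x i)\<^sup>2)))\<^sup>2 + v * (\<Sum>i<n. (x i)\<^sup>2) * (\<Sum>l\<in>J. (\<beta> l)\<^sup>2)
     = s\<^sup>2 + v * (\<Sum>i<n. (x i)\<^sup>2) * (\<Sum>l\<in>insert l J. (\<beta> l)\<^sup>2)"
  proof -
    have "0 \<le> s\<^sup>2 + v * (\<Sum>i<n. (\<beta> l * x i)\<^sup>2)" using v by (auto intro!: add_nonneg_nonneg mult_nonneg_nonneg sum_nonneg)
    then have "(sqrt (s\<^sup>2 + v * (\<Sum>i<n. (\<beta> l * x i)\<^sup>2)))\<^sup>2 = s\<^sup>2 + v * (\<Sum>i<n. (\<beta> l * x i)\<^sup>2)" by simp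
    moreover have "(\<Sum>i<n. (\<beta> l * x i)\<^sup>2) = (\<beta> l)\<^sup>2 * (\<Sum>i<n. (x i)\<^sup>2)" by (simp add: power_mult_distrib sum_distrib_left)
    moreover have "(\<Sum>l\<in>insert l J. (\<beta> l)\<^sup>2) = (\<beta> l)\<^sup>2 + (\<Sum>l\<in>J. (\<beta> l)\<^sup>2)" using insert.hyps by simp
    ultimately show ?thesis by (simp only: distrib_left distrib_right ac_simps)
  qed
  finally show ?case .
qed

text \<open>Column j both carries the signal \<beta> j and serves as the vector on which everything
  else is projected. It is therefore kept as the outer variable; the noise and the other columns
  merge into a single normal variable given it.\<close>

lemma nn_integral_score:
  fixes p :: nat
  assumes n: "0 < n" and \<sigma>: "0 \<le> \<sigma>" and j: "j < p" and f[measurable]: "f \<in> borel_measurable borel"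
  shows "(\<integral>\<^sup>+D. f (score n D j) \<partial>data_law n p \<sigma> \<beta>)
    = (\<integral>\<^sup>+x. \<integral>\<^sup>+z. f (\<beta> j * (\<Sum>i<n. (x i)\<^sup>2) + sqrt (\<sigma>\<^sup>2 + (\<Sum>l\<in>{..<p} - {j}. (\<beta> l)\<^sup>2) / real n) * sqrt (\<Sum>i<n. (x i)\<^sup>2) * z)
        \<partial>std_normal \<partial>PiM {..<n} (\<lambda>_. normal_measure 0 (1 / real n)))"
proof -
  let ?V = "PiM {..<n} (\<lambda>_. normal_measure 0 (1 / real n))" and ?U = "PiM {..<n} (\<lambda>_. std_normal)"
  let ?J = "{..<p} - {j}" and ?A = "\<lambda>x. \<Sum>i<n. (x i)\<^sup>2"
  have v: "0 < 1 / real n" using n by simp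
  interpret N: prob_space std_normal by (rule prob_space_std_normal)
  interpret V: prob_space ?V by (intro prob_space_PiM prob_space_normal_measure v)
  interpret U: prob_space ?U by (intro prob_space_PiM prob_space_std_normal)
  interpret PV: product_prob_space "\<lambda>_. ?V" ?J ..
  have P: "{..<p} = insert j ?J" using j by auto
  define g where "g = (\<lambda>c. \<integral>\<^sup>+z. f ((\<beta> j * ?A (c j) + (\<Sum>l\<in>?J. \<beta> l * (\<Sum>i<n. c l i * c j i))) + (\<sigma> * sqrt (?A (c j))) * z) \<partial>std_normal)"
  have g[measurable]: "g \<in> borel_measurable (PiM {..<p} (\<lambda>_. ?V))"
  proof -
    have [measurable]: "(\<lambda>c. ?A (c j)) \<in> borel_measurable (PiM {..<p} (\<lambda>_. ?V))"
      using j by (intro borel_measurable_sum borel_measurable_power measurable_entry) auto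
    have sq: "(\<lambda>c. sqrt (?A (c j))) \<in> borel_measurable (PiM {..<p} (\<lambda>_. ?V))" by measurable
    have S: "(\<lambda>c. (\<beta> j * ?A (c j) + (\<Sum>l\<in>?J. \<beta> l * (\<Sum>i<n. c l i * c j i)), \<sigma> * sqrt (?A (c j))))
        \<in> measurable (PiM {..<p} (\<lambda>_. ?V)) (borel \<Otimes>\<^sub>M borel)"
      using j by (intro measurable_Pair borel_measurable_add borel_measurable_sum borel_measurable_times borel_measurable_power
          borel_measurable_const sq measurable_entry) auto
    have "(\<lambda>r. \<integral>\<^sup>+z. f (fst r + snd r * z) \<partial>std_normal) \<in> borel_measurable (borel \<Otimes>\<^sub>M borel)" by measurable
    from measurable_compose[OF S this] show ?thesis by (simp add: g_def)
  qed
  have "(\<integral>\<^sup>+D. f (score n D j) \<partial>data_law n p \<sigma> \<beta>) = (\<integral>\<^sup>+c. g c \<partial>PiM {..<p} (\<lambda>_. ?V))"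
    unfolding nn_integral_data_law[OF n measurable_compose[OF measurable_score[OF j] f]]
  proof (rule nn_integral_cong)
    fix c assume "c \<in> space (PiM {..<p} (\<lambda>_. ?V))"
    \<comment> \<open>The summand \<open>0 * z\<close> supplies the extra normal variable of
      \<open>nn_integral_PiM_normal_add\<close>, at scale s = 0.\<close>
    have sc: "score n (\<lambda>i\<in>{..<n}. ((\<Sum>j<p. c j i * \<beta> j) + \<sigma> * u i, \<lambda>j\<in>{..<p}. c j i)) j
       = (\<beta> j * ?A (c j) + (\<Sum>l\<in>?J. \<beta> l * (\<Sum>i<n. c l i * c j i))) + (\<Sum>i<n. (\<sigma> * c j i) * u i) + 0 * z" for u z
    proof -
      have 1: "(\<Sum>l\<in>?J. \<beta> l * (\<Sum>i<n. c l i * c j i)) = (\<Sum>i<n. \<Sum>l\<in>?J. \<beta> l * (c l i * c j i))"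
        by (subst sum.swap) (simp add: sum_distrib_left)
      have 2: "\<beta> j * ?A (c j) = (\<Sum>i<n. \<beta> j * (c j i)\<^sup>2)" by (simp add: sum_distrib_left)
      have "((\<Sum>l<p. c l i * \<beta> l) + \<sigma> * u i) * c j i = \<beta> j * (c j i)\<^sup>2 + (\<Sum>l\<in>?J. \<beta> l * (c l i * c j i)) + (\<sigma> * c j i) * u i" for i
      proof -
        have "(\<Sum>l<p. c l i * \<beta> l) = c j i * \<beta> j + (\<Sum>l\<in>?J. c l i * \<beta> l)"
          using j by (subst sum.remove[of _ j]) auto
        moreover have "(\<Sum>l\<in>?J. c l i * \<beta> l) * c j i = (\<Sum>l\<in>?J. \<beta> l * (c l i * c j i))"
          unfolding sum_distrib_right by (intro sum.cong) auto
        ultimately show ?thesis by (simp only: distrib_right) (simp add: power2_eq_square)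
      qed
      then show ?thesis using j unfolding 1 2 by (simp add: score_def sum.distrib)
    qed
    have "(\<integral>\<^sup>+u. f (score n (\<lambda>i\<in>{..<n}. ((\<Sum>j<p. c j i * \<beta> j) + \<sigma> * u i, \<lambda>j\<in>{..<p}. c j i)) j) \<partial>?U)
      = (\<integral>\<^sup>+u. \<integral>\<^sup>+z. f ((\<beta> j * ?A (c j) + (\<Sum>l\<in>?J. \<beta> l * (\<Sum>i<n. c l i * c j i))) + (\<Sum>i<n. (\<sigma> * c j i) * u i) + 0 * z) \<partial>std_normal \<partial>?U)"
      unfolding sc[of _ 0] using N.emeasure_space_1 by simp
    also have "\<dots> = (\<integral>\<^sup>+z. f ((\<beta> j * ?A (c j) + (\<Sum>l\<in>?J. \<beta> l * (\<Sum>i<n. c l i * c j i))) + sqrt (0\<^sup>2 + 1 * (\<Sum>i<n. (\<sigma> * c j i)\<^sup>2)) * z) \<partial>std_normal)"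
      by (intro nn_integral_PiM_normal_add f) auto
    also have "sqrt (0\<^sup>2 + 1 * (\<Sum>i<n. (\<sigma> * c j i)\<^sup>2)) = \<sigma> * sqrt (?A (c j))"
      using \<sigma> by (simp add: power_mult_distrib sum_distrib_left[symmetric] real_sqrt_mult)
    finally show "(\<integral>\<^sup>+u. f (score n (\<lambda>i\<in>{..<n}. ((\<Sum>j<p. c j i * \<beta> j) + \<sigma> * u i, \<lambda>j\<in>{..<p}. c j i)) j) \<partial>?U) = g c"
      unfolding g_def .
  qed
  also have "\<dots> = (\<integral>\<^sup>+c. g c \<partial>PiM (insert j ?J) (\<lambda>_. ?V))" using P by simp
  also have "\<dots> = (\<integral>\<^sup>+x. \<integral>\<^sup>+c. g (c(j := x)) \<partial>PiM ?J (\<lambda>_. ?V) \<partial>?V)"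
    using g P by (intro PV.product_nn_integral_insert_rev) auto
  also have "\<dots> = (\<integral>\<^sup>+x. \<integral>\<^sup>+z. f (\<beta> j * ?A x + sqrt (\<sigma>\<^sup>2 + (\<Sum>l\<in>?J. (\<beta> l)\<^sup>2) / real n) * sqrt (?A x) * z) \<partial>std_normal \<partial>?V)"
  proof (rule nn_integral_cong)
    fix x :: "nat \<Rightarrow> real"
    have A0: "0 \<le> ?A x" by (intro sum_nonneg) auto
    have "(\<integral>\<^sup>+c. g (c(j := x)) \<partial>PiM ?J (\<lambda>_. ?V))
       = (\<integral>\<^sup>+c. \<integral>\<^sup>+z. f (\<beta> j * ?A x + (\<Sum>l\<in>?J. \<beta> l * (\<Sum>i<n. c l i * x i)) + (\<sigma> * sqrt (?A x)) * z) \<partial>std_normal \<partial>PiM ?J (\<lambda>_. ?V))"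
    proof -
      have "(\<Sum>l\<in>?J. \<beta> l * (\<Sum>i<n. (c(j := x)) l i * x i)) = (\<Sum>l\<in>?J. \<beta> l * (\<Sum>i<n. c l i * x i))" for c
        by (intro sum.cong) auto
      then show ?thesis unfolding g_def by simp
    qed
    also have "\<dots> = (\<integral>\<^sup>+z. f (\<beta> j * ?A x + sqrt ((\<sigma> * sqrt (?A x))\<^sup>2 + 1 / real n * ?A x * (\<Sum>l\<in>?J. (\<beta> l)\<^sup>2)) * z) \<partial>std_normal)"
      using \<sigma> A0 by (intro nn_integral_columns_add v f) auto
    also have "sqrt ((\<sigma> * sqrt (?A x))\<^sup>2 + 1 / real n * ?A x * (\<Sum>l\<in>?J. (\<beta> l)\<^sup>2)) = sqrt (\<sigma>\<^sup>2 + (\<Sum>l\<in>?J. (\<beta> l)\<^sup>2) / real n) * sqrt (?A x)"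
    proof -
      have "(\<sigma> * sqrt (?A x))\<^sup>2 + 1 / real n * ?A x * (\<Sum>l\<in>?J. (\<beta> l)\<^sup>2) = (\<sigma>\<^sup>2 + (\<Sum>l\<in>?J. (\<beta> l)\<^sup>2) / real n) * ?A x"
        using A0 by (simp add: power_mult_distrib distrib_right)
      then show ?thesis by (simp only: real_sqrt_mult)
    qed
    finally show "(\<integral>\<^sup>+c. g (c(j := x)) \<partial>PiM ?J (\<lambda>_. ?V))
       = (\<integral>\<^sup>+z. f (\<beta> j * ?A x + sqrt (\<sigma>\<^sup>2 + (\<Sum>l\<in>?J. (\<beta> l)\<^sup>2) / real n) * sqrt (?A x) * z) \<partial>std_normal)" .
  qed
  finally show ?thesis .
qed

section \<open>One Gaussian column and the risk of one coordinate\<close>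

lemma measurable_soft_mean [measurable]: "(\<lambda>r. soft_mean t (fst r) (snd r)) \<in> borel_measurable (borel \<Otimes>\<^sub>M borel)"
proof -
  interpret N: prob_space std_normal by (rule prob_space_std_normal)
  show ?thesis unfolding soft_mean_def by measurable
qed

lemma measurable_upper_tail [measurable]: "upper_tail \<in> borel_measurable borel"
  by (intro borel_measurable_continuous_onI continuous_at_imp_continuous_on) (auto intro: DERIV_isCont[OF DERIV_upper_tail])

lemma measurable_soft_slope [measurable]: "(\<lambda>r. soft_slope t (fst r) (snd r)) \<in> borel_measurable (borel \<Otimes>\<^sub>M borel)"
  if "0 \<le> t"
  unfolding soft_slope_def[OF that] by measurable

text \<open>The bound 4 <= n makes \<kappa> = 1 admissible in \<open>integrable_exp_A\<close>, from
  which the first two moments of A are controlled.\<close>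

locale gaussian_column =
  fixes n :: nat and \<tau> \<sigma> :: real
  assumes n: "4 \<le> n" and \<tau>: "0 < \<tau>" and \<sigma>: "0 < \<sigma>"
begin

abbreviation col :: "(nat \<Rightarrow> real) measure" where
  "col \<equiv> PiM {..<n} (\<lambda>_. normal_measure 0 (1 / real n))"

text \<open>Under \<open>col\<close>, n times A is chi-square with n degrees of freedom, so A
  concentrates around 1.\<close>

definition A :: "(nat \<Rightarrow> real) \<Rightarrow> real" where
  "A x = (\<Sum>i<n. (x i)\<^sup>2)"

definition e\<^sub>\<tau> :: real where
  "e\<^sub>\<tau> = (\<integral>x. soft_mean (2 * \<tau>) (\<tau> * A x) (\<sigma> * sqrt (A x)) \<partial>col)"

text \<open>The column average of the derivative in b, at b = \<tau>, of the conditional mean of the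
  thresholded score; the factor A x is the inner derivative.\<close>

definition d\<^sub>\<tau> :: real where
  "d\<^sub>\<tau> = (\<integral>x. soft_slope (2 * \<tau>) (\<tau> * A x) (\<sigma> * sqrt (A x)) * A x \<partial>col)"

lemma prob_space_col: "prob_space col"
  using n by (intro prob_space_PiM prob_space_normal_measure) auto

interpretation col: prob_space col by (rule prob_space_col)

lemma measurable_A [measurable]: "A \<in> borel_measurable col"
proof -
  have "(\<lambda>x. x i) \<in> borel_measurable col" if "i < n" for i
    using measurable_component_singleton[of i "{..<n}" "\<lambda>_. normal_measure 0 (1 / real n)"] that
      measurable_cong_sets[OF refl sets_normal_measure[of 0 "1 / real n"], of col] by auto
  then show ?thesis unfolding A_def[abs_def] by (intro borel_measurable_sum borel_measurable_power) auto
qed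

lemma A_nonneg: "0 \<le> A x"
  unfolding A_def by (intro sum_nonneg) auto

lemma nn_integral_exp_A:
  assumes "\<bar>\<kappa>\<bar> \<le> real n / 4"
  shows "(\<integral>\<^sup>+x. ennreal (exp (\<kappa> * A x)) \<partial>col) \<le> ennreal (exp (\<kappa> + 4 * \<kappa>\<^sup>2 / real n))"
proof -
  have "\<bar>\<kappa> * (1 / real n)\<bar> \<le> 1 / 4" using assms n by (simp add: abs_mult field_simps)
  then have "(\<integral>\<^sup>+x. ennreal (exp (\<kappa> * A x)) \<partial>col) \<le> ennreal (exp (real n * (\<kappa> * (1 / real n) + 4 * (\<kappa> * (1 / real n))\<^sup>2)))"
    unfolding A_def using n by (intro nn_integral_chi_square_exp) auto
  also have "real n * (\<kappa> * (1 / real n) + 4 * (\<kappa> * (1 / real n))\<^sup>2) = \<kappa> + 4 * \<kappa>\<^sup>2 / real n"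
    using n by (simp add: field_simps power2_eq_square)
  finally show ?thesis .
qed

lemma integrable_exp_A:
  assumes "\<bar>\<kappa>\<bar> \<le> real n / 4"
  shows "integrable col (\<lambda>x. exp (\<kappa> * A x))" "(\<integral>x. exp (\<kappa> * A x) \<partial>col) \<le> exp (\<kappa> + 4 * \<kappa>\<^sup>2 / real n)"
proof -
  show i: "integrable col (\<lambda>x. exp (\<kappa> * A x))"
    using nn_integral_exp_A[OF assms] by (intro integrableI_nonneg) (auto simp: less_top[symmetric] top_unique)
  have "ennreal (\<integral>x. exp (\<kappa> * A x) \<partial>col) \<le> ennreal (exp (\<kappa> + 4 * \<kappa>\<^sup>2 / real n))"
    using nn_integral_exp_A[OF assms] by (subst nn_integral_eq_integral[OF i, symmetric]) auto
  then show "(\<integral>x. exp (\<kappa> * A x) \<partial>col) \<le> exp (\<kappa> + 4 * \<kappa>\<^sup>2 / real n)" by simp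
qed

lemma exp_A_1: "integrable col (\<lambda>x. exp (A x))" "(\<integral>x. exp (A x) \<partial>col) \<le> exp 2"
proof -
  have "\<bar>1 :: real\<bar> \<le> real n / 4" using n by simp
  note e = integrable_exp_A[OF this]
  have "4 / real n \<le> 1" using n by simp
  then have "exp (1 + 4 * 1\<^sup>2 / real n) \<le> exp (2 :: real)" unfolding exp_le_cancel_iff by simp
  then show "integrable col (\<lambda>x. exp (A x))" "(\<integral>x. exp (A x) \<partial>col) \<le> exp 2"
    using e(1) order_trans[OF e(2)] by simp_all
qed

text \<open>Both powers of A are dominated by multiples of exp A. The constants 3 and 18 may be
  crude (the exact values are 1 and 1 + 2 / n), since they enter only the \<theta>^2 terms on the
  support and the a priori bound on \<open>d\<^sub>\<tau>\<close>.\<close>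

lemma integrable_A: "integrable col A" and integral_A: "0 \<le> (\<integral>x. A x \<partial>col)" "(\<integral>x. A x \<partial>col) \<le> 3"
  and integrable_A2: "integrable col (\<lambda>x. (A x)\<^sup>2)" and integral_A2: "(\<integral>x. (A x)\<^sup>2 \<partial>col) \<le> 18"
proof -
  have e9: "exp (2 :: real) \<le> 9"
  proof -
    have "exp (2 :: real) = exp 1 * exp 1" by (simp add: exp_add[symmetric])
    also have "\<dots> \<le> 3 * 3" using exp_le by (intro mult_mono) auto
    finally show ?thesis by simp
  qed
  have le1: "A x \<le> exp (A x) * exp (- 1)" for x
    using exp_ge_add_one_self[of "A x - 1"] by (simp add: exp_diff exp_minus divide_inverse)
  have le2: "(A x)\<^sup>2 \<le> 2 * exp (A x)" for x
    using exp_lower_Taylor_quadratic[OF A_nonneg[of x]] A_nonneg[of x] by (simp add: field_simps)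
  show i1: "integrable col A"
    by (rule Bochner_Integration.integrable_bound[OF integrable_mult_left[OF exp_A_1(1), of "exp (- 1)"]])
      (use le1 A_nonneg in auto)
  show i2: "integrable col (\<lambda>x. (A x)\<^sup>2)"
    by (rule Bochner_Integration.integrable_bound[OF integrable_mult_right[OF exp_A_1(1), of 2]]) (use le2 in auto)
  show "0 \<le> (\<integral>x. A x \<partial>col)" by (intro integral_nonneg_AE AE_I2 A_nonneg)
  have "(\<integral>x. A x \<partial>col) \<le> (\<integral>x. exp (A x) * exp (- 1) \<partial>col)"
    by (intro integral_mono i1 le1 integrable_mult_left exp_A_1)
  also have "\<dots> \<le> exp 2 * exp (- 1)" using exp_A_1(2) by simp
  also have "\<dots> = exp 1" by (simp add: exp_add[symmetric])
  also have "\<dots> \<le> 3" by (rule exp_le)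
  finally show "(\<integral>x. A x \<partial>col) \<le> 3" .
  have "(\<integral>x. (A x)\<^sup>2 \<partial>col) \<le> (\<integral>x. 2 * exp (A x) \<partial>col)"
    by (intro integral_mono i2 le2 integrable_mult_right exp_A_1)
  also have "\<dots> \<le> 2 * exp 2" using exp_A_1(2) by simp
  also have "\<dots> \<le> 18" using e9 by simp
  finally show "(\<integral>x. (A x)\<^sup>2 \<partial>col) \<le> 18" .
qed

lemma tangent:
  assumes b: "0 \<le> b"
  shows "soft_mean (2 * \<tau>) (\<tau> * A x) (\<sigma> * sqrt (A x)) + soft_slope (2 * \<tau>) (\<tau> * A x) (\<sigma> * sqrt (A x)) * A x * (b - \<tau>)
    \<le> soft_mean (2 * \<tau>) (b * A x) (\<sigma> * sqrt (A x))"
proof (cases "A x = 0")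
  case False
  then have "0 < A x" using A_nonneg[of x] by simp
  then show ?thesis
    using soft_mean_tangent[of "2 * \<tau>" "\<sigma> * sqrt (A x)" "\<tau> * A x" "b * A x"] \<tau> \<sigma> b by (simp add: algebra_simps)
qed simp

lemma soft_mean_zero: "soft_mean t 0 w = 0" if "0 \<le> t" for t w
proof -
  have "(\<integral>z. soft t (0 + w * (- z)) \<partial>std_normal) = (\<integral>z. soft t (0 + w * z) \<partial>std_normal)"
    by (rule integral_std_normal_symmetric) measurable
  moreover have "(\<integral>z. soft t (0 + w * (- z)) \<partial>std_normal) = - (\<integral>z. soft t (0 + w * z) \<partial>std_normal)"
    using soft_minus by simp
  ultimately show ?thesis by (simp add: soft_mean_def)
qed

lemma slope_bounds:
  "0 \<le> soft_slope (2 * \<tau>) a w" "soft_slope (2 * \<tau>) a w \<le> 2"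
  using soft_slope_bounds[of "2 * \<tau>"] \<tau> by auto

lemma measurable_mean_col [measurable]: "(\<lambda>x. soft_mean (2 * \<tau>) (b * A x) (s * sqrt (A x))) \<in> borel_measurable col"
  using measurable_compose[OF _ measurable_soft_mean, of "\<lambda>x. (b * A x, s * sqrt (A x))" col "2 * \<tau>"] by simp

lemma measurable_slope_col [measurable]: "(\<lambda>x. soft_slope (2 * \<tau>) (b * A x) (s * sqrt (A x))) \<in> borel_measurable col"
proof -
  have "0 \<le> 2 * \<tau>" using \<tau> by simp
  from measurable_compose[OF _ measurable_soft_slope[OF this], of "\<lambda>x. (b * A x, s * sqrt (A x))" col] show ?thesis by simp
qed

text \<open>The second bound is the tangent inequality at b = 0, where the mean vanishes because
  \<open>soft\<close> is odd. It yields \<open>e_le\<close>, i.e. the sign of the slack in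
  \<open>coordinate_risk_nonneg_case\<close>.\<close>

lemma mean_col_bounds:
  "0 \<le> soft_mean (2 * \<tau>) (\<tau> * A x) (\<sigma> * sqrt (A x))"
  "soft_mean (2 * \<tau>) (\<tau> * A x) (\<sigma> * sqrt (A x)) \<le> \<tau> * (soft_slope (2 * \<tau>) (\<tau> * A x) (\<sigma> * sqrt (A x)) * A x)"
  using soft_mean_nonneg[of "2 * \<tau>" "\<tau> * A x" "\<sigma> * sqrt (A x)"] tangent[of 0 x] \<tau> \<sigma> A_nonneg[of x] soft_mean_zero[of "2 * \<tau>"]
  by (auto simp: algebra_simps)

lemma slope_A_bounds: "0 \<le> soft_slope (2 * \<tau>) a w * A x" "soft_slope (2 * \<tau>) a w * A x \<le> 2 * A x"
  using slope_bounds[of a w] A_nonneg[of x] by (auto intro: mult_right_mono)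

lemma integrable_slope: "integrable col (\<lambda>x. soft_slope (2 * \<tau>) (\<tau> * A x) (\<sigma> * sqrt (A x)) * A x)"
  by (rule Bochner_Integration.integrable_bound[OF integrable_mult_right[OF integrable_A, of 2]])
    (use slope_A_bounds A_nonneg in \<open>auto simp: abs_of_nonneg\<close>)

lemma integrable_mean: "integrable col (\<lambda>x. soft_mean (2 * \<tau>) (\<tau> * A x) (\<sigma> * sqrt (A x)))"
  by (rule Bochner_Integration.integrable_bound[OF integrable_mult_right[OF integrable_slope, of \<tau>]])
    (use mean_col_bounds in \<open>auto intro!: order_trans[OF _ abs_ge_self]\<close>)

lemma e_le: "e\<^sub>\<tau> \<le> \<tau> * d\<^sub>\<tau>" and d_le: "d\<^sub>\<tau> \<le> 6"
proof -
  have "e\<^sub>\<tau> \<le> (\<integral>x. \<tau> * (soft_slope (2 * \<tau>) (\<tau> * A x) (\<sigma> * sqrt (A x)) * A x) \<partial>col)"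
    unfolding e\<^sub>\<tau>_def by (intro integral_mono integrable_mean integrable_mult_right integrable_slope mean_col_bounds)
  then show "e\<^sub>\<tau> \<le> \<tau> * d\<^sub>\<tau>" by (simp add: d\<^sub>\<tau>_def)
  have "d\<^sub>\<tau> \<le> (\<integral>x. 2 * A x \<partial>col)" unfolding d\<^sub>\<tau>_def
    by (intro integral_mono integrable_slope integrable_mult_right integrable_A slope_A_bounds)
  then show "d\<^sub>\<tau> \<le> 6" using integral_A by simp
qed

text \<open>An affine function of b^2, so that its sum over the support depends on \<beta> only
  through the squared norm and the number of nonzero entries.\<close>

definition coordinate_bound :: "real \<Rightarrow> real \<Rightarrow> real \<Rightarrow> real" where
  "coordinate_bound \<theta> S b = b\<^sup>2 - 2 * \<theta> * (\<tau> * e\<^sub>\<tau> + (e\<^sub>\<tau> / \<tau> + d\<^sub>\<tau>) / 2 * (b\<^sup>2 - \<tau>\<^sup>2)) + \<theta>\<^sup>2 * (18 * b\<^sup>2 + 3 * S)"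

text \<open>
  \<open>(e\<^sub>\<tau> / \<tau> + d\<^sub>\<tau>) / 2\<close> is the slope at \<open>\<tau>\<^sup>2\<close> of \<open>b\<close> times the mean of the thresholded score, as a function of
  \<open>b\<^sup>2\<close>; the tangent inequality holds with the exact slack \<open>(b - \<tau>)\<^sup>2 / 2 (d\<^sub>\<tau> - e\<^sub>\<tau> / \<tau>)\<close>.
\<close>

lemma coordinate_risk_nonneg_case:
  assumes \<theta>: "0 \<le> \<theta>" and b: "0 \<le> b" and s: "\<sigma> \<le> s" "s\<^sup>2 \<le> S"
  shows "(\<integral>\<^sup>+x. \<integral>\<^sup>+z. ennreal ((\<theta> * soft (2 * \<tau>) (b * A x + s * sqrt (A x) * z) - b)\<^sup>2) \<partial>std_normal \<partial>col)
    \<le> ennreal (coordinate_bound \<theta> S b)"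
    and "0 \<le> coordinate_bound \<theta> S b"
proof -
  let ?m = "\<lambda>x. soft_mean (2 * \<tau>) (\<tau> * A x) (\<sigma> * sqrt (A x))" and ?D = "\<lambda>x. soft_slope (2 * \<tau>) (\<tau> * A x) (\<sigma> * sqrt (A x)) * A x"
  define f where "f = (\<lambda>x. b\<^sup>2 - 2 * \<theta> * b * (?m x + ?D x * (b - \<tau>)) + \<theta>\<^sup>2 * (b\<^sup>2 * (A x)\<^sup>2 + S * A x))"
  have t: "0 \<le> 2 * \<tau>" using \<tau> by simp
  have fge: "b\<^sup>2 - 2 * \<theta> * b * soft_mean (2 * \<tau>) (b * A x) (s * sqrt (A x)) + \<theta>\<^sup>2 * ((b * A x)\<^sup>2 + (s * sqrt (A x))\<^sup>2) \<le> f x" for x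
  proof -
    have "?m x + ?D x * (b - \<tau>) \<le> soft_mean (2 * \<tau>) (b * A x) (\<sigma> * sqrt (A x))" by (rule tangent[OF b])
    also have "\<dots> \<le> soft_mean (2 * \<tau>) (b * A x) (s * sqrt (A x))"
      using s \<sigma> b A_nonneg[of x] by (intro soft_mean_mono t mult_right_mono) auto
    finally have "2 * \<theta> * b * (?m x + ?D x * (b - \<tau>)) \<le> 2 * \<theta> * b * soft_mean (2 * \<tau>) (b * A x) (s * sqrt (A x))"
      using \<theta> b by (intro mult_left_mono) auto
    moreover have "(s * sqrt (A x))\<^sup>2 \<le> S * A x"
      using mult_right_mono[OF s(2) A_nonneg[of x]] A_nonneg[of x] by (simp add: power_mult_distrib)
    then have "\<theta>\<^sup>2 * ((b * A x)\<^sup>2 + (s * sqrt (A x))\<^sup>2) \<le> \<theta>\<^sup>2 * (b\<^sup>2 * (A x)\<^sup>2 + S * A x)"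
      by (intro mult_left_mono) (auto simp: power_mult_distrib)
    ultimately show ?thesis unfolding f_def by linarith
  qed
  have f0: "0 \<le> f x" for x using soft_risk_bound_nonneg[OF t] fge order_trans by blast
  have fi: "integrable col f" unfolding f_def
    by (intro Bochner_Integration.integrable_add Bochner_Integration.integrable_diff integrable_mult_right integrable_mult_left
        integrable_mean integrable_slope integrable_A integrable_A2 col.integrable_const)
  have "(\<integral>\<^sup>+x. \<integral>\<^sup>+z. ennreal ((\<theta> * soft (2 * \<tau>) (b * A x + s * sqrt (A x) * z) - b)\<^sup>2) \<partial>std_normal \<partial>col)
     \<le> (\<integral>\<^sup>+x. ennreal (f x) \<partial>col)" (is "?L \<le> _")
    by (intro nn_integral_mono order_trans[OF nn_integral_soft_risk_le[OF t]] ennreal_leI fge)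
  also have "\<dots> = ennreal (\<integral>x. f x \<partial>col)" by (intro nn_integral_eq_integral fi AE_I2 f0)
  finally have L: "?L \<le> ennreal (\<integral>x. f x \<partial>col)" .
  have "(\<integral>x. f x \<partial>col) = b\<^sup>2 - 2 * \<theta> * b * (e\<^sub>\<tau> + d\<^sub>\<tau> * (b - \<tau>)) + \<theta>\<^sup>2 * (b\<^sup>2 * (\<integral>x. (A x)\<^sup>2 \<partial>col) + S * (\<integral>x. A x \<partial>col))"
    unfolding f_def e\<^sub>\<tau>_def d\<^sub>\<tau>_def
    by (simp add: integrable_mean integrable_slope integrable_A integrable_A2 col.prob_space)
  also have "\<dots> \<le> b\<^sup>2 - 2 * \<theta> * (\<tau> * e\<^sub>\<tau> + (e\<^sub>\<tau> / \<tau> + d\<^sub>\<tau>) / 2 * (b\<^sup>2 - \<tau>\<^sup>2)) + \<theta>\<^sup>2 * (18 * b\<^sup>2 + 3 * S)"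
  proof -
    have "b * (e\<^sub>\<tau> + d\<^sub>\<tau> * (b - \<tau>)) - (\<tau> * e\<^sub>\<tau> + (e\<^sub>\<tau> / \<tau> + d\<^sub>\<tau>) / 2 * (b\<^sup>2 - \<tau>\<^sup>2)) = (b - \<tau>)\<^sup>2 / 2 * (d\<^sub>\<tau> - e\<^sub>\<tau> / \<tau>)"
      using \<tau> by (simp add: power2_eq_square field_simps)
    moreover have "0 \<le> (b - \<tau>)\<^sup>2 / 2 * (d\<^sub>\<tau> - e\<^sub>\<tau> / \<tau>)"
      using e_le \<tau> by (intro mult_nonneg_nonneg) (auto simp: field_simps)
    ultimately have "\<tau> * e\<^sub>\<tau> + (e\<^sub>\<tau> / \<tau> + d\<^sub>\<tau>) / 2 * (b\<^sup>2 - \<tau>\<^sup>2) \<le> b * (e\<^sub>\<tau> + d\<^sub>\<tau> * (b - \<tau>))" by linarith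
    then have "2 * \<theta> * (\<tau> * e\<^sub>\<tau> + (e\<^sub>\<tau> / \<tau> + d\<^sub>\<tau>) / 2 * (b\<^sup>2 - \<tau>\<^sup>2)) \<le> 2 * \<theta> * (b * (e\<^sub>\<tau> + d\<^sub>\<tau> * (b - \<tau>)))"
      using \<theta> by (intro mult_left_mono) auto
    moreover have "\<theta>\<^sup>2 * (b\<^sup>2 * (\<integral>x. (A x)\<^sup>2 \<partial>col) + S * (\<integral>x. A x \<partial>col)) \<le> \<theta>\<^sup>2 * (b\<^sup>2 * 18 + S * 3)"
      using integral_A integral_A2 order_trans[OF zero_le_power2 s(2)] by (intro mult_left_mono add_mono) auto
    ultimately show ?thesis by (simp add: mult.assoc mult.commute[of _ 18] mult.commute[of _ 3])
  qed
  finally have le: "(\<integral>x. f x \<partial>col) \<le> coordinate_bound \<theta> S b" by (simp add: coordinate_bound_def)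
  show "?L \<le> ennreal (coordinate_bound \<theta> S b)" using L ennreal_leI[OF le] by (rule order_trans)
  have "0 \<le> (\<integral>x. f x \<partial>col)" by (intro integral_nonneg_AE AE_I2 f0)
  then show "0 \<le> coordinate_bound \<theta> S b" using le by linarith
qed

text \<open>Reflecting z changes the sign of b, as \<open>soft\<close> is odd, and the bound is even
  in b.\<close>

lemma coordinate_risk:
  assumes \<theta>: "0 \<le> \<theta>" and s: "\<sigma> \<le> s" "s\<^sup>2 \<le> S"
  shows "(\<integral>\<^sup>+x. \<integral>\<^sup>+z. ennreal ((\<theta> * soft (2 * \<tau>) (b * A x + s * sqrt (A x) * z) - b)\<^sup>2) \<partial>std_normal \<partial>col)
    \<le> ennreal (coordinate_bound \<theta> S b)" (is ?A)
    and "0 \<le> coordinate_bound \<theta> S b" (is ?B)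
proof -
  have "?A \<and> ?B"
  proof (cases "0 \<le> b")
    case True then show ?thesis using coordinate_risk_nonneg_case[OF \<theta> _ s] by simp
  next
    case False
    have "(\<integral>\<^sup>+z. ennreal ((\<theta> * soft (2 * \<tau>) (b * A x + s * sqrt (A x) * z) - b)\<^sup>2) \<partial>std_normal)
        = (\<integral>\<^sup>+z. ennreal ((\<theta> * soft (2 * \<tau>) ((- b) * A x + s * sqrt (A x) * z) - (- b))\<^sup>2) \<partial>std_normal)" for x
    proof -
      have "(\<integral>\<^sup>+z. ennreal ((\<theta> * soft (2 * \<tau>) (b * A x + s * sqrt (A x) * z) - b)\<^sup>2) \<partial>std_normal)
          = (\<integral>\<^sup>+z. ennreal ((\<theta> * soft (2 * \<tau>) (b * A x + s * sqrt (A x) * (- z)) - b)\<^sup>2) \<partial>std_normal)"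
        by (rule std_normal_symmetric[symmetric]) measurable
      also have "\<dots> = (\<integral>\<^sup>+z. ennreal ((\<theta> * soft (2 * \<tau>) ((- b) * A x + s * sqrt (A x) * z) - (- b))\<^sup>2) \<partial>std_normal)"
      proof (intro nn_integral_cong arg_cong[of _ _ ennreal])
        fix z
        have "soft (2 * \<tau>) (b * A x + s * sqrt (A x) * (- z)) = - soft (2 * \<tau>) ((- b) * A x + s * sqrt (A x) * z)"
          unfolding soft_minus[symmetric] by simp
        then show "(\<theta> * soft (2 * \<tau>) (b * A x + s * sqrt (A x) * (- z)) - b)\<^sup>2 = (\<theta> * soft (2 * \<tau>) ((- b) * A x + s * sqrt (A x) * z) - (- b))\<^sup>2"
          by (simp add: power2_eq_square algebra_simps)
      qed
      finally show ?thesis .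
    qed
    moreover have "coordinate_bound \<theta> S (- b) = coordinate_bound \<theta> S b" by (simp add: coordinate_bound_def)
    ultimately show ?thesis using coordinate_risk_nonneg_case[OF \<theta> _ s, of "- b"] False by simp
  qed
  then show ?A ?B by simp_all
qed

text \<open>With c = 2 \<tau> / s, the factor without the second summand in the exponent is 4 s^2
  times the normal density at c, divided by c^3: the bound for a thresholded centred score at A = 1.
  The second summand pays for the fluctuation of A.\<close>

definition null_risk :: "real \<Rightarrow> real" where
  "null_risk s = s ^ 5 / (2 * \<tau> ^ 3 * sqrt (2 * pi)) * exp (- 2 * \<tau>\<^sup>2 / s\<^sup>2 + 4 * (5 / 2 + 2 * \<tau>\<^sup>2 / \<sigma>\<^sup>2)\<^sup>2 / real n)"

lemma coordinate_risk_null: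
  assumes s: "\<sigma> \<le> s" "s \<le> s'" and small: "5 / 2 + 2 * \<tau>\<^sup>2 / \<sigma>\<^sup>2 \<le> real n / 4"
  shows "(\<integral>\<^sup>+x. \<integral>\<^sup>+z. ennreal ((\<theta> * soft (2 * \<tau>) (0 * A x + s * sqrt (A x) * z) - 0)\<^sup>2) \<partial>std_normal \<partial>col)
    \<le> ennreal (\<theta>\<^sup>2 * null_risk s')"
proof -
  \<comment> \<open>\<kappa> is the coefficient of A in the log-linear bound. At the mean A = 1 it
    turns the exponent - 5 / 2 - 4 \<tau>^2 / s^2 of \<open>C\<close> into - 2 \<tau>^2 /
    s^2.\<close>
  define \<kappa> where "\<kappa> = 5 / 2 + 2 * \<tau>\<^sup>2 / s\<^sup>2"
  have s0: "0 < s" "0 < s'" using \<sigma> s by auto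
  have \<kappa>: "0 \<le> \<kappa>" "\<kappa> \<le> 5 / 2 + 2 * \<tau>\<^sup>2 / \<sigma>\<^sup>2"
    using s \<sigma> s0 by (auto simp: \<kappa>_def intro!: divide_left_mono power_mono)
  define C where "C = s ^ 5 / (2 * \<tau> ^ 3 * sqrt (2 * pi)) * exp (- 5 / 2 - 4 * \<tau>\<^sup>2 / s\<^sup>2)"
  have C: "0 \<le> C" using s0 \<tau> by (simp add: C_def)
  have pw: "(\<integral>\<^sup>+z. ennreal ((\<theta> * soft (2 * \<tau>) (0 * A x + s * sqrt (A x) * z) - 0)\<^sup>2) \<partial>std_normal)
      \<le> ennreal (\<theta>\<^sup>2) * ennreal (C * exp (\<kappa> * A x))" for x
  proof -
    have "(\<integral>\<^sup>+z. ennreal ((\<theta> * soft (2 * \<tau>) (0 * A x + s * sqrt (A x) * z) - 0)\<^sup>2) \<partial>std_normal)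
       = (\<integral>\<^sup>+z. ennreal (\<theta>\<^sup>2) * ennreal ((soft (2 * \<tau>) (s * sqrt (A x) * z))\<^sup>2) \<partial>std_normal)"
      by (simp add: power_mult_distrib ennreal_mult)
    also have "\<dots> = ennreal (\<theta>\<^sup>2) * (\<integral>\<^sup>+z. ennreal ((soft (2 * \<tau>) (s * sqrt (A x) * z))\<^sup>2) \<partial>std_normal)"
      by (rule nn_integral_cmult) measurable
    also have "\<dots> \<le> ennreal (\<theta>\<^sup>2) * ennreal (4 * s ^ 5 / ((2 * \<tau>) ^ 3 * sqrt (2 * pi)) * exp (5 / 2 * (A x - 1) - (2 * \<tau>)\<^sup>2 / (2 * s\<^sup>2) * (2 - A x)))"
      using \<tau> s0 A_nonneg by (intro mult_left_mono nn_integral_soft_square_null) auto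
    also have "4 * s ^ 5 / ((2 * \<tau>) ^ 3 * sqrt (2 * pi)) * exp (5 / 2 * (A x - 1) - (2 * \<tau>)\<^sup>2 / (2 * s\<^sup>2) * (2 - A x)) = C * exp (\<kappa> * A x)"
    proof -
      have 1: "4 * s ^ 5 / ((2 * \<tau>) ^ 3 * sqrt (2 * pi)) = s ^ 5 / (2 * \<tau> ^ 3 * sqrt (2 * pi))"
        by (simp add: power_mult_distrib)
      have 2: "5 / 2 * (A x - 1) - (2 * \<tau>)\<^sup>2 / (2 * s\<^sup>2) * (2 - A x) = (- 5 / 2 - 4 * \<tau>\<^sup>2 / s\<^sup>2) + \<kappa> * A x"
        using s0 by (simp add: \<kappa>_def power_mult_distrib field_simps)
      show ?thesis unfolding 1 2 C_def exp_add by (simp only: mult.assoc)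
    qed
    finally show ?thesis .
  qed
  have "(\<integral>\<^sup>+x. \<integral>\<^sup>+z. ennreal ((\<theta> * soft (2 * \<tau>) (0 * A x + s * sqrt (A x) * z) - 0)\<^sup>2) \<partial>std_normal \<partial>col)
    \<le> (\<integral>\<^sup>+x. ennreal (\<theta>\<^sup>2 * C) * ennreal (exp (\<kappa> * A x)) \<partial>col)"
    using pw C by (intro nn_integral_mono) (simp add: ennreal_mult mult.assoc)
  also have "\<dots> = ennreal (\<theta>\<^sup>2 * C) * (\<integral>\<^sup>+x. ennreal (exp (\<kappa> * A x)) \<partial>col)"
    by (rule nn_integral_cmult) measurable
  also have "\<dots> \<le> ennreal (\<theta>\<^sup>2 * C) * ennreal (exp (\<kappa> + 4 * \<kappa>\<^sup>2 / real n))"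
    using \<kappa> small by (intro mult_left_mono nn_integral_exp_A) auto
  also have "\<dots> = ennreal (\<theta>\<^sup>2 * (C * exp (\<kappa> + 4 * \<kappa>\<^sup>2 / real n)))"
    using C by (simp add: ennreal_mult'[symmetric] mult.assoc)
  also have "\<dots> \<le> ennreal (\<theta>\<^sup>2 * null_risk s')"
  proof (intro ennreal_leI mult_left_mono)
    have "C * exp (\<kappa> + 4 * \<kappa>\<^sup>2 / real n) = s ^ 5 / (2 * \<tau> ^ 3 * sqrt (2 * pi)) * exp (- 2 * \<tau>\<^sup>2 / s\<^sup>2 + 4 * \<kappa>\<^sup>2 / real n)"
      unfolding C_def mult.assoc exp_add[symmetric] by (simp add: \<kappa>_def)
    also have "\<dots> \<le> s' ^ 5 / (2 * \<tau> ^ 3 * sqrt (2 * pi)) * exp (- 2 * \<tau>\<^sup>2 / s'\<^sup>2 + 4 * (5 / 2 + 2 * \<tau>\<^sup>2 / \<sigma>\<^sup>2)\<^sup>2 / real n)"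
    proof (intro mult_mono divide_right_mono power_mono)
      have "2 * \<tau>\<^sup>2 / s'\<^sup>2 \<le> 2 * \<tau>\<^sup>2 / s\<^sup>2" using s s0 by (intro divide_left_mono power_mono) auto
      moreover have "4 * \<kappa>\<^sup>2 / real n \<le> 4 * (5 / 2 + 2 * \<tau>\<^sup>2 / \<sigma>\<^sup>2)\<^sup>2 / real n"
        using \<kappa> by (intro divide_right_mono mult_left_mono power_mono) auto
      ultimately show "exp (- 2 * \<tau>\<^sup>2 / s\<^sup>2 + 4 * \<kappa>\<^sup>2 / real n) \<le> exp (- 2 * \<tau>\<^sup>2 / s'\<^sup>2 + 4 * (5 / 2 + 2 * \<tau>\<^sup>2 / \<sigma>\<^sup>2)\<^sup>2 / real n)"
        by simp
    qed (use s s0 \<tau> in auto)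
    finally show "C * exp (\<kappa> + 4 * \<kappa>\<^sup>2 / real n) \<le> null_risk s'" by (simp add: null_risk_def)
  qed auto
  finally show ?thesis .
qed

end

context gaussian_column
begin

interpretation col: prob_space col by (rule prob_space_col)

text \<open>By AM-GM \<open>(2 + A) / sqrt A \<ge> 2 sqrt 2\<close>, so the far tail is negligible for every \<open>A\<close>.\<close>

lemma soft_mean_concentrated:
  assumes d: "0 < d" "d < 1 / 2" and A: "\<bar>A x - 1\<bar> \<le> d"
  shows "\<sigma> * ((1 - d) * normal_excess (\<tau> / \<sigma> * (1 + d) / sqrt (1 - d)) - 2 * std_normal_density (2 * sqrt 2 * (\<tau> / \<sigma>)))
    \<le> soft_mean (2 * \<tau>) (\<tau> * A x) (\<sigma> * sqrt (A x))"
proof -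
  define a where "a = A x"
  have a: "1 - d \<le> a" "a \<le> 1 + d" using A by (auto simp: a_def)
  have a0: "0 < a" "a \<le> 4" using a d by auto
  have ra: "1 - d \<le> sqrt a" "sqrt a \<le> 2" "sqrt (1 - d) \<le> sqrt a"
  proof -
    have "(1 - d)\<^sup>2 \<le> 1 - d" using d by (simp add: power2_eq_square mult_left_le)
    then have "(1 - d)\<^sup>2 \<le> a" using a by simp
    then show "1 - d \<le> sqrt a" by (rule real_le_rsqrt)
    show "sqrt a \<le> 2" using real_sqrt_le_mono[OF a0(2)] by simp
    show "sqrt (1 - d) \<le> sqrt a" using a by simp
  qed
  have w: "0 < \<sigma> * sqrt a" using \<sigma> a0 by simp
  let ?c = "(2 * \<tau> - \<tau> * a) / (\<sigma> * sqrt a)" and ?c' = "(2 * \<tau> + \<tau> * a) / (\<sigma> * sqrt a)"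
  \<comment> \<open>The ratio (2 - a) / sqrt a is decreasing in a, so the near threshold is worst at
    a = 1 - d.\<close>
  have "?c = \<tau> / \<sigma> * ((2 - a) / sqrt a)" using \<sigma> a0 by (simp add: field_simps)
  also have "\<dots> \<le> \<tau> / \<sigma> * ((1 + d) / sqrt (1 - d))"
    using \<tau> \<sigma> a d ra by (intro mult_left_mono frac_le) auto
  finally have c: "normal_excess (\<tau> / \<sigma> * (1 + d) / sqrt (1 - d)) \<le> normal_excess ?c"
    by (intro normal_excess_antimono) simp
  have "2 * sqrt 2 \<le> (2 + a) / sqrt a"
  proof -
    have "0 \<le> (sqrt 2 - sqrt a)\<^sup>2" by simp
    then have "2 * sqrt 2 * sqrt a \<le> 2 + a" using a0 by (simp add: power2_diff)
    then show ?thesis using a0 by (simp add: field_simps)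
  qed
  then have "\<tau> / \<sigma> * (2 * sqrt 2) \<le> \<tau> / \<sigma> * ((2 + a) / sqrt a)" using \<tau> \<sigma> by (intro mult_left_mono) auto
  also have "\<dots> = ?c'" using \<sigma> a0 by (simp add: field_simps)
  finally have c'1: "2 * sqrt 2 * (\<tau> / \<sigma>) \<le> ?c'" unfolding mult.commute[of "2 * sqrt 2" "\<tau> / \<sigma>"] .
  have "(2 * sqrt 2 * (\<tau> / \<sigma>))\<^sup>2 \<le> ?c'\<^sup>2" using \<tau> \<sigma> by (intro power_mono c'1) auto
  then have "std_normal_density ?c' \<le> std_normal_density (2 * sqrt 2 * (\<tau> / \<sigma>))"
    unfolding std_normal_density_def by (intro mult_left_mono) auto
  then have c': "normal_excess ?c' \<le> std_normal_density (2 * sqrt 2 * (\<tau> / \<sigma>))"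
    using normal_excess_le_density[of ?c'] \<tau> \<sigma> a0 by (simp add: field_simps)
  have "(1 - d) * normal_excess (\<tau> / \<sigma> * (1 + d) / sqrt (1 - d)) \<le> sqrt a * normal_excess ?c"
    using ra c d normal_excess_nonneg by (intro mult_mono) auto
  moreover have "sqrt a * normal_excess ?c' \<le> 2 * std_normal_density (2 * sqrt 2 * (\<tau> / \<sigma>))"
    using ra c' a0 normal_excess_nonneg by (intro mult_mono) auto
  ultimately have "\<sigma> * ((1 - d) * normal_excess (\<tau> / \<sigma> * (1 + d) / sqrt (1 - d)) - 2 * std_normal_density (2 * sqrt 2 * (\<tau> / \<sigma>)))
     \<le> \<sigma> * (sqrt a * normal_excess ?c - sqrt a * normal_excess ?c')"
    using \<sigma> by (intro mult_left_mono) auto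
  also have "\<dots> = soft_mean (2 * \<tau>) (\<tau> * a) (\<sigma> * sqrt a)"
    using soft_mean_eq[OF _ w, of "2 * \<tau>" "\<tau> * a"] \<tau> by (simp add: algebra_simps)
  finally show ?thesis by (simp add: a_def)
qed

text \<open>Deviations of A are handled by exponential moments at the rates r and - r with r = sqrt
  n: there the second-order term 4 r^2 / n equals 4, and 16 <= n makes the rate admissible.\<close>

lemma e_lower_bound:
  assumes n16: "16 \<le> n" and d: "0 < d" "d < 1 / 2"
    and K: "K = (1 - d) * normal_excess (\<tau> / \<sigma> * (1 + d) / sqrt (1 - d)) - 2 * std_normal_density (2 * sqrt 2 * (\<tau> / \<sigma>))" "0 \<le> K"
  shows "\<sigma> * K * (1 - 2 * exp (4 - sqrt (real n) * d)) \<le> e\<^sub>\<tau>"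
proof -
  define r where "r = sqrt (real n)"
  have r: "r\<^sup>2 = real n" by (simp add: r_def)
  have "4 \<le> r" using n16 by (simp add: r_def real_le_rsqrt)
  then have "4 * r \<le> r\<^sup>2" unfolding power2_eq_square by (intro mult_right_mono) auto
  then have rn: "\<bar>r\<bar> \<le> real n / 4" "\<bar>- r\<bar> \<le> real n / 4" unfolding r using \<open>4 \<le> r\<close> by auto
  note i1 = integrable_exp_A[OF rn(1)] and i2 = integrable_exp_A[OF rn(2)]
  have e4: "4 * r\<^sup>2 / real n = 4" "4 * (- r)\<^sup>2 / real n = 4" using r n16 by auto
  \<comment> \<open>If A x is within d of 1, the bracket is at most 1 and the concentrated bound
    applies. Otherwise one of the exponentials makes the bracket nonpositive, and nonnegativity of
    the mean is enough.\<close>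
  let ?g = "\<lambda>x. \<sigma> * K * (1 - exp (- r * d) * (exp (- r) * exp (r * A x) + exp r * exp (- r * A x)))"
  have "?g x \<le> soft_mean (2 * \<tau>) (\<tau> * A x) (\<sigma> * sqrt (A x))" for x
  proof (cases "\<bar>A x - 1\<bar> \<le> d")
    case True
    have "?g x \<le> \<sigma> * K * 1" using \<sigma> K(2) by (intro mult_left_mono) auto
    also have "\<dots> \<le> soft_mean (2 * \<tau>) (\<tau> * A x) (\<sigma> * sqrt (A x))"
      using soft_mean_concentrated[OF d True] K(1) by simp
    finally show ?thesis .
  next
    case False
    have "1 \<le> exp (- r * d) * (exp (- r) * exp (r * A x) + exp r * exp (- r * A x))"
    proof (cases "1 + d < A x")
      case True
      have "0 \<le> r * (A x - 1 - d)" using True \<open>4 \<le> r\<close> by (intro mult_nonneg_nonneg) auto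
      then have "1 \<le> exp (- r * d) * (exp (- r) * exp (r * A x))"
        by (simp add: exp_add[symmetric] algebra_simps)
      also have "\<dots> \<le> exp (- r * d) * (exp (- r) * exp (r * A x) + exp r * exp (- r * A x))"
        by (intro mult_left_mono) auto
      finally show ?thesis .
    next
      case f: False
      have "0 \<le> r * (1 - d - A x)" using False f \<open>4 \<le> r\<close> by (intro mult_nonneg_nonneg) auto
      then have "1 \<le> exp (- r * d) * (exp r * exp (- r * A x))"
        by (simp add: exp_add[symmetric] algebra_simps)
      also have "\<dots> \<le> exp (- r * d) * (exp (- r) * exp (r * A x) + exp r * exp (- r * A x))"
        by (intro mult_left_mono) auto
      finally show ?thesis .
    qed
    then have "?g x \<le> 0" using \<sigma> K(2) by (intro mult_nonneg_nonpos) auto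
    also have "0 \<le> soft_mean (2 * \<tau>) (\<tau> * A x) (\<sigma> * sqrt (A x))" by (rule mean_col_bounds)
    finally show ?thesis .
  qed
  then have "(\<integral>x. ?g x \<partial>col) \<le> e\<^sub>\<tau>"
    unfolding e\<^sub>\<tau>_def
    by (intro integral_mono integrable_mean integrable_mult_right Bochner_Integration.integrable_diff
        Bochner_Integration.integrable_add i1 i2 col.integrable_const)
  moreover have "(\<integral>x. ?g x \<partial>col) = \<sigma> * K * (1 - exp (- r * d) * (exp (- r) * (\<integral>x. exp (r * A x) \<partial>col) + exp r * (\<integral>x. exp (- r * A x) \<partial>col)))"
    using i1 i2 by (simp add: col.prob_space)
  moreover have "\<sigma> * K * (1 - 2 * exp (4 - r * d)) \<le> \<dots>"
  proof (intro mult_left_mono)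
    have "exp (- r) * (\<integral>x. exp (r * A x) \<partial>col) \<le> exp (- r) * exp (r + 4)"
      using i1(2) e4 by (intro mult_left_mono) auto
    moreover have "exp r * (\<integral>x. exp (- r * A x) \<partial>col) \<le> exp r * exp (- r + 4)"
      using i2(2) e4 by (intro mult_left_mono) auto
    ultimately have "exp (- r) * (\<integral>x. exp (r * A x) \<partial>col) + exp r * (\<integral>x. exp (- r * A x) \<partial>col) \<le> 2 * exp 4"
      by (simp add: exp_add[symmetric])
    then have "exp (- r * d) * (exp (- r) * (\<integral>x. exp (r * A x) \<partial>col) + exp r * (\<integral>x. exp (- r * A x) \<partial>col)) \<le> exp (- r * d) * (2 * exp 4)"
      by (intro mult_left_mono) auto
    also have "\<dots> = 2 * exp (4 - r * d)" by (simp add: exp_diff exp_minus divide_inverse)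
    finally show "1 - 2 * exp (4 - r * d) \<le> 1 - exp (- r * d) * (exp (- r) * (\<integral>x. exp (r * A x) \<partial>col) + exp r * (\<integral>x. exp (- r * A x) \<partial>col))"
      by simp
  qed (use \<sigma> K(2) in auto)
  ultimately show ?thesis unfolding r_def by linarith
qed

end

section \<open>The closed form of the elastic net\<close>

lemma scalar_enet_minimum:
  fixes a t x b :: real
  assumes a: "0 < a" and t: "0 \<le> t"
  shows "(x - soft t x / a)\<^sup>2 + 2 * t * \<bar>soft t x / a\<bar> + (a - 1) * (soft t x / a)\<^sup>2 + a * (b - soft t x / a)\<^sup>2
    \<le> (x - b)\<^sup>2 + 2 * t * \<bar>b\<bar> + (a - 1) * b\<^sup>2"
proof -
  define c where "c = soft t x / a"
  have s: "soft t x = a * c" using a by (simp add: c_def)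
  \<comment> \<open>The residual x - \<open>soft t x\<close> is a subgradient of t times the modulus
    at c: facts 1 and 2 are its equality at c and its inequality at b. The term a (b - c)^2 is the
    surplus from strong convexity.\<close>
  have 1: "(x - soft t x) * c = t * \<bar>c\<bar>"
  proof (cases "soft t x = 0")
    case False
    then have "(x - soft t x = t \<and> soft t x > 0) \<or> (x - soft t x = - t \<and> soft t x < 0)"
      using t by (auto simp: soft_def max_def split: if_splits)
    then show ?thesis
    proof
      assume *: "x - soft t x = t \<and> soft t x > 0"
      then have "0 < c" using a by (simp add: c_def)
      then show ?thesis using * by simp
    next
      assume *: "x - soft t x = - t \<and> soft t x < 0"
      then have "c < 0" using a by (simp add: c_def divide_neg_pos)
      then show ?thesis using * by simp
    qed
  qed (simp add: c_def)
  have "\<bar>x - soft t x\<bar> \<le> t" using t by (auto simp: soft_def max_def)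
  then have 2: "(x - soft t x) * b \<le> t * \<bar>b\<bar>"
    by (metis abs_ge_self abs_mult mult_right_mono abs_ge_zero order_trans)
  have "(x - b)\<^sup>2 + 2 * t * \<bar>b\<bar> + (a - 1) * b\<^sup>2 - ((x - c)\<^sup>2 + 2 * t * \<bar>c\<bar> + (a - 1) * c\<^sup>2 + a * (b - c)\<^sup>2)
     = 2 * ((t * \<bar>b\<bar> - (x - a * c) * b) + ((x - a * c) * c - t * \<bar>c\<bar>))"
    by (simp add: power2_eq_square algebra_simps)
  also have "\<dots> \<ge> 0" using 1 2 unfolding s by simp
  finally show ?thesis unfolding c_def by linarith
qed

definition enet_solution :: "nat \<Rightarrow> nat \<Rightarrow> real \<Rightarrow> real \<Rightarrow> (nat \<Rightarrow> real \<times> (nat \<Rightarrow> real)) \<Rightarrow> nat \<Rightarrow> real" where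
  "enet_solution n p l g D = (\<lambda>j\<in>{..<p}. soft (l / 2) (score n D j) / (1 + g))"

text \<open>Strong convexity, coordinate by coordinate, with curvature 1 + g and threshold l / 2.
  The quadratic surplus yields minimality and uniqueness of the closed form at once.\<close>

lemma enet_objective_ge:
  assumes l: "0 \<le> l" and g: "- 1 < g"
  shows "enet_objective n p l g D (enet_solution n p l g D) + (1 + g) * (\<Sum>j<p. (b j - enet_solution n p l g D j)\<^sup>2)
    \<le> enet_objective n p l g D b"
proof -
  have obj: "enet_objective n p l g D b = (\<Sum>j<p. (score n D j - b j)\<^sup>2 + 2 * (l / 2) * \<bar>b j\<bar> + ((1 + g) - 1) * (b j)\<^sup>2)" for b
    by (simp add: enet_objective_def L2_set_def sum_nonneg score_def sum.distrib sum_distrib_left)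
  show ?thesis unfolding obj sum_distrib_left sum.distrib[symmetric]
    using l g by (intro sum_mono) (simp only: enet_solution_def restrict_apply if_True, intro scalar_enet_minimum, auto)
qed

lemma enet_solution_estimator: "enet_solution n p l g \<in> estimators n p"
  unfolding estimators_def borel_vec_def enet_solution_def[abs_def]
  by (intro measurable_restrict borel_measurable_divide borel_measurable_const
      measurable_compose[OF measurable_score measurable_soft]) auto

text \<open>The closed form is measurable, so the set of estimators is nonempty and a statement
  about all minimisers is not vacuous; uniqueness reduces that statement to the closed form.\<close>

lemma enet_estimators_eq:
  assumes l: "0 \<le> l" and g: "- 1 < g"
  shows "enet_solution n p l g \<in> enet_estimators n p l g"
    and "h \<in> enet_estimators n p l g \<Longrightarrow> D \<in> space (data_space n p) \<Longrightarrow> h D = enet_solution n p l g D"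
proof -
  let ?P = "\<lambda>b. b \<in> {..<p} \<rightarrow>\<^sub>E (UNIV :: real set)"
  have ext: "?P (enet_solution n p l g D)" for D by (simp add: enet_solution_def)
  have nn: "0 \<le> (1 + g) * (\<Sum>j<p. (b j - enet_solution n p l g D j)\<^sup>2)" for b D
    using g by (intro mult_nonneg_nonneg sum_nonneg) auto
  have "is_arg_min (enet_objective n p l g D) ?P (enet_solution n p l g D)" for D
    unfolding is_arg_min_def
  proof (intro conjI notI)
    assume "\<exists>y. ?P y \<and> enet_objective n p l g D y < enet_objective n p l g D (enet_solution n p l g D)"
    then obtain y where "enet_objective n p l g D y < enet_objective n p l g D (enet_solution n p l g D)" by blast
    then show False using enet_objective_ge[OF l g, of n p D y] nn[of y D] by linarith
  qed (rule ext)
  then show "enet_solution n p l g \<in> enet_estimators n p l g"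
    using enet_solution_estimator by (simp add: enet_estimators_def)
  assume h: "h \<in> enet_estimators n p l g" and D: "D \<in> space (data_space n p)"
  then have am: "is_arg_min (enet_objective n p l g D) ?P (h D)" by (simp add: enet_estimators_def)
  then have "enet_objective n p l g D (h D) \<le> enet_objective n p l g D (enet_solution n p l g D)"
    using ext[of D] by (auto simp: is_arg_min_def not_less)
  then have "(1 + g) * (\<Sum>j<p. (h D j - enet_solution n p l g D j)\<^sup>2) \<le> 0"
    using enet_objective_ge[OF l g, of n p D "h D"] by linarith
  then have "(\<Sum>j<p. (h D j - enet_solution n p l g D j)\<^sup>2) \<le> 0"
    using g by (simp add: mult_le_0_iff)
  then have "(\<Sum>j<p. (h D j - enet_solution n p l g D j)\<^sup>2) = 0"
    by (intro antisym sum_nonneg) auto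
  then have "h D j = enet_solution n p l g D j" if "j < p" for j
    using that by (simp add: sum_nonneg_eq_0_iff)
  moreover have "?P (h D)" using am by (simp add: is_arg_min_def)
  ultimately show "h D = enet_solution n p l g D"
    using ext[of D] by (intro PiE_ext) auto
qed

lemma space_data_law: "space (data_law n p \<sigma> \<beta>) = space (data_space n p)"
  by (intro sets_eq_imp_space_eq) (auto simp: data_law_def data_space_def obs_law_def intro!: sets_PiM_cong)

lemma enet_risk:
  fixes p :: nat
  assumes n: "0 < n" and \<sigma>: "0 \<le> \<sigma>" and l: "0 \<le> l" and g: "- 1 < g" and h: "h \<in> enet_estimators n p l g"
  shows "risk n p \<sigma> h \<beta> = (\<Sum>j<p. \<integral>\<^sup>+x. \<integral>\<^sup>+z. ennreal ((1 / (1 + g) * soft (l / 2) (\<beta> j * (\<Sum>i<n. (x i)\<^sup>2)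
        + sqrt (\<sigma>\<^sup>2 + (\<Sum>l\<in>{..<p} - {j}. (\<beta> l)\<^sup>2) / real n) * sqrt (\<Sum>i<n. (x i)\<^sup>2) * z) - \<beta> j)\<^sup>2)
        \<partial>std_normal \<partial>PiM {..<n} (\<lambda>_. normal_measure 0 (1 / real n)))"
proof -
  let ?f = "\<lambda>j y. ennreal ((1 / (1 + g) * soft (l / 2) y - \<beta> j)\<^sup>2)"
  have sD: "sets (data_law n p \<sigma> \<beta>) = sets (data_space n p)"
    by (auto simp: data_law_def data_space_def obs_law_def intro!: sets_PiM_cong)
  have "risk n p \<sigma> h \<beta> = (\<integral>\<^sup>+D. (\<Sum>j<p. ?f j (score n D j)) \<partial>data_law n p \<sigma> \<beta>)"
    unfolding risk_def
  proof (rule nn_integral_cong)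
    fix D assume "D \<in> space (data_law n p \<sigma> \<beta>)"
    then have "h D = enet_solution n p l g D" by (intro enet_estimators_eq(2)[OF l g h]) (simp add: space_data_law)
    then show "ennreal ((L2_set (\<lambda>j. h D j - \<beta> j) {..<p})\<^sup>2) = (\<Sum>j<p. ?f j (score n D j))"
      by (simp add: L2_set_def sum_nonneg enet_solution_def)
  qed
  also have "\<dots> = (\<Sum>j<p. \<integral>\<^sup>+D. ?f j (score n D j) \<partial>data_law n p \<sigma> \<beta>)"
  proof (intro nn_integral_sum)
    fix j assume "j \<in> {..<p}"
    then have "(\<lambda>D. score n D j) \<in> borel_measurable (data_law n p \<sigma> \<beta>)"
      using measurable_score[of j p n] measurable_cong_sets[OF sD refl, of borel] by auto
    then show "(\<lambda>D. ?f j (score n D j)) \<in> borel_measurable (data_law n p \<sigma> \<beta>)" by measurable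
  qed
  also have "\<dots> = (\<Sum>j<p. \<integral>\<^sup>+x. \<integral>\<^sup>+z. ?f j (\<beta> j * (\<Sum>i<n. (x i)\<^sup>2)
        + sqrt (\<sigma>\<^sup>2 + (\<Sum>l\<in>{..<p} - {j}. (\<beta> l)\<^sup>2) / real n) * sqrt (\<Sum>i<n. (x i)\<^sup>2) * z)
        \<partial>std_normal \<partial>PiM {..<n} (\<lambda>_. normal_measure 0 (1 / real n)))"
    by (intro sum.cong refl nn_integral_score[OF n \<sigma>]) auto
  finally show ?thesis .
qed

text \<open>The coordinate bounds add up to an affine function of the squared norm V and of the
  support size with nonnegative coefficients, hence are worst at V = k \<tau>^2 and support size k.
  There the tangent slope c cancels and only \<open>e\<^sub>\<tau>\<close> survives.\<close>

lemma (in gaussian_column) enet_max_risk: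
  fixes p k :: nat and g :: real
  defines "\<theta> \<equiv> 1 / (1 + g)" and "S \<equiv> \<sigma>\<^sup>2 + real k * \<tau>\<^sup>2 / real n"
  assumes g: "- 1 < g" and \<theta>: "12 * \<theta> \<le> 1" and h: "h \<in> enet_estimators n p (4 * \<tau>) g"
    and small: "5 / 2 + 2 * \<tau>\<^sup>2 / \<sigma>\<^sup>2 \<le> real n / 4"
  shows "max_risk n p k \<tau> \<sigma> h
    \<le> ennreal (real k * \<tau>\<^sup>2 - 2 * \<theta> * real k * \<tau> * e\<^sub>\<tau> + \<theta>\<^sup>2 * real k * (18 * \<tau>\<^sup>2 + 3 * S) + real p * \<theta>\<^sup>2 * null_risk (sqrt S))"
  unfolding max_risk_def
proof (rule SUP_least)
  fix \<beta> assume \<beta>: "\<beta> \<in> param_set p k \<tau>"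
  let ?S = "{j. j < p \<and> \<beta> j \<noteq> 0}"
  define V where "V = (\<Sum>j<p. (\<beta> j)\<^sup>2)"
  define c where "c = (e\<^sub>\<tau> / \<tau> + d\<^sub>\<tau>) / 2"
  have V: "V \<le> real k * \<tau>\<^sup>2" and cS: "card ?S \<le> k"
    using \<beta> by (auto simp: param_set_def V_def L2_set_def sum_nonneg)
  have \<theta>0: "0 \<le> \<theta>" using g by (simp add: \<theta>_def)
  have n0: "0 < n" using n by simp
  have S0: "0 \<le> S" unfolding S_def by (auto intro!: add_nonneg_nonneg)
  let ?s = "\<lambda>j. sqrt (\<sigma>\<^sup>2 + (\<Sum>l\<in>{..<p} - {j}. (\<beta> l)\<^sup>2) / real n)"
  have sub: "0 \<le> (\<Sum>l\<in>{..<p} - {j}. (\<beta> l)\<^sup>2) / real n" "(\<Sum>l\<in>{..<p} - {j}. (\<beta> l)\<^sup>2) / real n \<le> real k * \<tau>\<^sup>2 / real n" for j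
  proof -
    show "0 \<le> (\<Sum>l\<in>{..<p} - {j}. (\<beta> l)\<^sup>2) / real n" by (intro divide_nonneg_nonneg sum_nonneg) auto
    have "(\<Sum>l\<in>{..<p} - {j}. (\<beta> l)\<^sup>2) \<le> V" unfolding V_def by (intro sum_mono2) auto
    then show "(\<Sum>l\<in>{..<p} - {j}. (\<beta> l)\<^sup>2) / real n \<le> real k * \<tau>\<^sup>2 / real n" using V by (intro divide_right_mono) auto
  qed
  have s: "\<sigma> \<le> ?s j" "(?s j)\<^sup>2 \<le> S" "?s j \<le> sqrt S" for j
  proof -
    show "\<sigma> \<le> ?s j" using sub(1)[of j] by (intro real_le_rsqrt) simp
    show "?s j \<le> sqrt S" using sub(2)[of j] by (simp add: S_def)
    show "(?s j)\<^sup>2 \<le> S" using sub[of j] by (simp add: S_def)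
  qed
  let ?b = "\<lambda>j. if \<beta> j \<noteq> 0 then coordinate_bound \<theta> S (\<beta> j) else \<theta>\<^sup>2 * null_risk (sqrt S)"
  have nr0: "0 \<le> null_risk (sqrt S)" using \<tau> S0 by (auto simp: null_risk_def)
  have "risk n p \<sigma> h \<beta> = (\<Sum>j<p. \<integral>\<^sup>+x. \<integral>\<^sup>+z. ennreal ((\<theta> * soft (2 * \<tau>) (\<beta> j * A x + ?s j * sqrt (A x) * z) - \<beta> j)\<^sup>2)
        \<partial>std_normal \<partial>col)"
    using enet_risk[OF n0 less_imp_le[OF \<sigma>] _ g h, of \<beta>] \<tau> by (simp add: A_def \<theta>_def)
  also have "\<dots> \<le> (\<Sum>j<p. ennreal (?b j))"
  proof (rule sum_mono)
    fix j
    show "(\<integral>\<^sup>+x. \<integral>\<^sup>+z. ennreal ((\<theta> * soft (2 * \<tau>) (\<beta> j * A x + ?s j * sqrt (A x) * z) - \<beta> j)\<^sup>2) \<partial>std_normal \<partial>col) \<le> ennreal (?b j)"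
      using coordinate_risk(1)[OF \<theta>0 s(1,2), of "\<beta> j" j] coordinate_risk_null[OF s(1,3) small, of \<theta> j]
      by (cases "\<beta> j = 0") (simp_all only: if_True if_False not_False_eq_True simp_thms)
  qed
  also have "\<dots> = ennreal (\<Sum>j<p. ?b j)"
    using nr0 coordinate_risk(2)[OF \<theta>0 s(1,2)] by (intro sum_ennreal) auto
  also have "(\<Sum>j<p. ?b j) \<le> real k * \<tau>\<^sup>2 - 2 * \<theta> * real k * \<tau> * e\<^sub>\<tau> + \<theta>\<^sup>2 * real k * (18 * \<tau>\<^sup>2 + 3 * S) + real p * \<theta>\<^sup>2 * null_risk (sqrt S)"
  proof -
    \<comment> \<open>The null bound is charged to all p coordinates, those of the support included;
      as k / p tends to 0 in the application, this costs nothing to first order.\<close>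
    have "(\<Sum>j<p. ?b j) \<le> (\<Sum>j<p. (if \<beta> j \<noteq> 0 then coordinate_bound \<theta> S (\<beta> j) else 0) + \<theta>\<^sup>2 * null_risk (sqrt S))"
      using nr0 by (intro sum_mono) auto
    also have "\<dots> = (\<Sum>j\<in>?S. coordinate_bound \<theta> S (\<beta> j)) + real p * \<theta>\<^sup>2 * null_risk (sqrt S)"
    proof -
      have "{..<p} \<inter> {j. \<beta> j \<noteq> 0} = ?S" by auto
      then show ?thesis by (simp add: sum.distrib sum.If_cases)
    qed
    also have "(\<Sum>j\<in>?S. coordinate_bound \<theta> S (\<beta> j)) = (\<Sum>j\<in>?S. (1 - 2 * \<theta> * c + 18 * \<theta>\<^sup>2) * (\<beta> j)\<^sup>2 + (2 * \<theta> * (c * \<tau>\<^sup>2 - \<tau> * e\<^sub>\<tau>) + 3 * \<theta>\<^sup>2 * S))"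
      unfolding coordinate_bound_def c_def[symmetric] by (intro sum.cong refl) (simp add: algebra_simps)
    also have "\<dots> = (1 - 2 * \<theta> * c + 18 * \<theta>\<^sup>2) * (\<Sum>j\<in>?S. (\<beta> j)\<^sup>2) + real (card ?S) * (2 * \<theta> * (c * \<tau>\<^sup>2 - \<tau> * e\<^sub>\<tau>) + 3 * \<theta>\<^sup>2 * S)"
      by (simp add: sum.distrib sum_distrib_left)
    also have "(\<Sum>j\<in>?S. (\<beta> j)\<^sup>2) = V" unfolding V_def by (intro sum.mono_neutral_left) auto
    also have "(1 - 2 * \<theta> * c + 18 * \<theta>\<^sup>2) * V + real (card ?S) * (2 * \<theta> * (c * \<tau>\<^sup>2 - \<tau> * e\<^sub>\<tau>) + 3 * \<theta>\<^sup>2 * S)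
      \<le> (1 - 2 * \<theta> * c + 18 * \<theta>\<^sup>2) * (real k * \<tau>\<^sup>2) + real k * (2 * \<theta> * (c * \<tau>\<^sup>2 - \<tau> * e\<^sub>\<tau>) + 3 * \<theta>\<^sup>2 * S)"
    proof (intro add_mono mult_left_mono mult_right_mono V)
      \<comment> \<open>The two signs that monotonicity requires: 12 \<theta> <= 1 and c <= 6 serve
        the coefficient of V, and \<open>e\<^sub>\<tau>\<close> / \<tau> <= c serves the coefficient
        of the support size.\<close>
      have ed: "e\<^sub>\<tau> / \<tau> \<le> d\<^sub>\<tau>" using e_le \<tau> by (simp add: field_simps)
      then have "c \<le> 6" using d_le by (simp add: c_def)
      then have "2 * \<theta> * c \<le> 2 * \<theta> * 6" using \<theta>0 by (intro mult_left_mono) auto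
      then show "0 \<le> 1 - 2 * \<theta> * c + 18 * \<theta>\<^sup>2" using \<theta> by (smt (verit) zero_le_power2)
      have "x \<le> (x + y) / 2" if "x \<le> y" for x y :: real using that by simp
      from this[OF ed] have "e\<^sub>\<tau> / \<tau> \<le> c" unfolding c_def .
      then have "e\<^sub>\<tau> / \<tau> * \<tau>\<^sup>2 \<le> c * \<tau>\<^sup>2" by (intro mult_right_mono) auto
      then have "0 \<le> c * \<tau>\<^sup>2 - \<tau> * e\<^sub>\<tau>" using \<tau> by (simp add: power2_eq_square)
      then show "0 \<le> 2 * \<theta> * (c * \<tau>\<^sup>2 - \<tau> * e\<^sub>\<tau>) + 3 * \<theta>\<^sup>2 * S" using \<theta>0 S0 by auto
    qed (use cS in auto)
    also have "\<dots> = real k * \<tau>\<^sup>2 - 2 * \<theta> * real k * \<tau> * e\<^sub>\<tau> + \<theta>\<^sup>2 * real k * (18 * \<tau>\<^sup>2 + 3 * S)"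
      by (simp add: algebra_simps)
    finally show ?thesis by simp
  qed
  finally show "risk n p \<sigma> h \<beta>
    \<le> ennreal (real k * \<tau>\<^sup>2 - 2 * \<theta> * real k * \<tau> * e\<^sub>\<tau> + \<theta>\<^sup>2 * real k * (18 * \<tau>\<^sup>2 + 3 * S) + real p * \<theta>\<^sup>2 * null_risk (sqrt S))"
    by (simp add: ennreal_leI)
qed

section \<open>Asymptotics of the elastic net\<close>

text \<open>A lower bound for the thresholded mean at signal \<tau>, in units of \<sigma>, when |A -
  1| <= d: the Mills bound at the worst near threshold, minus the far tail.\<close>

definition excess_bound :: "real \<Rightarrow> real \<Rightarrow> real" where
  "excess_bound u d = (1 - d) * (std_normal_density (u * (1 + d) / sqrt (1 - d)) *
     (1 / (u * (1 + d) / sqrt (1 - d))\<^sup>2 - 3 / (u * (1 + d) / sqrt (1 - d)) ^ 4)) - 2 * std_normal_density (2 * sqrt 2 * u)"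

text \<open>All terms are measured in the unit \<open>U\<close>, the common factor of the stated
  rate. I is the gain on the support, II the crude second moment there, and III the loss off the
  support; \<rho> is the largest inflation of the noise variance by the other coordinates.\<close>

lemma (in gaussian_column) enet_max_risk_normalized:
  fixes p k :: nat and g d u X :: real
  assumes k: "0 < k" and p: "0 < p" and u: "u = \<tau> / \<sigma>" and X: "X = real p / real k"
    and g: "g = X / (2 * u\<^sup>2) * exp (- (3 / 2 * u\<^sup>2)) - 1" and \<theta>: "12 * (2 * u\<^sup>2 * exp (3 / 2 * u\<^sup>2) / X) \<le> 1"
    and n16: "16 \<le> n" and d: "0 < d" "d < 1 / 2" and K: "0 \<le> excess_bound u d" and P: "0 \<le> P" "P = 1 - 2 * exp (4 - sqrt (real n) * d)"
    and small: "5 / 2 + 2 * u\<^sup>2 \<le> real n / 4" and h: "h \<in> enet_estimators n p (4 * \<tau>) g"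
    and \<rho>: "\<rho> = 1 + real k * u\<^sup>2 / real n"
    and I: "I = 4 * (u\<^sup>2 * exp (u\<^sup>2 / 2) * sqrt (2 * pi) * excess_bound u d) * P"
    and II: "II = 4 * sqrt (2 * pi) * (u ^ 5 * exp (2 * u\<^sup>2) / X) * (18 + 3 * (1 / u\<^sup>2 + real k / real n))"
    and III: "III = 2 * sqrt \<rho> ^ 5 * exp (2 * (real k * u ^ 4 / real n) / \<rho> + 4 * (5 / 2 + 2 * u\<^sup>2)\<^sup>2 / real n)"
  shows "max_risk n p k \<tau> \<sigma> h \<le> ennreal (real k * \<tau>\<^sup>2 * (1 - (I - II - III) / sqrt (2 * pi) * (real k / real p) * (\<sigma> / \<tau>) * exp (u\<^sup>2)))"
proof -
  define t where "t = 2 * u\<^sup>2 * exp (3 / 2 * u\<^sup>2) / X"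
  define S where "S = \<sigma>\<^sup>2 + real k * \<tau>\<^sup>2 / real n"
  define q where "q = sqrt (2 * pi)"
  define U where "U = exp (u\<^sup>2) / (q * X * u)"
  have u0: "0 < u" and X0: "0 < X" and q0: "0 < q" using \<tau> \<sigma> k p by (auto simp: u X q_def)
  have n0: "0 < real n" using n by simp
  have \<tau>u: "\<tau> = u * \<sigma>" using \<sigma> by (simp add: u)
  have \<rho>0: "0 < \<rho>" unfolding \<rho> by (intro add_pos_nonneg) auto
  have t: "1 / (1 + g) = t"
  proof -
    have "(1 + g) * t = (X / (2 * u\<^sup>2) * (2 * u\<^sup>2 / X)) * (exp (- (3 / 2 * u\<^sup>2)) * exp (3 / 2 * u\<^sup>2))"
      by (simp add: g t_def)
    also have "\<dots> = 1" using u0 X0 by (simp add: exp_add[symmetric])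
    finally have *: "(1 + g) * t = 1" .
    then have "1 + g \<noteq> 0" by auto
    then show ?thesis using * by (simp add: divide_eq_eq mult.commute)
  qed
  have t0: "0 < t" using u0 X0 by (simp add: t_def)
  have g1: "- 1 < g" using u0 X0 by (simp add: g)
  have U: "(I - II - III) / sqrt (2 * pi) * (real k / real p) * (\<sigma> / \<tau>) * exp (u\<^sup>2) = (I - II - III) * U"
    using \<sigma> \<tau> k p by (simp add: U_def q_def X u)
  have tX: "t * X = 2 * u\<^sup>2 * exp (3 / 2 * u\<^sup>2)" using X0 by (simp add: t_def)
  have e3: "exp (3 / 2 * u\<^sup>2) = exp (u\<^sup>2 / 2) * exp (u\<^sup>2)" "exp (3 / 2 * u\<^sup>2) ^ 2 = exp (2 * u\<^sup>2) * exp (u\<^sup>2)"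
    by (simp_all add: exp_add[symmetric] power2_eq_square)
  have "max_risk n p k \<tau> \<sigma> h
    \<le> ennreal (real k * \<tau>\<^sup>2 - 2 * t * real k * \<tau> * e\<^sub>\<tau> + t\<^sup>2 * real k * (18 * \<tau>\<^sup>2 + 3 * S) + real p * t\<^sup>2 * null_risk (sqrt S))"
    using enet_max_risk[OF g1 _ h, of k] \<theta> small unfolding t S_def by (simp add: t_def u power_divide)
  also have "real k * \<tau>\<^sup>2 - 2 * t * real k * \<tau> * e\<^sub>\<tau> + t\<^sup>2 * real k * (18 * \<tau>\<^sup>2 + 3 * S) + real p * t\<^sup>2 * null_risk (sqrt S)
    \<le> real k * \<tau>\<^sup>2 * (1 - (I - II - III) * U)"
  proof -
    have 1: "real k * \<tau>\<^sup>2 * (I * U) \<le> 2 * t * real k * \<tau> * e\<^sub>\<tau>"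
    proof -
      define KK where "KK = (1 - d) * normal_excess (\<tau> / \<sigma> * (1 + d) / sqrt (1 - d)) - 2 * std_normal_density (2 * sqrt 2 * (\<tau> / \<sigma>))"
      have "0 < u * (1 + d) / sqrt (1 - d)" using u0 d by simp
      from normal_excess_lower_bound[OF this] have KK: "excess_bound u d \<le> KK"
        unfolding excess_bound_def KK_def u[symmetric] using d by (intro diff_right_mono mult_left_mono) auto
      then have "0 \<le> KK" using K by simp
      have "\<sigma> * excess_bound u d * P \<le> \<sigma> * KK * P"
        using \<sigma> P(1) KK by (intro mult_right_mono mult_left_mono) auto
      also have "\<dots> \<le> e\<^sub>\<tau>" unfolding P(2) by (rule e_lower_bound[OF n16 d KK_def \<open>0 \<le> KK\<close>])
      finally have "2 * t * real k * \<tau> * (\<sigma> * excess_bound u d * P) \<le> 2 * t * real k * \<tau> * e\<^sub>\<tau>"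
        using t0 \<tau> by (intro mult_left_mono) auto
      moreover have "real k * \<tau>\<^sup>2 * (I * U) = 2 * t * real k * \<tau> * (\<sigma> * excess_bound u d * P)"
      proof -
        have "I * U = 2 * (2 * u\<^sup>2 * (exp (u\<^sup>2 / 2) * exp (u\<^sup>2))) * (excess_bound u d * P) / (X * u)"
          using q0 by (simp add: I U_def q_def[symmetric])
        also have "\<dots> = 2 * t * (excess_bound u d * P) / u" unfolding e3(1)[symmetric] tX[symmetric] using X0 by simp
        finally show ?thesis using u0 by (simp add: \<tau>u power2_eq_square)
      qed
      ultimately show ?thesis by (simp only:)
    qed
    have 2: "t\<^sup>2 * real k * (18 * \<tau>\<^sup>2 + 3 * S) = real k * \<tau>\<^sup>2 * (II * U)"
    proof -
      have "S = \<tau>\<^sup>2 * (1 / u\<^sup>2 + real k / real n)" using \<sigma> u0 by (simp add: S_def \<tau>u power_mult_distrib field_simps)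
      then have "t\<^sup>2 * real k * (18 * \<tau>\<^sup>2 + 3 * S) = real k * \<tau>\<^sup>2 * (t\<^sup>2 * (18 + 3 * (1 / u\<^sup>2 + real k / real n)))"
        by (simp add: algebra_simps)
      also have "\<dots> = real k * \<tau>\<^sup>2 * ((4 * q * (u ^ 5 * exp (2 * u\<^sup>2) / X) * U) * (18 + 3 * (1 / u\<^sup>2 + real k / real n)))"
      proof -
        have "t\<^sup>2 = 4 * u ^ 4 * (exp (2 * u\<^sup>2) * exp (u\<^sup>2)) / X\<^sup>2"
          unfolding e3(2)[symmetric] by (simp add: t_def power_divide power_mult_distrib)
        also have "\<dots> = 4 * q * (u ^ 5 * exp (2 * u\<^sup>2) / X) * U"
          using q0 u0 X0 by (simp add: U_def power2_eq_square eval_nat_numeral)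
        finally show ?thesis by (simp only:)
      qed
      finally show ?thesis unfolding II q_def[symmetric] by (simp only: ac_simps)
    qed
    have 3: "real p * t\<^sup>2 * null_risk (sqrt S) = real k * \<tau>\<^sup>2 * (III * U)"
    proof -
      have S: "S = \<sigma>\<^sup>2 * \<rho>" by (simp add: S_def \<rho> \<tau>u power_mult_distrib distrib_left)
      have s5: "sqrt S ^ 5 = \<sigma> ^ 5 * sqrt \<rho> ^ 5" using \<sigma> by (simp add: S real_sqrt_mult power_mult_distrib)
      have sS: "(sqrt S)\<^sup>2 = \<sigma>\<^sup>2 * \<rho>" using \<rho>0 by (simp add: S)
      \<comment> \<open>The inflation of the variance shifts the exponent by 2 u^2 (\<rho> - 1) /
        \<rho>, and u^2 (\<rho> - 1) = k u^4 / n; this is where the sample size has to dominate k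
        u^4.\<close>
      have ex: "- 2 * \<tau>\<^sup>2 / (sqrt S)\<^sup>2 = 2 * (real k * u ^ 4 / real n) / \<rho> - 2 * u\<^sup>2"
      proof -
        have "- 2 * \<tau>\<^sup>2 / (sqrt S)\<^sup>2 = - 2 * u\<^sup>2 / \<rho>" unfolding sS using \<sigma> by (simp add: \<tau>u power_mult_distrib)
        also have "\<dots> = (2 * u\<^sup>2 * (\<rho> - 1) - 2 * u\<^sup>2 * \<rho>) / \<rho>" by (simp add: algebra_simps)
        also have "\<dots> = 2 * u\<^sup>2 * (\<rho> - 1) / \<rho> - 2 * u\<^sup>2" using \<rho>0 by (simp add: diff_divide_distrib)
        also have "2 * u\<^sup>2 * (\<rho> - 1) = 2 * (real k * u ^ 4 / real n)" by (simp add: \<rho> power2_eq_square power4_eq_xxxx)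
        finally show ?thesis .
      qed
      define E where "E = exp (2 * (real k * u ^ 4 / real n) / \<rho> + 4 * (5 / 2 + 2 * u\<^sup>2)\<^sup>2 / real n)"
      have "2 * \<tau>\<^sup>2 / \<sigma>\<^sup>2 = 2 * u\<^sup>2" by (simp add: u power_divide)
      then have "null_risk (sqrt S) = \<sigma> ^ 5 * sqrt \<rho> ^ 5 / (2 * \<tau> ^ 3 * q) * (E * exp (- (2 * u\<^sup>2)))"
        unfolding null_risk_def s5 ex E_def exp_add[symmetric] by (simp add: q_def algebra_simps)
      moreover have "t\<^sup>2 = 4 * u ^ 4 * (exp (2 * u\<^sup>2) * exp (u\<^sup>2)) / X\<^sup>2"
        unfolding e3(2)[symmetric] by (simp add: t_def power_divide power_mult_distrib)
      moreover have "real p = real k * X" using k by (simp add: X)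
      ultimately have "real p * t\<^sup>2 * null_risk (sqrt S)
          = real k * X * (4 * u ^ 4 * (exp (2 * u\<^sup>2) * exp (u\<^sup>2)) / X\<^sup>2) * (\<sigma> ^ 5 * sqrt \<rho> ^ 5 / (2 * \<tau> ^ 3 * q) * (E * exp (- (2 * u\<^sup>2))))" by (simp only:)
      also have "\<dots> = real k * ((X * (4 * u ^ 4) / X\<^sup>2) * (\<sigma> ^ 5 / (2 * \<tau> ^ 3 * q))) * sqrt \<rho> ^ 5 * E * exp (u\<^sup>2) * (exp (2 * u\<^sup>2) * exp (- (2 * u\<^sup>2)))"
      proof -
        \<comment> \<open>Stated for free variables so that the exponentials are atoms in the
          rearrangement.\<close>
        have "k * X * (F * (a * b) / Y) * (s * r / Z * (E * c)) = k * ((X * F / Y) * (s / Z)) * r * E * b * (a * c)"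
          for k X F a b Y s r Z E c :: real by simp
        then show ?thesis .
      qed
      also have "exp (2 * u\<^sup>2) * exp (- (2 * u\<^sup>2)) = 1" by (simp add: exp_add[symmetric])
      also have "(X * (4 * u ^ 4) / X\<^sup>2) * (\<sigma> ^ 5 / (2 * \<tau> ^ 3 * q)) = \<tau>\<^sup>2 * 2 / (q * X * u)"
        using X0 u0 \<sigma> q0 by (simp add: \<tau>u field_simps power_mult_distrib eval_nat_numeral)
      finally show ?thesis unfolding III E_def[symmetric] U_def by simp
    qed
    have "real k * \<tau>\<^sup>2 * (1 - (I - II - III) * U) = real k * \<tau>\<^sup>2 - real k * \<tau>\<^sup>2 * (I * U) + real k * \<tau>\<^sup>2 * (II * U) + real k * \<tau>\<^sup>2 * (III * U)"
      by (simp add: algebra_simps)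
    then show ?thesis unfolding 2 3 using 1 by linarith
  qed
  finally show ?thesis unfolding U by (simp add: ennreal_leI)
qed

text \<open>By \<open>enet_max_risk_normalized\<close> it suffices that I, II and III tend to 4, 0
  and 2; the error is I - II - III - 2.\<close>

lemma enet_asymptotic_upper_bound:
  fixes p k :: "nat \<Rightarrow> nat" and \<sigma> \<tau> :: "nat \<Rightarrow> real"
  assumes k: "\<And>n. 1 \<le> k n" "\<And>n. k n \<le> p n" and pos: "\<And>n. \<sigma> n > 0" "\<And>n. \<tau> n > 0"
    and x: "filterlim (\<lambda>n. real (p n) / real (k n)) at_top sequentially"
    and \<mu>: "filterlim (\<lambda>n. \<tau> n / \<sigma> n) at_top sequentially"
      "(\<lambda>n. (\<tau> n / \<sigma> n) / sqrt (ln (real (p n) / real (k n)))) \<longlonglongrightarrow> 0"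
    and kn: "(\<lambda>n. real (k n) * (ln (real (p n) / real (k n)))\<^sup>2 / real n) \<longlonglongrightarrow> 0"
  shows "\<exists>\<epsilon>::nat \<Rightarrow> real. \<epsilon> \<longlonglongrightarrow> 0 \<and>
        (\<forall>\<^sub>F n in sequentially.
          let l = 4 * \<tau> n;
              g = real (p n) * (\<sigma> n)\<^sup>2 / (2 * real (k n) * (\<tau> n)\<^sup>2)
                    * exp (- (3 * (\<tau> n)\<^sup>2 / (2 * (\<sigma> n)\<^sup>2))) - 1
          in enet_estimators n (p n) l g \<noteq> {} \<and>
             (\<forall>h \<in> enet_estimators n (p n) l g.
               max_risk n (p n) (k n) (\<tau> n) (\<sigma> n) h \<le>
                 ennreal (real (k n) * (\<tau> n)\<^sup>2 *
                   (1 - (2 + \<epsilon> n) / sqrt (2 * pi) * (real (k n) / real (p n))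
                        * (\<sigma> n / \<tau> n) * exp ((\<tau> n)\<^sup>2 / (\<sigma> n)\<^sup>2)))))"
proof -
  define X where "X = (\<lambda>n. real (p n) / real (k n))"
  define u where "u = (\<lambda>n. \<tau> n / \<sigma> n)"
  define v where "v = (\<lambda>n. real (k n) * u n ^ 4 / real n)"
  define q where "q = (\<lambda>n. (u n)\<^sup>2 / sqrt (real n))"
  define d where "d = (\<lambda>n. sqrt (q n) / (u n)\<^sup>2)" \<comment> \<open>\<open>u\<^sup>2 d \<longlonglongrightarrow> 0\<close> while \<open>\<surd>n d \<longlonglongrightarrow> \<infinity>\<close>\<close>
  define P where "P = (\<lambda>n. 1 - 2 * exp (4 - sqrt (real n) * d n))"
  define \<rho> where "\<rho> = (\<lambda>n. 1 + real (k n) * (u n)\<^sup>2 / real n)"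
  define I where "I = (\<lambda>n. 4 * ((u n)\<^sup>2 * exp ((u n)\<^sup>2 / 2) * sqrt (2 * pi) * excess_bound (u n) (d n)) * P n)"
  define II where "II = (\<lambda>n. 4 * sqrt (2 * pi) * (u n ^ 5 * exp (2 * (u n)\<^sup>2) / X n) * (18 + 3 * (1 / (u n)\<^sup>2 + real (k n) / real n)))"
  define III where "III = (\<lambda>n. 2 * sqrt (\<rho> n) ^ 5 * exp (2 * (real (k n) * u n ^ 4 / real n) / \<rho> n + 4 * (5 / 2 + 2 * (u n)\<^sup>2)\<^sup>2 / real n))"
  have X: "filterlim X at_top sequentially" using x by (simp add: X_def)
  have u: "filterlim u at_top sequentially" using \<mu> by (simp add: u_def)
  have n: "filterlim (\<lambda>n. real n) at_top sequentially" by (rule filterlim_real_sequentially)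
  have eu: "\<forall>\<^sub>F n in sequentially. 1 < u n" using u by (auto simp: filterlim_at_top_dense)
  have eX: "\<forall>\<^sub>F n in sequentially. 1 < X n" using X by (auto simp: filterlim_at_top_dense)
  have eln: "\<forall>\<^sub>F n in sequentially. 1 < ln (X n)"
    using filterlim_compose[OF ln_at_top X] by (auto simp: filterlim_at_top_dense)
  have en: "\<forall>\<^sub>F n in sequentially. 16 \<le> n" by (rule eventually_ge_at_top)
  have u0: "0 < u n" for n using pos by (simp add: u_def)
  have X0: "0 < X n" for n using k(1)[of n] k(2)[of n] by (simp add: X_def)
  \<comment> \<open>The quantity k u^4 / n is the product of k (ln X)^2 / n and (u / sqrt (ln X))^4,
    both of which tend to 0.\<close>
  have v: "v \<longlonglongrightarrow> 0"
  proof -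
    have "(\<lambda>n. real (k n) * (ln (X n))\<^sup>2 / real n * (u n / sqrt (ln (X n))) ^ 4) \<longlonglongrightarrow> 0 * 0 ^ 4"
      using kn \<mu>(2) by (intro tendsto_intros) (auto simp: X_def u_def)
    moreover have "\<forall>\<^sub>F n in sequentially. real (k n) * (ln (X n))\<^sup>2 / real n * (u n / sqrt (ln (X n))) ^ 4 = v n"
      using eln
    proof eventually_elim
      case (elim n)
      have "sqrt (ln (X n)) ^ 4 = (sqrt (ln (X n)))\<^sup>2 ^ 2" by (simp flip: power_mult)
      also have "\<dots> = (ln (X n))\<^sup>2" using elim by simp
      finally show ?case using elim by (simp add: v_def power_divide)
    qed
    ultimately show ?thesis by (simp add: Lim_transform_eventually)
  qed
  \<comment> \<open>As k >= 1 and eventually u > 1, the single quantity v dominates all other ratios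
    with denominator n that involve k or u.\<close>
  have vle: "\<forall>\<^sub>F n in sequentially. real (k n) / real n \<le> v n \<and> real (k n) * (u n)\<^sup>2 / real n \<le> v n \<and> (u n)\<^sup>2 / real n \<le> v n \<and> u n ^ 4 / real n \<le> v n"
    using eu
  proof eventually_elim
    case (elim n)
    have k1: "1 \<le> real (k n)" using k(1)[of n] by simp
    have u2: "1 \<le> (u n)\<^sup>2" "(u n)\<^sup>2 \<le> u n ^ 4" "1 \<le> u n ^ 4"
      using elim by (auto intro!: one_le_power power_increasing)
    have "real (k n) * 1 \<le> real (k n) * u n ^ 4" "real (k n) * (u n)\<^sup>2 \<le> real (k n) * u n ^ 4"
      using k1 u2 by (auto intro!: mult_left_mono)
    moreover have "1 * u n ^ 4 \<le> real (k n) * u n ^ 4" using k1 u2 by (intro mult_right_mono) linarith+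
    ultimately show ?case unfolding v_def using u2 by (auto intro!: divide_right_mono)
  qed
  have sand: "f \<longlonglongrightarrow> 0" if "\<forall>\<^sub>F n in sequentially. f n \<le> v n" "\<And>n. 0 \<le> f n" for f :: "nat \<Rightarrow> real"
    by (rule tendsto_sandwich[where f="\<lambda>_. 0" and h=v]) (use that v in auto)
  have kn0: "(\<lambda>n. real (k n) / real n) \<longlonglongrightarrow> 0" by (rule sand) (use vle in \<open>auto elim: eventually_mono\<close>)
  have ku0: "(\<lambda>n. real (k n) * (u n)\<^sup>2 / real n) \<longlonglongrightarrow> 0" by (rule sand) (use vle in \<open>auto elim: eventually_mono\<close>)
  have u2n: "(\<lambda>n. (u n)\<^sup>2 / real n) \<longlonglongrightarrow> 0" by (rule sand) (use vle in \<open>auto elim: eventually_mono\<close>)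
  have u4n: "(\<lambda>n. u n ^ 4 / real n) \<longlonglongrightarrow> 0" by (rule sand) (use vle in \<open>auto elim: eventually_mono\<close>)
  have n0: "(\<lambda>n. 1 / real n) \<longlonglongrightarrow> 0" using lim_inverse_n' by simp
  have rho: "\<rho> \<longlonglongrightarrow> 1" unfolding \<rho>_def using tendsto_add[OF tendsto_const[of 1] ku0] by simp
  have iu: "(\<lambda>n. 1 / (u n)\<^sup>2) \<longlonglongrightarrow> 0"
  proof -
    have "((\<lambda>y::real. 1 / y\<^sup>2) \<longlongrightarrow> 0) at_top" by real_asymp
    from filterlim_compose[OF this u] show ?thesis .
  qed
  have III: "III \<longlonglongrightarrow> 2"
  proof -
    have "(\<lambda>n. 2 * sqrt (\<rho> n) ^ 5 * exp (2 * v n / \<rho> n + (25 * (1 / real n) + 40 * ((u n)\<^sup>2 / real n) + 16 * (u n ^ 4 / real n)))) \<longlonglongrightarrow> 2 * sqrt 1 ^ 5 * exp (2 * 0 / 1 + (25 * 0 + 40 * 0 + 16 * 0))"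
      by (intro tendsto_intros rho v n0 u2n u4n) auto
    moreover have "III = (\<lambda>n. 2 * sqrt (\<rho> n) ^ 5 * exp (2 * v n / \<rho> n + (25 * (1 / real n) + 40 * ((u n)\<^sup>2 / real n) + 16 * (u n ^ 4 / real n))))"
    proof
      fix n
      have "4 * (5 / 2 + 2 * (u n)\<^sup>2)\<^sup>2 = 25 + 40 * (u n)\<^sup>2 + 16 * u n ^ 4" by (simp add: power2_eq_square power4_eq_xxxx algebra_simps)
      then show "III n = 2 * sqrt (\<rho> n) ^ 5 * exp (2 * v n / \<rho> n + (25 * (1 / real n) + 40 * ((u n)\<^sup>2 / real n) + 16 * (u n ^ 4 / real n)))"
        by (simp add: III_def v_def add_divide_distrib)
    qed
    ultimately show ?thesis by simp
  qed
  have ex: "(\<lambda>n. exp (c * (u n)\<^sup>2) / X n) \<longlonglongrightarrow> 0" for c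
  proof -
    have "(\<lambda>n. u n / sqrt (ln (X n))) \<longlonglongrightarrow> 0" using \<mu>(2) by (simp add: X_def u_def)
    from exp_square_powr_tendsto_0[OF X this, of 1 c] show ?thesis
      using X0 by (simp add: powr_minus less_imp_le divide_inverse)
  qed
  have II: "II \<longlonglongrightarrow> 0"
  proof -
    \<comment> \<open>A factor exp (- u^2) is split off to absorb u^5; the remaining exp (3 u^2) / X
      vanishes because u^2 = o(ln X).\<close>
    have "((\<lambda>y::real. y ^ 5 * exp (- y\<^sup>2)) \<longlongrightarrow> 0) at_top" by real_asymp
    from filterlim_compose[OF this u] have "(\<lambda>n. u n ^ 5 * exp (- (u n)\<^sup>2)) \<longlonglongrightarrow> 0" .
    then have "(\<lambda>n. 4 * sqrt (2 * pi) * ((u n ^ 5 * exp (- (u n)\<^sup>2)) * (exp (3 * (u n)\<^sup>2) / X n)) * (18 + 3 * (1 / (u n)\<^sup>2 + real (k n) / real n)))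
      \<longlonglongrightarrow> 4 * sqrt (2 * pi) * (0 * 0) * (18 + 3 * (0 + 0))"
      by (intro tendsto_intros ex iu kn0)
    moreover have "(u n ^ 5 * exp (- (u n)\<^sup>2)) * (exp (3 * (u n)\<^sup>2) / X n) = u n ^ 5 * exp (2 * (u n)\<^sup>2) / X n" for n
    proof -
      have "exp (- (u n)\<^sup>2) * exp (3 * (u n)\<^sup>2) = exp (2 * (u n)\<^sup>2)" unfolding exp_add[symmetric] by simp
      then show ?thesis by (simp only: times_divide_eq_right mult.assoc)
    qed
    ultimately show ?thesis by (simp only: II_def mult_zero_left mult_zero_right)
  qed
  have th: "(\<lambda>n. 12 * (2 * (u n)\<^sup>2 * exp (3 / 2 * (u n)\<^sup>2) / X n)) \<longlonglongrightarrow> 0"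
  proof -
    have "((\<lambda>y::real. y\<^sup>2 * exp (- y\<^sup>2)) \<longlongrightarrow> 0) at_top" by real_asymp
    from filterlim_compose[OF this u] have "(\<lambda>n. (u n)\<^sup>2 * exp (- (u n)\<^sup>2)) \<longlonglongrightarrow> 0" .
    then have "(\<lambda>n. 12 * (2 * ((u n)\<^sup>2 * exp (- (u n)\<^sup>2)) * (exp (5 / 2 * (u n)\<^sup>2) / X n))) \<longlonglongrightarrow> 12 * (2 * 0 * 0)"
      by (intro tendsto_intros ex)
    moreover have "12 * (2 * ((u n)\<^sup>2 * exp (- (u n)\<^sup>2)) * (exp (5 / 2 * (u n)\<^sup>2) / X n)) = 12 * (2 * (u n)\<^sup>2 * exp (3 / 2 * (u n)\<^sup>2) / X n)" for n
    proof -
      have "exp (- (u n)\<^sup>2) * exp (5 / 2 * (u n)\<^sup>2) = exp (3 / 2 * (u n)\<^sup>2)" unfolding exp_add[symmetric] by simp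
      then show ?thesis by (simp only: times_divide_eq_right mult.assoc)
    qed
    ultimately show ?thesis by (simp only: mult_zero_left mult_zero_right)
  qed
  have q: "q \<longlonglongrightarrow> 0"
  proof -
    have "(\<lambda>n. sqrt (u n ^ 4 / real n)) \<longlonglongrightarrow> sqrt 0" by (intro tendsto_intros u4n)
    moreover have "sqrt (u n ^ 4 / real n) = q n" for n
    proof -
      have "u n ^ 4 = ((u n)\<^sup>2)\<^sup>2" by (simp add: power2_eq_square power4_eq_xxxx)
      then show ?thesis by (simp only: q_def real_sqrt_divide real_sqrt_abs abs_power2)
    qed
    ultimately show ?thesis by simp
  qed
  have sq: "(\<lambda>n. sqrt (q n)) \<longlonglongrightarrow> 0" using tendsto_real_sqrt[OF q] by simp
  have dt: "d \<longlonglongrightarrow> 0" using tendsto_mult[OF sq iu] by (simp add: d_def)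
  have ed: "\<forall>\<^sub>F n in sequentially. d n < 1 / 2" by (rule order_tendstoD(2)[OF dt]) simp
  have u2d: "(u n)\<^sup>2 * d n = sqrt (q n)" for n using u0[of n] by (simp add: d_def)
  have qpos: "0 < q n" if "0 < n" for n
    unfolding q_def using that u0[of n] by (intro divide_pos_pos zero_less_power) auto
  have d0: "0 < d n" if "0 < n" for n
    unfolding d_def using qpos[OF that] u0[of n] by (intro divide_pos_pos zero_less_power) auto
  have P: "P \<longlonglongrightarrow> 1"
  proof -
    have "filterlim (\<lambda>n. inverse (sqrt (q n))) at_top sequentially"
    proof (rule filterlim_inverse_at_top[OF sq])
      show "\<forall>\<^sub>F n in sequentially. 0 < sqrt (q n)"
        using eventually_gt_at_top[of 0] by eventually_elim (simp add: qpos)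
    qed
    moreover have "((\<lambda>y::real. 1 - 2 * exp (4 - y)) \<longlongrightarrow> 1) at_top" by real_asymp
    ultimately have "(\<lambda>n. 1 - 2 * exp (4 - inverse (sqrt (q n)))) \<longlonglongrightarrow> 1" by (rule filterlim_compose[rotated])
    moreover have "\<forall>\<^sub>F n in sequentially. 1 - 2 * exp (4 - inverse (sqrt (q n))) = P n"
      using eventually_gt_at_top[of 0]
    proof eventually_elim
      case (elim n)
      have q0: "0 < q n" using elim by (rule qpos)
      \<comment> \<open>The window d exceeds the fluctuation scale 1 / sqrt n of A by the factor 1 /
        sqrt q, which tends to infinity.\<close>
      have "sqrt (real n) * d n = sqrt (q n) / q n" using elim u0[of n] by (simp add: d_def q_def)
      also have "\<dots> = inverse (sqrt (q n))" using q0 by (intro sqrt_divide_self_eq) simp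
      finally show ?case by (simp add: P_def)
    qed
    ultimately show ?thesis by (rule Lim_transform_eventually)
  qed
  define J where "J = (\<lambda>n. (u n)\<^sup>2 * exp ((u n)\<^sup>2 / 2) * sqrt (2 * pi) * excess_bound (u n) (d n))"
  have J: "J \<longlonglongrightarrow> 1"
  proof -
    have "((\<lambda>y::real. 2 * (y\<^sup>2 * exp (- 7 / 2 * y\<^sup>2))) \<longlongrightarrow> 0) at_top" by real_asymp
    from filterlim_compose[OF this u] have t2: "(\<lambda>n. 2 * ((u n)\<^sup>2 * exp (- 7 / 2 * (u n)\<^sup>2))) \<longlonglongrightarrow> 0" .
    have "(\<lambda>n. (1 - d n) * (exp (- (sqrt (q n) * (3 + d n) / (1 - d n) / 2)) *
        ((1 - d n) / (1 + d n)\<^sup>2 - 3 * ((1 - d n) / (1 + d n)\<^sup>2)\<^sup>2 * (1 / (u n)\<^sup>2))) - 2 * ((u n)\<^sup>2 * exp (- 7 / 2 * (u n)\<^sup>2)))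
      \<longlonglongrightarrow> (1 - 0) * (exp (- (0 * (3 + 0) / (1 - 0) / 2)) * ((1 - 0) / (1 + 0)\<^sup>2 - 3 * ((1 - 0) / (1 + 0)\<^sup>2)\<^sup>2 * 0)) - 0"
      by (intro tendsto_intros dt sq iu t2) auto
    moreover have "\<forall>\<^sub>F n in sequentially. (1 - d n) * (exp (- (sqrt (q n) * (3 + d n) / (1 - d n) / 2)) *
        ((1 - d n) / (1 + d n)\<^sup>2 - 3 * ((1 - d n) / (1 + d n)\<^sup>2)\<^sup>2 * (1 / (u n)\<^sup>2))) - 2 * ((u n)\<^sup>2 * exp (- 7 / 2 * (u n)\<^sup>2)) = J n"
      using ed eventually_gt_at_top[of 0]
    proof eventually_elim
      case (elim n)
      define D where "D = d n"
      define w where "w = u n"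
      define C where "C = w * (1 + D) / sqrt (1 - D)"
      have D: "0 < D" "D < 1 / 2" using elim d0[of n] by (auto simp: D_def)
      have w: "0 < w" using u0[of n] by (simp add: w_def)
      have C2: "C\<^sup>2 = w\<^sup>2 * ((1 + D)\<^sup>2 / (1 - D))" using D by (simp add: C_def power_divide power_mult_distrib)
      have C4: "C ^ 4 = (w\<^sup>2 * ((1 + D)\<^sup>2 / (1 - D)))\<^sup>2" unfolding C2[symmetric] by (simp add: power2_eq_square power4_eq_xxxx)
      have i2: "w\<^sup>2 * (1 / C\<^sup>2) = (1 - D) / (1 + D)\<^sup>2" unfolding C2 using w D by (simp add: field_simps)
      have i4: "w\<^sup>2 * (3 / C ^ 4) = 3 * ((1 - D) / (1 + D)\<^sup>2)\<^sup>2 * (1 / w\<^sup>2)" unfolding C4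
        using w by (simp add: power_mult_distrib power_divide power2_eq_square)
      \<comment> \<open>The difference is of order w^2 D = sqrt q and so tends to 0: evaluating the
        density at C instead of w costs a factor that tends to 1.\<close>
      have "C\<^sup>2 - w\<^sup>2 = w\<^sup>2 * D * (3 + D) / (1 - D)" unfolding C2 using D by (simp add: field_simps power2_eq_square)
      also have "w\<^sup>2 * D = sqrt (q n)" using u2d[of n] by (simp add: w_def D_def)
      finally have cw: "w\<^sup>2 / 2 + - C\<^sup>2 / 2 = - (sqrt (q n) * (3 + D) / (1 - D) / 2)" by (simp add: field_simps)
      have e1: "exp (w\<^sup>2 / 2) * exp (- C\<^sup>2 / 2) = exp (- (sqrt (q n) * (3 + D) / (1 - D) / 2))"
        unfolding exp_add[symmetric] cw ..
      \<comment> \<open>The far tail contributes exp (- 4 w^2), which beats the normalising factor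
        exp (w^2 / 2).\<close>
      have s8: "(2 * sqrt 2 * w)\<^sup>2 = 8 * w\<^sup>2" by (simp add: power_mult_distrib)
      have e2: "exp (w\<^sup>2 / 2) * exp (- (2 * sqrt 2 * w)\<^sup>2 / 2) = exp (- 7 / 2 * w\<^sup>2)"
        unfolding s8 exp_add[symmetric] by (simp add: field_simps)
      have sp: "sqrt (2 * pi) * (1 / sqrt (2 * pi)) = 1" by simp
      have "J n = w\<^sup>2 * exp (w\<^sup>2 / 2) * sqrt (2 * pi) * ((1 - D) * ((1 / sqrt (2 * pi)) * exp (- C\<^sup>2 / 2) * (1 / C\<^sup>2 - 3 / C ^ 4))
            - 2 * ((1 / sqrt (2 * pi)) * exp (- (2 * sqrt 2 * w)\<^sup>2 / 2)))"
        by (simp only: J_def excess_bound_def w_def[symmetric] D_def[symmetric] C_def[symmetric] std_normal_density_def)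
      also have "\<dots> = (sqrt (2 * pi) * (1 / sqrt (2 * pi))) * ((1 - D) * ((exp (w\<^sup>2 / 2) * exp (- C\<^sup>2 / 2)) * (w\<^sup>2 * (1 / C\<^sup>2) - w\<^sup>2 * (3 / C ^ 4)))
            - 2 * (w\<^sup>2 * (exp (w\<^sup>2 / 2) * exp (- (2 * sqrt 2 * w)\<^sup>2 / 2))))"
        by (simp only: right_diff_distrib left_diff_distrib ac_simps)
      finally show ?case unfolding sp e1 e2 i2 i4 by (simp add: w_def D_def)
    qed
    ultimately show ?thesis using Lim_transform_eventually by fastforce
  qed
  have I: "I \<longlonglongrightarrow> 4"
  proof -
    have "(\<lambda>n. 4 * J n * P n) \<longlonglongrightarrow> 4 * 1 * 1" by (intro tendsto_intros J P)
    then show ?thesis by (simp add: I_def J_def)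
  qed
  define e where "e = (\<lambda>n. I n - II n - III n - 2)"
  have "e \<longlonglongrightarrow> 4 - 0 - 2 - 2" unfolding e_def by (intro tendsto_intros I II III)
  then have e: "e \<longlonglongrightarrow> 0" by simp
  have sm: "\<forall>\<^sub>F n in sequentially. 5 / 2 * (1 / real n) + 2 * ((u n)\<^sup>2 / real n) < 1 / 4"
  proof -
    have "(\<lambda>n. 5 / 2 * (1 / real n) + 2 * ((u n)\<^sup>2 / real n)) \<longlonglongrightarrow> 5 / 2 * 0 + 2 * 0" by (intro tendsto_intros n0 u2n)
    from order_tendstoD(2)[OF this, of "1 / 4"] show ?thesis by simp
  qed
  have "\<forall>\<^sub>F n in sequentially.
          let l = 4 * \<tau> n;
              g = real (p n) * (\<sigma> n)\<^sup>2 / (2 * real (k n) * (\<tau> n)\<^sup>2)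
                    * exp (- (3 * (\<tau> n)\<^sup>2 / (2 * (\<sigma> n)\<^sup>2))) - 1
          in enet_estimators n (p n) l g \<noteq> {} \<and>
             (\<forall>h \<in> enet_estimators n (p n) l g.
               max_risk n (p n) (k n) (\<tau> n) (\<sigma> n) h \<le>
                 ennreal (real (k n) * (\<tau> n)\<^sup>2 *
                   (1 - (2 + e n) / sqrt (2 * pi) * (real (k n) / real (p n))
                        * (\<sigma> n / \<tau> n) * exp ((\<tau> n)\<^sup>2 / (\<sigma> n)\<^sup>2))))"
    using sm en order_tendstoD(2)[OF th, of 1, OF zero_less_one] ed
      order_tendstoD(1)[OF J, of 0, OF zero_less_one] order_tendstoD(1)[OF P, of 0, OF zero_less_one]
  proof eventually_elim
    case (elim n)
    define g where "g = real (p n) * (\<sigma> n)\<^sup>2 / (2 * real (k n) * (\<tau> n)\<^sup>2) * exp (- (3 * (\<tau> n)\<^sup>2 / (2 * (\<sigma> n)\<^sup>2))) - 1"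
    have g: "g = X n / (2 * (u n)\<^sup>2) * exp (- (3 / 2 * (u n)\<^sup>2)) - 1"
      using pos[of n] by (simp add: g_def X_def u_def power_divide)
    have g1: "- 1 < g" unfolding g using X0[of n] u0[of n] by simp
    have l: "0 \<le> 4 * \<tau> n" using pos(2)[of n] by simp
    interpret gaussian_column n "\<tau> n" "\<sigma> n" by unfold_locales (use elim pos[of n] in auto)
    have kp: "0 < k n" "0 < p n" using k(1)[of n] k(2)[of n] by auto
    have nn: "0 < real n" using elim by simp
    have small: "5 / 2 + 2 * (u n)\<^sup>2 \<le> real n / 4"
    proof -
      have "(5 / 2 * (1 / real n) + 2 * ((u n)\<^sup>2 / real n)) * real n \<le> 1 / 4 * real n" using elim by (intro mult_right_mono) auto
      then show ?thesis using nn by (simp add: distrib_right)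
    qed
    \<comment> \<open>J is a nonnegative multiple of \<open>excess_bound\<close> and tends to 1,
      which decides the sign.\<close>
    have K: "0 \<le> excess_bound (u n) (d n)"
    proof (rule ccontr)
      assume "\<not> 0 \<le> excess_bound (u n) (d n)"
      then have "J n \<le> 0" unfolding J_def by (intro mult_nonneg_nonpos) auto
      then show False using elim by simp
    qed
    have "max_risk n (p n) (k n) (\<tau> n) (\<sigma> n) h \<le>
        ennreal (real (k n) * (\<tau> n)\<^sup>2 * (1 - (2 + e n) / sqrt (2 * pi) * (real (k n) / real (p n)) * (\<sigma> n / \<tau> n) * exp ((\<tau> n)\<^sup>2 / (\<sigma> n)\<^sup>2)))"
      if h: "h \<in> enet_estimators n (p n) (4 * \<tau> n) g" for h
    proof -
      have "2 + e n = I n - II n - III n" by (simp add: e_def)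
      moreover have "(\<tau> n)\<^sup>2 / (\<sigma> n)\<^sup>2 = (u n)\<^sup>2" by (simp add: u_def power_divide)
      ultimately show ?thesis
        using enet_max_risk_normalized[OF kp, of "u n" "X n" g "d n" "P n" h "\<rho> n" "I n" "II n" "III n"]
          g elim d0[of n] K small h nn
        by (simp only: u_def X_def P_def \<rho>_def I_def II_def III_def)
    qed
    then show ?case using enet_estimators_eq(1)[OF l g1] unfolding Let_def g_def[symmetric] by blast
  qed
  then show ?thesis using e by blast
qed

theorem theorem4:
  fixes p k :: "nat \<Rightarrow> nat" and \<sigma> \<tau> :: "nat \<Rightarrow> real"
  assumes "\<And>n. 1 \<le> k n" and "\<And>n. k n \<le> p n"
    and "\<And>n. \<sigma> n > 0" and "\<And>n. \<tau> n > 0"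
    and "(\<lambda>n. real (k n) / real (p n)) \<longlonglongrightarrow> 0"
    and "filterlim (\<lambda>n. \<tau> n / \<sigma> n) at_top sequentially"
    and "(\<lambda>n. (\<tau> n / \<sigma> n) / sqrt (ln (real (p n) / real (k n)))) \<longlonglongrightarrow> 0"
  shows
    "((\<lambda>n. ln (real (p n) / real (k n)) / real n) \<longlonglongrightarrow> 0 \<and>
      (\<lambda>n. \<tau> n ^ 4 / (real n * \<sigma> n ^ 4)) \<longlonglongrightarrow> 0 \<longrightarrow>
      (\<exists>\<epsilon>::nat \<Rightarrow> real. \<epsilon> \<longlonglongrightarrow> 0 \<and>
        (\<forall>\<^sub>F n in sequentially.
          minimax_risk n (p n) (k n) (\<tau> n) (\<sigma> n) \<ge>
            ennreal (real (k n) * (\<tau> n)\<^sup>2 *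
              (1 - (1 + \<epsilon> n) / 2 * (real (k n) / real (p n)) * exp ((\<tau> n)\<^sup>2 / (\<sigma> n)\<^sup>2))))))
     \<and>
     ((\<lambda>n. real (k n) * (ln (real (p n) / real (k n)))\<^sup>2 / real n) \<longlonglongrightarrow> 0 \<and>
      (\<exists>\<alpha>>0. \<forall>\<^sub>F n in sequentially. (real (p n) / real (k n)) powr \<alpha> \<le> real n) \<longrightarrow>
      (\<exists>\<epsilon>::nat \<Rightarrow> real. \<epsilon> \<longlonglongrightarrow> 0 \<and>
        (\<forall>\<^sub>F n in sequentially.
          let l = 4 * \<tau> n;
              g = real (p n) * (\<sigma> n)\<^sup>2 / (2 * real (k n) * (\<tau> n)\<^sup>2)
                    * exp (- (3 * (\<tau> n)\<^sup>2 / (2 * (\<sigma> n)\<^sup>2))) - 1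
          in enet_estimators n (p n) l g \<noteq> {} \<and>
             (\<forall>h \<in> enet_estimators n (p n) l g.
               max_risk n (p n) (k n) (\<tau> n) (\<sigma> n) h \<le>
                 ennreal (real (k n) * (\<tau> n)\<^sup>2 *
                   (1 - (2 + \<epsilon> n) / sqrt (2 * pi) * (real (k n) / real (p n))
                        * (\<sigma> n / \<tau> n) * exp ((\<tau> n)\<^sup>2 / (\<sigma> n)\<^sup>2)))))))"
proof -
  have k: "1 \<le> k n" "k n \<le> p n" and pos: "\<sigma> n > 0" "\<tau> n > 0" for n
    using assms by auto
  have x: "filterlim (\<lambda>n. real (p n) / real (k n)) at_top sequentially"
  proof -
    have "0 < real (k n) / real (p n)" for n using k[of n] by simp
    then have "filterlim (\<lambda>n. inverse (real (k n) / real (p n))) at_top sequentially"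
      by (intro filterlim_inverse_at_top[OF assms(5)] always_eventually) auto
    then show ?thesis by simp
  qed
  show ?thesis
    using minimax_risk_asymptotic_lower_bound[OF k pos x assms(6,7)]
      enet_asymptotic_upper_bound[OF k pos x assms(6,7)] by blast
qed

end
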